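(* Let $A(n)$ be one of the $15$ known sporadic Apéry-like sequences $\mathbf{A},\mathbf{B},\mathbf{C},\mathbf{D},\mathbf{E},\mathbf{F}$, $(\alpha),(\gamma),(\delta),(\epsilon),(\eta),(\zeta)$, $s_7,s_{10},s_{18}$, and let $A'(n)$ denote its formal derivative. Then, for all primes $p\geq 3$ and all integers $n,k$ with $n\geq 0$ and $0\leq k<p$, $$A(pn+k)\equiv A(k)A(n)+pn\,A'(k)A(n)\pmod{p^2}.$$
   Context: The $15$ known sporadic Apéry-like sequences are the following integer sequences $A(n)$, $n\ge 0$ (it is known that all their terms are integers), each determined by a three-term recurrence valid for all integers $n\geq 0$ together with the initial conditions $A(-1)=0$, $A(0)=1$. (1) Zagier's six sequences satisfy $$(n+1)^2A(n+1)=(an^2+an+b)A(n)-cn^2A(n-1),$$ with $(a,b,c)$ equal to: $\mathbf{A}$: $(7,2,-8)$; $\mathbf{B}$: $(9,3,27)$; $\mathbf{C}$: $(10,3,9)$; $\mathbf{D}$: $(11,3,-1)$; $\mathbf{E}$: $(12,4,32)$; $\mathbf{F}$: $(17,6,72)$. (2) The six sequences of Almkvist--Zudilin and the three sequences of Cooper satisfy $$(n+1)^3A(n+1)=(2n+1)(an^2+an+b)A(n)-n(cn^2+d)A(n-1),$$ with $(a,b,c,d)$ equal to: $(\alpha)$: $(10,4,64,0)$; $(\gamma)$: $(17,5,1,0)$; $(\delta)$: $(7,3,81,0)$; $(\epsilon)$: $(12,4,16,0)$; $(\eta)$: $(11,5,125,0)$; $(\zeta)$: $(9,3,-27,0)$;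 $s_7$: $(13,4,-27,3)$; $s_{10}$: $(6,2,-64,4)$; $s_{18}$: $(14,6,192,-12)$. For example, $(\gamma)$ is $\sum_{k=0}^n\binom{n}{k}^2\binom{n+k}{k}^2$; $\mathbf{D}$ is $\sum_{k=0}^n\binom{n}{k}^2\binom{n+k}{k}$; $\mathbf{F}$ is $\sum_{k=0}^n(-1)^k8^{n-k}\binom{n}{k}\sum_{l=0}^k\binom{k}{l}^3$; and $(\delta)$ is $\sum_{k=0}^n(-1)^k3^{n-3k}\binom{n}{3k}\binom{n+k}{n}\frac{(3k)!}{k!^3}$ (terms with $3k>n$ being zero). Formal derivative. Write the recurrence of $A$ as $\sum_{j=0}^{2}c_j(n)A(n-j)=0$ with polynomials $c_j(n)\in\mathbb{Z}[n]$, where in case (1) $c_0(n)=n^2$, $c_1(n)=-(a(n-1)^2+a(n-1)+b)$, $c_2(n)=c(n-1)^2$, and in case (2) $c_0(n)=n^3$, $c_1(n)=-(2n-1)(a(n-1)^2+a(n-1)+b)$, $c_2(n)=(n-1)(c(n-1)^2+d)$. With $A(j)=0$ for $j<0$, the formal derivative $A'(n)$ is the unique sequence of rational numbers with $A'(j)=0$ for all $j\leq 0$ and $$\sum_{j=0}^{2}c_j(n)A'(n-j)+\sum_{j=0}^{2}c_j'(n)A(n-j)=0\quad\text{for all } n\geq 1,$$ where $c_j'$ is the ordinary derivative of the polynomial $c_j$. For $0\le k<p$ the number $A'(k)$ is a rational number whose denominator is not divisible by $p$; the congruence modulo $p^2$ is understood in the ring of rational numbers with denominator prime to $p$ (equivalently,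 in $\mathbb{Z}_p$). *)

theory Defs
  imports Complex_Main "HOL-Computational_Algebra.Polynomial"
    "HOL-Computational_Algebra.Primes"
begin

text \<open>\<open>Quadratic a b c\<close> stands for
  \<open>(n+1)\<^sup>2 A(n+1) = (a n\<^sup>2 + a n + b) A(n) - c n\<^sup>2 A(n-1)\<close> and \<open>Cubic a b c d\<close> for
  \<open>(n+1)\<^sup>3 A(n+1) = (2n+1) (a n\<^sup>2 + a n + b) A(n) - n (c n\<^sup>2 + d) A(n-1)\<close>.\<close>

datatype apery_rec = Quadratic int int int | Cubic int int int int

definition zagier :: "apery_rec set" where
  "zagier =
    {Quadratic 7 2 (-8),    \<comment> \<open>A\<close>
     Quadratic 9 3 27,      \<comment> \<open>B\<close>
     Quadratic 10 3 9,      \<comment> \<open>C\<close>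
     Quadratic 11 3 (-1),   \<comment> \<open>D\<close>
     Quadratic 12 4 32,     \<comment> \<open>E\<close>
     Quadratic 17 6 72}     \<comment> \<open>F\<close>"

definition almkvist_zudilin :: "apery_rec set" where
  "almkvist_zudilin =
    {Cubic 10 4 64 0,       \<comment> \<open>\<open>\<alpha>\<close>\<close>
     Cubic 17 5 1 0,        \<comment> \<open>\<open>\<gamma>\<close>\<close>
     Cubic 7 3 81 0,        \<comment> \<open>\<open>\<delta>\<close>\<close>
     Cubic 12 4 16 0,       \<comment> \<open>\<open>\<epsilon>\<close>\<close>
     Cubic 11 5 125 0,      \<comment> \<open>\<open>\<eta>\<close>\<close>
     Cubic 9 3 (-27) 0}     \<comment> \<open>\<open>\<zeta>\<close>\<close>"

definition cooper :: "apery_rec set" where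
  "cooper =
    {Cubic 13 4 (-27) 3,    \<comment> \<open>\<open>s\<^sub>7\<close>\<close>
     Cubic 6 2 (-64) 4,     \<comment> \<open>\<open>s\<^sub>1\<^sub>0\<close>\<close>
     Cubic 14 6 192 (-12)}  \<comment> \<open>\<open>s\<^sub>1\<^sub>8\<close>\<close>"

definition sporadic :: "apery_rec set" where
  "sporadic = zagier \<union> almkvist_zudilin \<union> cooper"

fun satisfies_rec :: "apery_rec \<Rightarrow> (int \<Rightarrow> rat) \<Rightarrow> bool" where
  "satisfies_rec (Quadratic a b c) A \<longleftrightarrow>
     (\<forall>n\<ge>0. of_int ((n + 1)^2) * A (n + 1)
        = of_int (a * n^2 + a * n + b) * A n - of_int (c * n^2) * A (n - 1))"
| "satisfies_rec (Cubic a b c d) A \<longleftrightarrow>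
     (\<forall>n\<ge>0. of_int ((n + 1)^3) * A (n + 1)
        = of_int ((2 * n + 1) * (a * n^2 + a * n + b)) * A n
          - of_int (n * (c * n^2 + d)) * A (n - 1))"

text \<open>The sequence takes rational values, so that its integrality is not built into the
  definition. It is extended by \<open>0\<close> to all negative indices.\<close>

definition apery_seq :: "apery_rec \<Rightarrow> (int \<Rightarrow> rat) \<Rightarrow> bool" where
  "apery_seq r A \<longleftrightarrow> (\<forall>j<0. A j = 0) \<and> A 0 = 1 \<and> satisfies_rec r A"

text \<open>The polynomials \<open>c\<^sub>0, c\<^sub>1, c\<^sub>2\<close> of the recurrence in the form
  \<open>c\<^sub>0(n) A(n) + c\<^sub>1(n) A(n-1) + c\<^sub>2(n) A(n-2) = 0\<close>, i.e. after shifting \<open>n\<close> by one;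
  \<open>[:-1, 1:]\<close> is \<open>n - 1\<close>.\<close>

fun rec_coeff :: "apery_rec \<Rightarrow> nat \<Rightarrow> int poly" where
  "rec_coeff (Quadratic a b c) j =
     (if j = 0 then [:0, 1:]^2
      else if j = 1 then - (smult a ([:-1, 1:]^2) + smult a [:-1, 1:] + [:b:])
      else if j = 2 then smult c ([:-1, 1:]^2)
      else 0)"
| "rec_coeff (Cubic a b c d) j =
     (if j = 0 then [:0, 1:]^3
      else if j = 1 then - ([:-1, 2:] * (smult a ([:-1, 1:]^2) + smult a [:-1, 1:] + [:b:]))
      else if j = 2 then [:-1, 1:] * (smult c ([:-1, 1:]^2) + [:d:])
      else 0)"

definition formal_derivative :: "apery_rec \<Rightarrow> (int \<Rightarrow> rat) \<Rightarrow> (int \<Rightarrow> rat) \<Rightarrow> bool" where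
  "formal_derivative r A A' \<longleftrightarrow>
     (\<forall>j\<le>0. A' j = 0) \<and>
     (\<forall>n\<ge>1. (\<Sum>j\<le>2. of_int (poly (rec_coeff r j) n) * A' (n - int j))
            + (\<Sum>j\<le>2. of_int (poly (pderiv (rec_coeff r j)) n) * A (n - int j)) = 0)"

text \<open>The ring of rational numbers with denominator prime to \<open>p\<close> (for prime \<open>p\<close>), and
  congruence in it; \<open>quotient_of\<close> is the fraction in lowest terms.\<close>

definition localization :: "nat \<Rightarrow> rat set" where
  "localization p = {x. \<not> int p dvd snd (quotient_of x)}"

definition cong_localization :: "nat \<Rightarrow> rat \<Rightarrow> rat \<Rightarrow> nat \<Rightarrow> bool" where
  "cong_localization p x y m \<longleftrightarrow>
     x \<in> localization p \<and> y \<in> localization p \<and> (\<exists>z\<in>localization p. x - y = of_nat m * z)"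


text \<open>The two recurrences agree, and both sequences exist and are unique.\<close>

lemma satisfies_rec_iff:
  "satisfies_rec r A \<longleftrightarrow>
     (\<forall>n\<ge>1. (\<Sum>j\<le>2. of_int (poly (rec_coeff r j) n) * A (n - int j)) = 0)"
proof -
  have shift: "(\<forall>n\<ge>1::int. P n) \<longleftrightarrow> (\<forall>n\<ge>0. P (n + 1))" for P
  proof safe
    fix n :: int assume "\<forall>n\<ge>0. P (n + 1)" "n \<ge> 1"
    then have "P ((n - 1) + 1)" by (metis diff_ge_0_iff_ge)
    then show "P n" by simp
  qed simp
  show ?thesis
    unfolding shift
    by (cases r) (auto simp: numeral_2_eq_2 algebra_simps power2_eq_square power3_eq_cube)
qed

fun solution :: "(nat \<Rightarrow> int \<Rightarrow> rat) \<Rightarrow> (int \<Rightarrow> rat) \<Rightarrow> rat \<Rightarrow> nat \<Rightarrow> rat" where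
  "solution c g v 0 = v"
| "solution c g v (Suc 0) = - (c 1 1 * v + g 1) / c 0 1"
| "solution c g v (Suc (Suc n)) =
     - (c 1 (int n + 2) * solution c g v (Suc n) + c 2 (int n + 2) * solution c g v n
        + g (int n + 2)) / c 0 (int n + 2)"

lemma recurrence_ex1:
  fixes c :: "nat \<Rightarrow> int \<Rightarrow> rat"
  assumes c0: "\<And>n. n \<ge> 1 \<Longrightarrow> c 0 n \<noteq> 0"
  shows "\<exists>!F. (\<forall>j<0. F j = 0) \<and> F 0 = v \<and> (\<forall>n\<ge>1. (\<Sum>j\<le>2. c j n * F (n - int j)) + g n = 0)"
    (is "\<exists>!F. ?P F")
proof (rule ex_ex1I)
  define F where "F = (\<lambda>j. if j < 0 then 0 else solution c g v (nat j))"
  have "(\<Sum>j\<le>2. c j n * F (n - int j)) + g n = 0" if "n \<ge> 1" for n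
  proof (cases "n = 1")
    case True
    then show ?thesis
      using c0[of 1] by (simp add: F_def numeral_2_eq_2 field_simps)
  next
    case False
    then have *: "n = int (nat (n - 2)) + 2" using that by simp
    define m where "m = nat (n - 2)"
    have n: "n = int m + 2" using * by (simp add: m_def)
    have "nat (int m + 2) = Suc (Suc m)" "nat (int m + 1) = Suc m" by simp_all
    then show ?thesis
      using c0[OF that] unfolding n
      by (simp add: F_def numeral_2_eq_2 atMost_Suc field_simps)
  qed
  then have "?P F" by (auto simp: F_def)
  then show "\<exists>F. ?P F" by (rule exI[of _ F])
next
  fix F G assume F: "?P F" and G: "?P G"
  have "F (int n) = G (int n)" for n
  proof (induction n rule: less_induct)
    case (less n)
    show ?case
    proof (cases n)
      case 0
      then show ?thesis using F G by simp
    next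
      case (Suc m)
      have eq: "F (int n - int j) = G (int n - int j)" if "j > 0" for j
      proof (cases "j \<le> n")
        case True
        then show ?thesis using less[of "n - j"] that Suc by (simp add: of_nat_diff)
      next
        case False
        then show ?thesis using F G by simp
      qed
      have "(\<Sum>j\<le>2. c j (int n) * F (int n - int j)) = (\<Sum>j\<le>2. c j (int n) * G (int n - int j))"
      proof -
        have "int n \<ge> 1" using Suc by simp
        then have "(\<Sum>j\<le>2. c j (int n) * F (int n - int j)) + g (int n) = 0"
          and "(\<Sum>j\<le>2. c j (int n) * G (int n - int j)) + g (int n) = 0"
          using F G by blast+
        then show ?thesis by (metis add_right_cancel)
      qed
      then have "c 0 (int n) * F (int n) = c 0 (int n) * G (int n)"
        using eq[of 1] eq[of 2] by (simp add: numeral_2_eq_2)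
      then show ?thesis using c0[of "int n"] Suc by simp
    qed
  qed
  then have "F j = G j" for j
    using F G by (cases j rule: int_cases) auto
  then show "F = G" by (rule ext)
qed

lemma rec_coeff_0_nonzero: "n \<ge> 1 \<Longrightarrow> poly (rec_coeff r 0) n \<noteq> 0"
  by (cases r) auto

lemma apery_seq_ex1: "\<exists>!A. apery_seq r A"
  using recurrence_ex1[of "\<lambda>j n. of_int (poly (rec_coeff r j) n)" 1 "\<lambda>_. 0"]
  by (simp add: apery_seq_def satisfies_rec_iff rec_coeff_0_nonzero)

lemma formal_derivative_ex1: "\<exists>!A'. formal_derivative r A A'"
proof -
  have *: "(\<forall>j\<le>0. F j = (0::rat)) \<longleftrightarrow> (\<forall>j<0. F j = 0) \<and> F 0 = 0" for F :: "int \<Rightarrow> rat"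
    by (auto simp: le_less)
  show ?thesis
    using recurrence_ex1[of "\<lambda>j n. of_int (poly (rec_coeff r j) n)" 0
        "\<lambda>n. \<Sum>j\<le>2. of_int (poly (pderiv (rec_coeff r j)) n) * A (n - int j)"]
    unfolding formal_derivative_def * conj_assoc
    by (simp add: rec_coeff_0_nonzero)
qed

end

theory Submission
  imports Defs "HOL-Number_Theory.Cong"
begin

text \<open>Expand the coefficients of the recurrence at \<open>p n + k\<close> to first order in \<open>p n\<close>: since \<open>c\<^sub>0(k)\<close> is a
  unit for \<open>0 < k < p\<close>, induction on \<open>k\<close> reduces the theorem to the supercongruence \<open>A(p n) \<equiv> A(n)\<close> modulo \<open>p\<^sup>2\<close>,
  together with \<open>p dvd A(p - 1)\<close> when \<open>d \<noteq> 0\<close>, because \<open>c\<^sub>2(p n + 1)\<close> is then divisible by \<open>p\<close> only. For the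
  supercongruence each sequence is written as a binomial sum. In most cases the summands with index prime
  to \<open>p\<close> vanish modulo \<open>p\<^sup>2\<close> and Babbage's congruence treats the others. The sums for \<open>B\<close>, \<open>F\<close> and \<open>\<delta>\<close>
  contain powers of \<open>3\<close> or \<open>8\<close>: there the defect \<open>c\<^bsup>p\<^esup> - c\<close> has to cancel against the remaining
  summands, which amounts to evaluating a Fermat quotient modulo \<open>p\<close>.\<close>

section \<open>Creative telescoping\<close>

text \<open>Over numbers \<open>x + h y\<close> with \<open>h^2 = 0\<close>, the definition of
  \<open>A'\<close> says that \<open>A(k) + h A'(k)\<close> solves the recurrence with
  \<open>k\<close> replaced by \<open>k + h\<close>. With \<open>h = p n\<close>, this prediction
  times \<open>A(n)\<close> obeys the true recurrence at \<open>p n + k\<close> modulo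
  \<open>p^2\<close>. For nonzero \<open>d\<close> the same induction is first run modulo
  \<open>p\<close>, where \<open>c_2(p n + 1)\<close> already vanishes; it gives
  \<open>A(p n - 1) = A(n - 1) A(p - 1)\<close> modulo \<open>p\<close>, hence the second factor
  \<open>p\<close>. The cancellation for sums with weights \<open>c^(N - d k)\<close> is uniform in
  \<open>n\<close>: the defect of the summand at \<open>p k\<close> carries the factor
  \<open>n - d k\<close> from the exponent, and the summands at \<open>p j + i\<close> carry
  \<open>n (n - 1 choose d j) = (n - d j) (n choose d j)\<close> from absorption. Both parts are the
  same linear form in the summands for \<open>n\<close>, so one congruence free of \<open>n\<close>
  remains for each \<open>c\<close>. For \<open>c = 3\<close> it comes from shifted Legendre
  polynomials and a harmonic number, for \<open>c = 8\<close> from exact sums over Franel numbers.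
  The prime 3, where the weight 3 is not a unit, is treated directly.\<close>

text \<open>Here \<open>x\<close> is the rational certificate found by Zeilberger's algorithm, with its denominator moved into \<open>D\<close>;
  keeping \<open>\<tau>\<close> separate from the summand \<open>t\<close> avoids quotients that are undefined at the boundary.\<close>

lemma creative_telescoping:
  fixes t :: "nat \<Rightarrow> nat \<Rightarrow> rat" and \<tau> :: "nat \<Rightarrow> rat" and x qa qb qc D N :: "rat \<Rightarrow> rat"
  assumes supp: "\<And>m k. k > m \<Longrightarrow> t m k = 0"
    and terms: "\<And>k. t n k = qa (of_nat k) * \<tau> k" "\<And>k. t (n + 1) k = qb (of_nat k) * \<tau> k"
      "\<And>k. t (n + 2) k = qc (of_nat k) * \<tau> k"
    and ratio: "\<And>k. D (of_nat k + 1) * \<tau> (Suc k) = N (of_nat k) * \<tau> k"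
    and boundary: "D 0 * \<tau> 0 = 0" "\<tau> (n + 3) = 0"
    and cert: "\<And>k. c0 * qa k + c1 * qb k + c2 * qc k = x (k + 1) * N k - x k * D k"
  shows "c0 * (\<Sum>k\<le>n. t n k) + c1 * (\<Sum>k\<le>n + 1. t (n + 1) k) + c2 * (\<Sum>k\<le>n + 2. t (n + 2) k) = 0"
proof -
  \<comment> \<open>The product \<open>x * D\<close> is the certificate without division, so
    \<open>G\<close> makes sense for every \<open>k\<close>; \<open>D 0 * \<tau> 0 = 0\<close> kills
    it at the lower end and \<open>\<tau> (n + 3) = 0\<close> at the upper one.\<close>
  define G where "G k = x (of_nat k) * D (of_nat k) * \<tau> k" for k
  \<comment> \<open>The range \<open>k < n + 3\<close> covers the supports of all three sums, so
    that a single telescoping sum serves them together.\<close>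
  have ext: "(\<Sum>k\<le>m. t m k) = (\<Sum>k<n + 3. t m k)" if "m \<le> n + 2" for m
    using that supp by (intro sum.mono_neutral_left) auto
  have "c0 * t n k + c1 * t (n + 1) k + c2 * t (n + 2) k = G (Suc k) - G k" for k
  proof -
    have "c0 * t n k + c1 * t (n + 1) k + c2 * t (n + 2) k
      = (c0 * qa (of_nat k) + c1 * qb (of_nat k) + c2 * qc (of_nat k)) * \<tau> k"
      unfolding terms by (simp add: algebra_simps)
    also have "\<dots> = x (of_nat k + 1) * (N (of_nat k) * \<tau> k) - G k"
      unfolding cert by (simp add: algebra_simps G_def)
    also have "\<dots> = G (Suc k) - G k"
      unfolding ratio[symmetric] by (simp add: G_def add.commute)
    finally show ?thesis .
  qed
  then have "c0 * (\<Sum>k<n + 3. t n k) + c1 * (\<Sum>k<n + 3. t (n + 1) k) + c2 * (\<Sum>k<n + 3. t (n + 2) k)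
    = (\<Sum>k<n + 3. G (Suc k) - G k)"
    by (simp only: sum_distrib_left sum.distrib[symmetric])
  also have "\<dots> = G (n + 3) - G 0" by (rule sum_lessThan_telescope)
  also have "\<dots> = 0" using boundary by (simp add: G_def)
  finally show ?thesis using ext[of n] ext[of "n + 1"] ext[of "n + 2"] by (simp only: le_add1 order_refl add_le_mono)
qed

text \<open>The recurrence is shifted by one, so that only the natural indices \<open>n\<close>,
  \<open>n + 1\<close>, \<open>n + 2\<close> occur, in the order in which
  \<open>creative_telescoping\<close> delivers them. The condition \<open>S 1 = b\<close> is the
  instance at the original index 0, where \<open>A (- 1)\<close> drops out.\<close>

fun nat_solution :: "apery_rec \<Rightarrow> (nat \<Rightarrow> rat) \<Rightarrow> bool" where
  "nat_solution (Quadratic a b c) S \<longleftrightarrow> S 0 = 1 \<and> S 1 = of_int b \<and> (\<forall>n.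
     of_int c * (of_nat n + 1)^2 * S n
     + - (of_int a * (of_nat n + 1)^2 + of_int a * (of_nat n + 1) + of_int b) * S (n + 1)
     + (of_nat n + 2)^2 * S (n + 2) = 0)"
| "nat_solution (Cubic a b c d) S \<longleftrightarrow> S 0 = 1 \<and> S 1 = of_int b \<and> (\<forall>n.
     (of_nat n + 1) * (of_int c * (of_nat n + 1)^2 + of_int d) * S n
     + - ((2 * of_nat n + 3) * (of_int a * (of_nat n + 1)^2 + of_int a * (of_nat n + 1) + of_int b)) * S (n + 1)
     + (of_nat n + 2)^3 * S (n + 2) = 0)"

text \<open>\<open>S\<close> extended by 0 to negative indices is again a solution, and solutions
  are unique by \<open>apery_seq_ex1\<close>. For integer-valued \<open>S\<close> this is also where
  integrality of the sequence comes from.\<close>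

lemma apery_seq_eqI:
  assumes A: "apery_seq r A" and S: "nat_solution r S"
  shows "A (int n) = S n"
proof -
  define B where "B j = (if j < 0 then 0 else S (nat j))" for j :: int
  have "satisfies_rec r B"
  proof (cases r)
    case (Quadratic a b c)
    show ?thesis unfolding Quadratic satisfies_rec.simps
    proof safe
      fix n :: int assume "n \<ge> 0"
      show "of_int ((n + 1)^2) * B (n + 1)
        = of_int (a * n^2 + a * n + b) * B n - of_int (c * n^2) * B (n - 1)"
      proof (cases "n = 0")
        case True
        then show ?thesis using S by (simp add: Quadratic B_def)
      next
        case False
        define m where "m = nat (n - 1)"
        have n: "n = int m + 1" using False \<open>n \<ge> 0\<close> by (simp add: m_def)
        have "nat (int m + 1) = m + 1" "nat (int m + 1 + 1) = m + 2" by simp_all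
        moreover have "of_int c * (of_nat m + 1)^2 * S m
          + - (of_int a * (of_nat m + 1)^2 + of_int a * (of_nat m + 1) + of_int b) * S (m + 1)
          + (of_nat m + 2)^2 * S (m + 2) = 0"
          using S by (simp add: Quadratic)
        ultimately show ?thesis by (simp add: B_def n algebra_simps)
      qed
    qed
  next
    case (Cubic a b c d)
    show ?thesis unfolding Cubic satisfies_rec.simps
    proof safe
      fix n :: int assume "n \<ge> 0"
      show "of_int ((n + 1)^3) * B (n + 1)
        = of_int ((2 * n + 1) * (a * n^2 + a * n + b)) * B n - of_int (n * (c * n^2 + d)) * B (n - 1)"
      proof (cases "n = 0")
        case True
        then show ?thesis using S by (simp add: Cubic B_def)
      next
        case False
        define m where "m = nat (n - 1)"
        have n: "n = int m + 1" using False \<open>n \<ge> 0\<close> by (simp add: m_def)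
        have "nat (int m + 1) = m + 1" "nat (int m + 1 + 1) = m + 2" by simp_all
        moreover have "(of_nat m + 1) * (of_int c * (of_nat m + 1)^2 + of_int d) * S m
          + - ((2 * of_nat m + 3) * (of_int a * (of_nat m + 1)^2 + of_int a * (of_nat m + 1) + of_int b)) * S (m + 1)
          + (of_nat m + 2)^3 * S (m + 2) = 0"
          using S by (simp add: Cubic)
        ultimately show ?thesis by (simp add: B_def n algebra_simps)
      qed
    qed
  qed
  moreover have "B 0 = 1" using S by (cases r) (auto simp: B_def)
  ultimately have "apery_seq r B" by (simp add: apery_seq_def B_def)
  then have "A = B" using A apery_seq_ex1 by blast
  then show ?thesis by (simp add: B_def)
qed

section \<open>Reciprocal factorials, and binomial coefficients at \<open>n\<close>,
  \<open>n + 1\<close>, \<open>n + 2\<close>\<close>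

definition ifact :: "int \<Rightarrow> rat" where
  "ifact m = (if m < 0 then 0 else 1 / fact (nat m))"

lemma ifact_neg [simp]: "m < 0 \<Longrightarrow> ifact m = 0"
  by (simp add: ifact_def)

text \<open>Valid for all integers because \<open>ifact\<close>, the function
  \<open>1 / Gamma (m + 1)\<close>, is 0 at negative arguments; at \<open>m = 0\<close> both sides
  are 0. The vanishing of binomial coefficients outside their range is thereby encoded without case
  distinctions.\<close>

lemma ifact_rec: "ifact (m - 1) = of_int m * ifact m"
proof (cases "m \<le> 0")
  case False
  then obtain k where "m = int (Suc k)"
    by (metis int_cases linorder_not_le of_nat_0_less_iff gr0_implies_Suc zero_less_imp_eq_int)
  then show ?thesis by (simp add: ifact_def nat_add_distrib)
qed (auto simp: ifact_def)

lemma ifact_Suc: "(of_nat k + 1) * ifact (int (Suc k)) = ifact (int k)"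
  using ifact_rec[of "int k + 1"] by (simp add: add.commute)

lemma of_nat_binomial_ifact:
  "of_nat (n choose k) = fact n * ifact (int k) * ifact (int n - int k)"
proof (cases "k \<le> n")
  case True
  then show ?thesis
    by (simp add: binomial_fact ifact_def of_nat_diff flip: of_nat_diff)
qed (simp add: binomial_eq_0)

text \<open>Lowering an argument multiplies by a polynomial, raising it would divide. Everything is
  therefore expressed through the largest argument, \<open>n + 2 - k\<close>.\<close>

lemma ifact_diff1: "ifact (int n + 1 - int k) = (of_nat n + 2 - of_nat k) * ifact (int n + 2 - int k)"
  using ifact_rec[of "int n + 2 - int k"] by (simp add: algebra_simps)

lemma ifact_diff0:
  "ifact (int n - int k)
    = (of_nat n + 1 - of_nat k) * (of_nat n + 2 - of_nat k) * ifact (int n + 2 - int k)"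
proof -
  have "ifact (int n - int k) = of_int (int n + 1 - int k) * ifact (int n + 1 - int k)"
    using ifact_rec[of "int n + 1 - int k"] by (simp add: algebra_simps)
  then show ?thesis unfolding ifact_diff1 by simp
qed

lemmas ifact_diff = ifact_diff0 ifact_diff1

text \<open>Supplies the contribution of a factor \<open>n choose k\<close> to the cofactors
  \<open>qa\<close>, \<open>qb\<close>, \<open>qc\<close> of
  \<open>creative_telescoping\<close>.\<close>

lemma binomial_ifact_shift:
  "of_nat (n choose k) = fact n * ifact (int k) * ((of_nat n + 1 - of_nat k) * (of_nat n + 2 - of_nat k) * ifact (int n + 2 - int k))"
  "of_nat ((n + 1) choose k) = (of_nat n + 1) * fact n * ifact (int k) * ((of_nat n + 2 - of_nat k) * ifact (int n + 2 - int k))"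
  "of_nat ((n + 2) choose k) = (of_nat n + 1) * (of_nat n + 2) * fact n * ifact (int k) * ifact (int n + 2 - int k)"
proof -
  have *: "int (n + 1) - int k = int n + 1 - int k" "int (n + 2) - int k = int n + 2 - int k" by simp_all
  show
  "of_nat (n choose k) = fact n * ifact (int k) * ((of_nat n + 1 - of_nat k) * (of_nat n + 2 - of_nat k) * ifact (int n + 2 - int k))"
  "of_nat ((n + 1) choose k) = (of_nat n + 1) * fact n * ifact (int k) * ((of_nat n + 2 - of_nat k) * ifact (int n + 2 - int k))"
  "of_nat ((n + 2) choose k) = (of_nat n + 1) * (of_nat n + 2) * fact n * ifact (int k) * ifact (int n + 2 - int k)"
    unfolding of_nat_binomial_ifact * ifact_diff by (simp_all add: algebra_simps)
qed

lemma ifact_fact: "fact n * ifact (int n) = 1"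
  by (simp add: ifact_def)

text \<open>In this pair the factorial of \<open>n\<close> cancels, and raising \<open>n\<close>
  costs one linear factor in \<open>n + k\<close> and one in \<open>n - k\<close>.\<close>

lemma binomial_mult_binomial_add:
  "of_nat (n choose k) * of_nat ((n + k) choose k) = fact (n + k) * ifact (int k)^2 * ifact (int n - int k)"
proof -
  have "of_nat (n choose k) * of_nat ((n + k) choose k)
    = fact (n + k) * ifact (int k)^2 * ifact (int n - int k) * (fact n * ifact (int n))"
    unfolding of_nat_binomial_ifact by (simp add: power2_eq_square mult_ac)
  then show ?thesis by (simp add: ifact_fact)
qed

lemma binomial_mult_binomial_double:
  "of_nat (n choose k) * of_nat ((2 * k) choose n)
    = fact (2 * k) * ifact (int k) * ifact (int n - int k) * ifact (2 * int k - int n)"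
proof -
  have "of_nat (n choose k) * of_nat ((2 * k) choose n)
    = fact (2 * k) * ifact (int k) * ifact (int n - int k) * ifact (2 * int k - int n) * (fact n * ifact (int n))"
    unfolding of_nat_binomial_ifact by (simp add: mult_ac)
  then show ?thesis by (simp add: ifact_fact)
qed

lemma binomial_mult_binomial_add_shift:
  "of_nat (n choose k) * of_nat ((n + k) choose k) = fact (n + k) * ifact (int k)^2
    * ((of_nat n + 1 - of_nat k) * (of_nat n + 2 - of_nat k) * ifact (int n + 2 - int k))"
  "of_nat ((n + 1) choose k) * of_nat ((n + 1 + k) choose k) = (of_nat n + of_nat k + 1) * fact (n + k) * ifact (int k)^2
    * ((of_nat n + 2 - of_nat k) * ifact (int n + 2 - int k))"
  "of_nat ((n + 2) choose k) * of_nat ((n + 2 + k) choose k)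
    = (of_nat n + of_nat k + 1) * (of_nat n + of_nat k + 2) * fact (n + k) * ifact (int k)^2 * ifact (int n + 2 - int k)"
proof -
  have *: "int (n + 1) - int k = int n + 1 - int k" "int (n + 2) - int k = int n + 2 - int k" by simp_all
  show "of_nat (n choose k) * of_nat ((n + k) choose k) = fact (n + k) * ifact (int k)^2
    * ((of_nat n + 1 - of_nat k) * (of_nat n + 2 - of_nat k) * ifact (int n + 2 - int k))"
  "of_nat ((n + 1) choose k) * of_nat ((n + 1 + k) choose k) = (of_nat n + of_nat k + 1) * fact (n + k) * ifact (int k)^2
    * ((of_nat n + 2 - of_nat k) * ifact (int n + 2 - int k))"
  "of_nat ((n + 2) choose k) * of_nat ((n + 2 + k) choose k)
    = (of_nat n + of_nat k + 1) * (of_nat n + of_nat k + 2) * fact (n + k) * ifact (int k)^2 * ifact (int n + 2 - int k)"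
    unfolding binomial_mult_binomial_add * ifact_diff by (simp_all add: algebra_simps)
qed

text \<open>Raising \<open>n\<close> lowers \<open>2 k - n\<close>, so here the base argument is
  \<open>2 k - n\<close> itself, while \<open>n - k\<close> is still based at
  \<open>n + 2 - k\<close>.\<close>

lemma binomial_mult_binomial_double_shift:
  defines "\<beta> \<equiv> \<lambda>n k. fact (2 * k) * ifact (int k) * ifact (int n + 2 - int k) * ifact (2 * int k - int n)"
  shows
  "of_nat (n choose k) * of_nat ((2 * k) choose n) = (of_nat n + 1 - of_nat k) * (of_nat n + 2 - of_nat k) * \<beta> n k"
  "of_nat ((n + 1) choose k) * of_nat ((2 * k) choose (n + 1))
    = (of_nat n + 2 - of_nat k) * (2 * of_nat k - of_nat n) * \<beta> n k"
  "of_nat ((n + 2) choose k) * of_nat ((2 * k) choose (n + 2))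
    = (2 * of_nat k - of_nat n - 1) * (2 * of_nat k - of_nat n) * \<beta> n k"
proof -
  have *: "int (n + 1) - int k = int n + 1 - int k" "int (n + 2) - int k = int n + 2 - int k"
    "2 * int k - int (n + 1) = 2 * int k - int n - 1" "2 * int k - int (n + 2) = 2 * int k - int n - 1 - 1" by simp_all
  show "of_nat (n choose k) * of_nat ((2 * k) choose n) = (of_nat n + 1 - of_nat k) * (of_nat n + 2 - of_nat k) * \<beta> n k"
  "of_nat ((n + 1) choose k) * of_nat ((2 * k) choose (n + 1))
    = (of_nat n + 2 - of_nat k) * (2 * of_nat k - of_nat n) * \<beta> n k"
  "of_nat ((n + 2) choose k) * of_nat ((2 * k) choose (n + 2))
    = (2 * of_nat k - of_nat n - 1) * (2 * of_nat k - of_nat n) * \<beta> n k"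
    unfolding \<beta>_def binomial_mult_binomial_double * ifact_diff ifact_rec by simp_all
qed

text \<open>Steps in the summation index, from which the ratio \<open>N / D\<close> of consecutive
  values of \<open>\<tau>\<close> is read off; each equation puts the polynomial factor where no
  division arises.\<close>

lemma index_shift:
  "ifact (int k) = (of_nat k + 1) * ifact (int (Suc k))"
  "ifact (int n + 2 - int (Suc k)) = (of_nat n + 2 - of_nat k) * ifact (int n + 2 - int k)"
  "fact (n + Suc k) = (of_nat n + of_nat k + 1) * (fact (n + k) :: rat)"
  "fact (2 * Suc k) = 2 * (of_nat k + 1) * (2 * of_nat k + 1) * (fact (2 * k) :: rat)"
  "ifact (2 * int k - int n)
    = (2 * of_nat k + 1 - of_nat n) * (2 * of_nat k + 2 - of_nat n) * ifact (2 * int (Suc k) - int n)"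
  "ifact (int n + 2 - 3 * int (Suc k))
    = (of_nat n + 2 - 3 * of_nat k) * (of_nat n + 1 - 3 * of_nat k) * (of_nat n - 3 * of_nat k)
      * ifact (int n + 2 - 3 * int k)"
proof -
  show "ifact (int k) = (of_nat k + 1) * ifact (int (Suc k))" by (simp only: ifact_Suc)
  show "ifact (int n + 2 - int (Suc k)) = (of_nat n + 2 - of_nat k) * ifact (int n + 2 - int k)"
    using ifact_diff1[of n k] by (simp add: algebra_simps)
  show "fact (n + Suc k) = (of_nat n + of_nat k + 1) * (fact (n + k) :: rat)" by (simp add: algebra_simps)
  show "fact (2 * Suc k) = 2 * (of_nat k + 1) * (2 * of_nat k + 1) * (fact (2 * k) :: rat)"
    by (simp add: algebra_simps)
  have "2 * int k - int n = 2 * int (Suc k) - int n - 1 - 1" by simp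
  then show "ifact (2 * int k - int n)
    = (2 * of_nat k + 1 - of_nat n) * (2 * of_nat k + 2 - of_nat n) * ifact (2 * int (Suc k) - int n)"
    by (simp only: ifact_rec) (simp add: algebra_simps)
  have "int n + 2 - 3 * int (Suc k) = int n + 2 - 3 * int k - 1 - 1 - 1" by simp
  then show "ifact (int n + 2 - 3 * int (Suc k))
    = (of_nat n + 2 - 3 * of_nat k) * (of_nat n + 1 - 3 * of_nat k) * (of_nat n - 3 * of_nat k)
      * ifact (int n + 2 - 3 * int k)"
    by (simp only: ifact_rec) (simp add: algebra_simps)
qed

text \<open>Both sides are the multinomial coefficient \<open>n! / (k!^3 (n - 3 k)!)\<close>, which
  is 0 for \<open>3 k > n\<close>.\<close>

lemma trinomial_ifact:
  "of_nat (n choose (3 * k)) * of_nat ((3 * k) choose k) * of_nat ((2 * k) choose k)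
    = fact n * ifact (int k)^3 * ifact (int n - 3 * int k)"
proof -
  have "3 * int k - int k = int (2 * k)" "2 * int k - int k = int k" by simp_all
  then have "of_nat (n choose (3 * k)) * of_nat ((3 * k) choose k) * of_nat ((2 * k) choose k)
    = fact n * ifact (int k)^3 * ifact (int n - 3 * int k)
      * (fact (3 * k) * ifact (int (3 * k))) * (fact (2 * k) * ifact (int (2 * k)))"
    unfolding of_nat_binomial_ifact by (simp add: power3_eq_cube mult_ac)
  then show ?thesis by (simp only: ifact_fact mult_1_right)
qed

lemma ifact_diff_triple:
  "ifact (int n - 3 * int k)
    = (of_nat n + 1 - 3 * of_nat k) * (of_nat n + 2 - 3 * of_nat k) * ifact (int n + 2 - 3 * int k)"
  "ifact (int n + 1 - 3 * int k) = (of_nat n + 2 - 3 * of_nat k) * ifact (int n + 2 - 3 * int k)"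
proof -
  have *: "int n - 3 * int k = int n + 2 - 3 * int k - 1 - 1"
    "int n + 1 - 3 * int k = int n + 2 - 3 * int k - 1" by simp_all
  show "ifact (int n - 3 * int k)
    = (of_nat n + 1 - 3 * of_nat k) * (of_nat n + 2 - 3 * of_nat k) * ifact (int n + 2 - 3 * int k)"
    unfolding *(1) by (simp only: ifact_rec) simp
  show "ifact (int n + 1 - 3 * int k) = (of_nat n + 2 - 3 * of_nat k) * ifact (int n + 2 - 3 * int k)"
    unfolding *(2) by (simp only: ifact_rec) simp
qed

lemma trinomial_shift:
  "of_nat (n choose (3 * k)) * of_nat ((3 * k) choose k) * of_nat ((2 * k) choose k)
    = fact n * ifact (int k)^3
      * ((of_nat n + 1 - 3 * of_nat k) * (of_nat n + 2 - 3 * of_nat k) * ifact (int n + 2 - 3 * int k))"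
  "of_nat ((n + 1) choose (3 * k)) * of_nat ((3 * k) choose k) * of_nat ((2 * k) choose k)
    = (of_nat n + 1) * fact n * ifact (int k)^3
      * ((of_nat n + 2 - 3 * of_nat k) * ifact (int n + 2 - 3 * int k))"
  "of_nat ((n + 2) choose (3 * k)) * of_nat ((3 * k) choose k) * of_nat ((2 * k) choose k)
    = (of_nat n + 1) * (of_nat n + 2) * fact n * ifact (int k)^3 * ifact (int n + 2 - 3 * int k)"
proof -
  have *: "int (n + 1) - 3 * int k = int n + 1 - 3 * int k" "int (n + 2) - 3 * int k = int n + 2 - 3 * int k"
    by simp_all
  show "of_nat (n choose (3 * k)) * of_nat ((3 * k) choose k) * of_nat ((2 * k) choose k)
    = fact n * ifact (int k)^3
      * ((of_nat n + 1 - 3 * of_nat k) * (of_nat n + 2 - 3 * of_nat k) * ifact (int n + 2 - 3 * int k))"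
  "of_nat ((n + 1) choose (3 * k)) * of_nat ((3 * k) choose k) * of_nat ((2 * k) choose k)
    = (of_nat n + 1) * fact n * ifact (int k)^3
      * ((of_nat n + 2 - 3 * of_nat k) * ifact (int n + 2 - 3 * int k))"
  "of_nat ((n + 2) choose (3 * k)) * of_nat ((3 * k) choose k) * of_nat ((2 * k) choose k)
    = (of_nat n + 1) * (of_nat n + 2) * fact n * ifact (int k)^3 * ifact (int n + 2 - 3 * int k)"
    unfolding trinomial_ifact * ifact_diff_triple by (simp_all add: algebra_simps)
qed

lemma trinomial_mult_binomial_add:
  "of_nat (n choose (3 * k)) * of_nat ((3 * k) choose k) * of_nat ((2 * k) choose k) * of_nat ((n + k) choose k)
    = fact (n + k) * ifact (int k)^4 * ifact (int n - 3 * int k)"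
proof -
  have "of_nat ((n + k) choose k) = fact (n + k) * ifact (int k) * ifact (int n)"
    unfolding of_nat_binomial_ifact by simp
  then have "of_nat (n choose (3 * k)) * of_nat ((3 * k) choose k) * of_nat ((2 * k) choose k) * of_nat ((n + k) choose k)
    = fact (n + k) * ifact (int k)^4 * ifact (int n - 3 * int k) * (fact n * ifact (int n))"
    unfolding trinomial_ifact by (simp add: power3_eq_cube power4_eq_xxxx mult_ac)
  then show ?thesis by (simp only: ifact_fact mult_1_right)
qed

lemma trinomial_mult_binomial_add_shift:
  defines "\<beta> \<equiv> \<lambda>n k. fact (n + k) * ifact (int k)^4 * ifact (int n + 2 - 3 * int k)"
  shows
  "of_nat (n choose (3 * k)) * of_nat ((3 * k) choose k) * of_nat ((2 * k) choose k) * of_nat ((n + k) choose k)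
    = (of_nat n + 1 - 3 * of_nat k) * (of_nat n + 2 - 3 * of_nat k) * \<beta> n k"
  "of_nat ((n + 1) choose (3 * k)) * of_nat ((3 * k) choose k) * of_nat ((2 * k) choose k) * of_nat ((n + 1 + k) choose k)
    = (of_nat n + of_nat k + 1) * (of_nat n + 2 - 3 * of_nat k) * \<beta> n k"
  "of_nat ((n + 2) choose (3 * k)) * of_nat ((3 * k) choose k) * of_nat ((2 * k) choose k) * of_nat ((n + 2 + k) choose k)
    = (of_nat n + of_nat k + 1) * (of_nat n + of_nat k + 2) * \<beta> n k"
proof -
  have *: "int (n + 1) - 3 * int k = int n + 1 - 3 * int k" "int (n + 2) - 3 * int k = int n + 2 - 3 * int k"
    by simp_all
  show "of_nat (n choose (3 * k)) * of_nat ((3 * k) choose k) * of_nat ((2 * k) choose k) * of_nat ((n + k) choose k)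
    = (of_nat n + 1 - 3 * of_nat k) * (of_nat n + 2 - 3 * of_nat k) * \<beta> n k"
  "of_nat ((n + 1) choose (3 * k)) * of_nat ((3 * k) choose k) * of_nat ((2 * k) choose k) * of_nat ((n + 1 + k) choose k)
    = (of_nat n + of_nat k + 1) * (of_nat n + 2 - 3 * of_nat k) * \<beta> n k"
  "of_nat ((n + 2) choose (3 * k)) * of_nat ((3 * k) choose k) * of_nat ((2 * k) choose k) * of_nat ((n + 2 + k) choose k)
    = (of_nat n + of_nat k + 1) * (of_nat n + of_nat k + 2) * \<beta> n k"
    unfolding \<beta>_def trinomial_mult_binomial_add * ifact_diff_triple by (simp_all add: algebra_simps)
qed

text \<open>The central binomial coefficients, extended by \<open>0\<close> so that their recurrence holds for all integers.\<close>

definition central_binomial :: "int \<Rightarrow> rat" where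
  "central_binomial m = (if m < 0 then 0 else of_nat ((2 * nat m) choose nat m))"

lemma central_binomial_fact: "of_nat ((2 * k) choose k) = fact (2 * k) * ifact (int k)^2"
proof -
  have "2 * int k - int k = int k" by simp
  then show ?thesis unfolding of_nat_binomial_ifact by (simp add: power2_eq_square)
qed

lemma central_binomial_rec:
  "of_int m * central_binomial m = 2 * (2 * of_int m - 1) * central_binomial (m - 1)"
proof (cases "m \<le> 0")
  case False
  define k where "k = nat (m - 1)"
  have m: "m = int (Suc k)" using False by (simp add: k_def)
  have "(of_nat k + 1) * (fact (2 * Suc k) * ifact (int (Suc k))^2)
    = 2 * (2 * of_nat k + 1) * (fact (2 * k) * ifact (int k)^2)"
    unfolding index_shift(1)[of k] index_shift(4) by algebra
  moreover have "central_binomial (int j) = fact (2 * j) * ifact (int j)^2" for j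
    by (simp add: central_binomial_def central_binomial_fact)
  moreover have "int (Suc k) - 1 = int k" "of_int (int (Suc k)) = (of_nat k + 1 :: rat)"
    "2 * (of_nat k + 1 :: rat) - 1 = 2 * of_nat k + 1" by simp_all
  ultimately show ?thesis unfolding m by (simp only:)
qed (auto simp: central_binomial_def)

text \<open>Lowering the argument of a central binomial coefficient divides by odd integers
  \<open>2 m - 1\<close>, which never vanish. The value at \<open>n + 2 - k\<close> with these odd
  factors divided out is thus a safe common base: the values at \<open>n - k\<close>,
  \<open>n + 1 - k\<close>, \<open>n + 2 - k\<close> are polynomial multiples of it.\<close>

definition central_base :: "nat \<Rightarrow> nat \<Rightarrow> rat" where
  "central_base n k = central_binomial (int n + 2 - int k)
    / (4 * (2 * of_nat n - 2 * of_nat k + 3) * (2 * of_nat n - 2 * of_nat k + 1))"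

lemma odd_nonzero: "2 * of_nat n - 2 * of_nat k + of_int (2 * j + 1) \<noteq> (0 :: rat)"
proof
  assume "2 * of_nat n - 2 * of_nat k + of_int (2 * j + 1) = (0 :: rat)"
  then have "of_int (2 * int n - 2 * int k + (2 * j + 1)) = (0 :: rat)" by simp
  then have "2 * int n - 2 * int k + (2 * j + 1) = 0" by (simp only: of_int_eq_0_iff)
  then show False by presburger
qed

lemma central_base_shift:
  "central_binomial (int n - int k) = (of_nat n + 1 - of_nat k) * (of_nat n + 2 - of_nat k) * central_base n k"
  "central_binomial (int n + 1 - int k)
    = 2 * (of_nat n + 2 - of_nat k) * (2 * of_nat n - 2 * of_nat k + 1) * central_base n k"
  "central_binomial (int n + 2 - int k)
    = 4 * (2 * of_nat n - 2 * of_nat k + 3) * (2 * of_nat n - 2 * of_nat k + 1) * central_base n k"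
  "2 * (2 * of_nat n - 2 * of_nat k - 1) * central_base n (Suc k) = (of_nat n + 2 - of_nat k) * central_base n k"
proof -
  define \<delta> :: rat where "\<delta> = of_nat n - of_nat k"
  have nz: "2 * \<delta> + 3 \<noteq> 0" "2 * \<delta> + 1 \<noteq> 0" "2 * \<delta> - 1 \<noteq> 0"
    using odd_nonzero[of n k 1] odd_nonzero[of n k 0] odd_nonzero[of n k "-1"] by (simp_all add: \<delta>_def algebra_simps)
  have base: "central_binomial (int n + 2 - int k) = 4 * (2 * \<delta> + 3) * (2 * \<delta> + 1) * central_base n k"
  proof -
    have "2 * of_nat n - 2 * of_nat k = 2 * \<delta>" by (simp add: \<delta>_def)
    then show ?thesis using nz unfolding central_base_def by simp
  qed
  have r2: "(\<delta> + 2) * central_binomial (int n + 2 - int k) = 2 * (2 * \<delta> + 3) * central_binomial (int n + 1 - int k)"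
    using central_binomial_rec[of "int n + 2 - int k"] by (simp add: \<delta>_def algebra_simps)
  have r1: "(\<delta> + 1) * central_binomial (int n + 1 - int k) = 2 * (2 * \<delta> + 1) * central_binomial (int n - int k)"
    using central_binomial_rec[of "int n + 1 - int k"] by (simp add: \<delta>_def algebra_simps)
  have e1: "central_binomial (int n + 1 - int k) = 2 * (\<delta> + 2) * (2 * \<delta> + 1) * central_base n k"
  proof -
    have "(2 * \<delta> + 3) * central_binomial (int n + 1 - int k) = (2 * \<delta> + 3) * (2 * (\<delta> + 2) * (2 * \<delta> + 1) * central_base n k)"
      using r2 unfolding base by algebra
    then show ?thesis using nz by simp
  qed
  have e0: "central_binomial (int n - int k) = (\<delta> + 1) * (\<delta> + 2) * central_base n k"
  proof -
    have "(2 * \<delta> + 1) * central_binomial (int n - int k) = (2 * \<delta> + 1) * ((\<delta> + 1) * (\<delta> + 2) * central_base n k)"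
      using r1 unfolding e1 by algebra
    then show ?thesis using nz by simp
  qed
  have "int n + 2 - int (Suc k) = int n + 1 - int k" by simp
  then have *: "central_base n (Suc k) = central_binomial (int n + 1 - int k) / (4 * (2 * \<delta> + 1) * (2 * \<delta> - 1))"
    unfolding central_base_def \<delta>_def by (simp add: algebra_simps)
  have e3: "2 * (2 * \<delta> - 1) * central_base n (Suc k) = (\<delta> + 2) * central_base n k"
  proof -
    have "4 * (2 * \<delta> + 1) * (2 * \<delta> - 1) \<noteq> 0" using nz by simp
    then have "central_base n (Suc k) * (4 * (2 * \<delta> + 1) * (2 * \<delta> - 1)) = 2 * (\<delta> + 2) * (2 * \<delta> + 1) * central_base n k"
      using *[unfolded e1] by (metis nonzero_divide_eq_eq)
    then have "(2 * \<delta> + 1) * (2 * (2 * \<delta> - 1) * central_base n (Suc k)) = (2 * \<delta> + 1) * ((\<delta> + 2) * central_base n k)"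
      by algebra
    then show ?thesis using nz by simp
  qed
  show
  "central_binomial (int n - int k) = (of_nat n + 1 - of_nat k) * (of_nat n + 2 - of_nat k) * central_base n k"
  "central_binomial (int n + 1 - int k)
    = 2 * (of_nat n + 2 - of_nat k) * (2 * of_nat n - 2 * of_nat k + 1) * central_base n k"
  "central_binomial (int n + 2 - int k)
    = 4 * (2 * of_nat n - 2 * of_nat k + 3) * (2 * of_nat n - 2 * of_nat k + 1) * central_base n k"
  "2 * (2 * of_nat n - 2 * of_nat k - 1) * central_base n (Suc k) = (of_nat n + 2 - of_nat k) * central_base n k"
    using e0 e1 base e3 by (simp_all add: \<delta>_def algebra_simps)
qed

lemma central_base_zero: "central_base n (n + 3) = 0"
  by (simp add: central_base_def central_binomial_def)

lemma binomial_mult_central_shift: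
  defines "\<beta> \<equiv> \<lambda>n k. fact n * ifact (int k) * ifact (int n + 2 - int k) * central_base n k"
  shows
  "of_nat (n choose k) * central_binomial (int n - int k)
    = ((of_nat n + 1 - of_nat k) * (of_nat n + 2 - of_nat k))^2 * \<beta> n k"
  "of_nat ((n + 1) choose k) * central_binomial (int (n + 1) - int k)
    = 2 * (of_nat n + 1) * (of_nat n + 2 - of_nat k)^2 * (2 * of_nat n - 2 * of_nat k + 1) * \<beta> n k"
  "of_nat ((n + 2) choose k) * central_binomial (int (n + 2) - int k)
    = 4 * (of_nat n + 1) * (of_nat n + 2) * (2 * of_nat n - 2 * of_nat k + 3) * (2 * of_nat n - 2 * of_nat k + 1) * \<beta> n k"
proof -
  have *: "int (n + 1) - int k = int n + 1 - int k" "int (n + 2) - int k = int n + 2 - int k" by simp_all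
  show "of_nat (n choose k) * central_binomial (int n - int k)
    = ((of_nat n + 1 - of_nat k) * (of_nat n + 2 - of_nat k))^2 * \<beta> n k"
    "of_nat ((n + 1) choose k) * central_binomial (int (n + 1) - int k)
    = 2 * (of_nat n + 1) * (of_nat n + 2 - of_nat k)^2 * (2 * of_nat n - 2 * of_nat k + 1) * \<beta> n k"
    "of_nat ((n + 2) choose k) * central_binomial (int (n + 2) - int k)
    = 4 * (of_nat n + 1) * (of_nat n + 2) * (2 * of_nat n - 2 * of_nat k + 3) * (2 * of_nat n - 2 * of_nat k + 1) * \<beta> n k"
    unfolding \<beta>_def * binomial_ifact_shift[of n] central_base_shift by algebra+
qed

section \<open>Binomial sums satisfying the recurrences\<close>

text \<open>Sequence A, the Franel numbers, usually written as the sum of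
  \<open>(n choose k)^3\<close>. The form chosen here turns into an expansion in
  \<open>2 j choose j\<close> in \<open>franel_alt\<close>.\<close>

definition franel :: "nat \<Rightarrow> int" where
  "franel n = (\<Sum>k\<le>n. int ((n choose k)^2 * (2 * k choose n)))"

lemma nat_solution_franel: "nat_solution (Quadratic 7 2 (- 8)) (\<lambda>n. of_int (franel n))"
proof -
  \<comment> \<open>The bracketing lets \<open>binomial_mult_binomial_double_shift\<close> rewrite
    the inner product before the remaining binomial coefficient is unfolded; later summands are
    bracketed for the same reason.\<close>
  define t :: "nat \<Rightarrow> nat \<Rightarrow> rat" where "t m k = of_nat (m choose k) * (of_nat (m choose k) * of_nat (2 * k choose m))" for m k
  have sum: "of_int (franel m) = (\<Sum>k\<le>m. t m k)" for m
    by (simp add: franel_def t_def power2_eq_square mult_ac)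
  have "(- 8) * (of_nat n + 1)^2 * (\<Sum>k\<le>n. t n k)
     + - (7 * (of_nat n + 1)^2 + 7 * (of_nat n + 1) + 2) * (\<Sum>k\<le>n + 1. t (n + 1) k)
     + (of_nat n + 2)^2 * (\<Sum>k\<le>n + 2. t (n + 2) k) = 0" for n
  proof -
    define \<nu> :: rat where "\<nu> = of_nat n"
    \<comment> \<open>\<open>\<tau>\<close> is the part shared by the summands for \<open>n\<close>,
      \<open>n + 1\<close>, \<open>n + 2\<close>, with every reciprocal factorial at its largest
      argument. The polynomials \<open>qa\<close>, \<open>qb\<close>, \<open>qc\<close> are the
      cofactors, \<open>N / D\<close> is the ratio of consecutive \<open>\<tau>\<close>, and
      \<open>x\<close> is what remains of the certificate once \<open>D\<close> is split
      off.\<close>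
    define \<tau> :: "nat \<Rightarrow> rat" where "\<tau> k = fact n * fact (2 * k) * ifact (int k)^2 * ifact (int n + 2 - int k)^2 * ifact (2 * int k - int n)" for k
    define qa where "qa \<kappa> = ((\<nu> + 2 - \<kappa>) * (\<nu> + 1 - \<kappa>))^2" for \<kappa> :: rat
    define qb where "qb \<kappa> = (\<nu> + 1) * (\<nu> + 2 - \<kappa>)^2 * (2 * \<kappa> - \<nu>)" for \<kappa> :: rat
    define qc where "qc \<kappa> = (\<nu> + 1) * (\<nu> + 2) * (2 * \<kappa> - \<nu> - 1) * (2 * \<kappa> - \<nu>)" for \<kappa> :: rat
    define N where "N \<kappa> = 2 * (2 * \<kappa> + 1) * (\<nu> + 2 - \<kappa>)^2" for \<kappa> :: rat
    define D where "D \<kappa> = \<kappa> * (2 * \<kappa> - \<nu>) * (2 * \<kappa> - 1 - \<nu>)" for \<kappa> :: rat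
    define x where "x \<kappa> = (\<nu> + 1) * ((- 6 - 3*\<nu>)*\<kappa> + (2)*\<kappa>^2)" for \<kappa> :: rat
    show ?thesis unfolding \<nu>_def[symmetric]
    proof (rule creative_telescoping[where t = t and n = n and \<tau> = \<tau> and qa = qa and qb = qb and qc = qc
          and D = D and N = N and x = x])
      show "t n k = qa (of_nat k) * \<tau> k" for k
        unfolding t_def \<tau>_def qa_def \<nu>_def unfolding binomial_mult_binomial_double_shift[of n k] unfolding binomial_ifact_shift[of n k] by algebra
      show "t (n + 1) k = qb (of_nat k) * \<tau> k" for k
        unfolding t_def \<tau>_def qb_def \<nu>_def unfolding binomial_mult_binomial_double_shift[of n k] unfolding binomial_ifact_shift[of n k] by algebra
      show "t (n + 2) k = qc (of_nat k) * \<tau> k" for k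
        unfolding t_def \<tau>_def qc_def \<nu>_def unfolding binomial_mult_binomial_double_shift[of n k] unfolding binomial_ifact_shift[of n k] by algebra
      show "D (of_nat k + 1) * \<tau> (Suc k) = N (of_nat k) * \<tau> k" for k
        unfolding \<tau>_def \<nu>_def D_def N_def index_shift(2-4,6) index_shift(5)[of k n] index_shift(1)[of k] by algebra
      show "(- 8) * (\<nu> + 1)^2 * qa \<kappa> + - (7 * (\<nu> + 1)^2 + 7 * (\<nu> + 1) + 2) * qb \<kappa> + (\<nu> + 2)^2 * qc \<kappa>
        = x (\<kappa> + 1) * N \<kappa> - x \<kappa> * D \<kappa>" for \<kappa>
        unfolding qa_def qb_def qc_def x_def D_def N_def by algebra
    qed (simp_all add: t_def \<tau>_def D_def)
  qed
  then show ?thesis by (simp add: sum) (simp add: t_def)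
qed

definition zagier_C :: "nat \<Rightarrow> int" where
  "zagier_C n = (\<Sum>k\<le>n. int ((n choose k)^2 * (2 * k choose k)))"

lemma nat_solution_zagier_C: "nat_solution (Quadratic 10 3 9) (\<lambda>n. of_int (zagier_C n))"
proof -
  define t :: "nat \<Rightarrow> nat \<Rightarrow> rat" where "t m k = of_nat (m choose k)^2 * of_nat (2 * k choose k)" for m k
  have sum: "of_int (zagier_C m) = (\<Sum>k\<le>m. t m k)" for m
    by (simp add: zagier_C_def t_def power2_eq_square mult_ac)
  have "9 * (of_nat n + 1)^2 * (\<Sum>k\<le>n. t n k)
     + - (10 * (of_nat n + 1)^2 + 10 * (of_nat n + 1) + 3) * (\<Sum>k\<le>n + 1. t (n + 1) k)
     + (of_nat n + 2)^2 * (\<Sum>k\<le>n + 2. t (n + 2) k) = 0" for n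
  proof -
    define \<nu> :: rat where "\<nu> = of_nat n"
    define \<tau> :: "nat \<Rightarrow> rat" where "\<tau> k = fact n^2 * fact (2 * k) * ifact (int k)^4 * ifact (int n + 2 - int k)^2" for k
    define qa where "qa \<kappa> = ((\<nu> + 2 - \<kappa>) * (\<nu> + 1 - \<kappa>))^2" for \<kappa> :: rat
    define qb where "qb \<kappa> = (\<nu> + 1)^2 * (\<nu> + 2 - \<kappa>)^2" for \<kappa> :: rat
    define qc where "qc \<kappa> = ((\<nu> + 1) * (\<nu> + 2))^2" for \<kappa> :: rat
    define N where "N \<kappa> = 2 * (2 * \<kappa> + 1) * (\<nu> + 2 - \<kappa>)^2" for \<kappa> :: rat
    define D where "D \<kappa> = \<kappa>^3" for \<kappa> :: rat
    define x where "x \<kappa> = (\<nu> + 1) * (\<nu> + 1) * ((- 8 - 4*\<nu>) + (3)*\<kappa>)" for \<kappa> :: rat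
    show ?thesis unfolding \<nu>_def[symmetric]
    proof (rule creative_telescoping[where t = t and n = n and \<tau> = \<tau> and qa = qa and qb = qb and qc = qc
          and D = D and N = N and x = x])
      show "t n k = qa (of_nat k) * \<tau> k" for k
        unfolding t_def \<tau>_def qa_def \<nu>_def unfolding central_binomial_fact binomial_ifact_shift[of n k] by algebra
      show "t (n + 1) k = qb (of_nat k) * \<tau> k" for k
        unfolding t_def \<tau>_def qb_def \<nu>_def unfolding central_binomial_fact binomial_ifact_shift[of n k] by algebra
      show "t (n + 2) k = qc (of_nat k) * \<tau> k" for k
        unfolding t_def \<tau>_def qc_def \<nu>_def unfolding central_binomial_fact binomial_ifact_shift[of n k] by algebra
      show "D (of_nat k + 1) * \<tau> (Suc k) = N (of_nat k) * \<tau> k" for k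
        unfolding \<tau>_def \<nu>_def D_def N_def index_shift(2-4,6) index_shift(5)[of k n] index_shift(1)[of k] by algebra
      show "9 * (\<nu> + 1)^2 * qa \<kappa> + - (10 * (\<nu> + 1)^2 + 10 * (\<nu> + 1) + 3) * qb \<kappa> + (\<nu> + 2)^2 * qc \<kappa>
        = x (\<kappa> + 1) * N \<kappa> - x \<kappa> * D \<kappa>" for \<kappa>
        unfolding qa_def qb_def qc_def x_def D_def N_def by algebra
    qed (simp_all add: t_def \<tau>_def D_def)
  qed
  then show ?thesis by (simp add: sum) (simp add: t_def)
qed

definition zagier_D :: "nat \<Rightarrow> int" where
  "zagier_D n = (\<Sum>k\<le>n. int ((n choose k)^2 * (n + k choose k)))"

lemma nat_solution_zagier_D: "nat_solution (Quadratic 11 3 (- 1)) (\<lambda>n. of_int (zagier_D n))"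
proof -
  define t :: "nat \<Rightarrow> nat \<Rightarrow> rat" where "t m k = of_nat (m choose k) * (of_nat (m choose k) * of_nat (m + k choose k))" for m k
  have sum: "of_int (zagier_D m) = (\<Sum>k\<le>m. t m k)" for m
    by (simp add: zagier_D_def t_def power2_eq_square mult_ac)
  have "(- 1) * (of_nat n + 1)^2 * (\<Sum>k\<le>n. t n k)
     + - (11 * (of_nat n + 1)^2 + 11 * (of_nat n + 1) + 3) * (\<Sum>k\<le>n + 1. t (n + 1) k)
     + (of_nat n + 2)^2 * (\<Sum>k\<le>n + 2. t (n + 2) k) = 0" for n
  proof -
    define \<nu> :: rat where "\<nu> = of_nat n"
    define \<tau> :: "nat \<Rightarrow> rat" where "\<tau> k = fact n * fact (n + k) * ifact (int k)^3 * ifact (int n + 2 - int k)^2" for k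
    define qa where "qa \<kappa> = ((\<nu> + 2 - \<kappa>) * (\<nu> + 1 - \<kappa>))^2" for \<kappa> :: rat
    define qb where "qb \<kappa> = (\<nu> + 1) * (\<nu> + \<kappa> + 1) * (\<nu> + 2 - \<kappa>)^2" for \<kappa> :: rat
    define qc where "qc \<kappa> = (\<nu> + 1) * (\<nu> + 2) * (\<nu> + \<kappa> + 1) * (\<nu> + \<kappa> + 2)" for \<kappa> :: rat
    define N where "N \<kappa> = (\<nu> + \<kappa> + 1) * (\<nu> + 2 - \<kappa>)^2" for \<kappa> :: rat
    define D where "D \<kappa> = \<kappa>^3" for \<kappa> :: rat
    define x where "x \<kappa> = (\<nu> + 1) * ((- 30 - 37*\<nu> - 11*\<nu>^2) + (7 + 6*\<nu>)*\<kappa> + (1)*\<kappa>^2)" for \<kappa> :: rat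
    show ?thesis unfolding \<nu>_def[symmetric]
    proof (rule creative_telescoping[where t = t and n = n and \<tau> = \<tau> and qa = qa and qb = qb and qc = qc
          and D = D and N = N and x = x])
      show "t n k = qa (of_nat k) * \<tau> k" for k
        unfolding t_def \<tau>_def qa_def \<nu>_def unfolding binomial_mult_binomial_add_shift[of n k] unfolding binomial_ifact_shift[of n k] by algebra
      show "t (n + 1) k = qb (of_nat k) * \<tau> k" for k
        unfolding t_def \<tau>_def qb_def \<nu>_def unfolding binomial_mult_binomial_add_shift[of n k] unfolding binomial_ifact_shift[of n k] by algebra
      show "t (n + 2) k = qc (of_nat k) * \<tau> k" for k
        unfolding t_def \<tau>_def qc_def \<nu>_def unfolding binomial_mult_binomial_add_shift[of n k] unfolding binomial_ifact_shift[of n k] by algebra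
      show "D (of_nat k + 1) * \<tau> (Suc k) = N (of_nat k) * \<tau> k" for k
        unfolding \<tau>_def \<nu>_def D_def N_def index_shift(2-4,6) index_shift(5)[of k n] index_shift(1)[of k] by algebra
      show "(- 1) * (\<nu> + 1)^2 * qa \<kappa> + - (11 * (\<nu> + 1)^2 + 11 * (\<nu> + 1) + 3) * qb \<kappa> + (\<nu> + 2)^2 * qc \<kappa>
        = x (\<kappa> + 1) * N \<kappa> - x \<kappa> * D \<kappa>" for \<kappa>
        unfolding qa_def qb_def qc_def x_def D_def N_def by algebra
    qed (simp_all add: t_def \<tau>_def D_def)
  qed
  then show ?thesis by (simp add: sum) (simp add: t_def)
qed

definition apery :: "nat \<Rightarrow> int" where
  "apery n = (\<Sum>k\<le>n. int ((n choose k)^2 * (n + k choose k)^2))"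

lemma nat_solution_apery: "nat_solution (Cubic 17 5 1 0) (\<lambda>n. of_int (apery n))"
proof -
  define t :: "nat \<Rightarrow> nat \<Rightarrow> rat" where "t m k = (of_nat (m choose k) * of_nat (m + k choose k))^2" for m k
  have sum: "of_int (apery m) = (\<Sum>k\<le>m. t m k)" for m
    by (simp add: apery_def t_def power2_eq_square mult_ac)
  have "(of_nat n + 1) * (1 * (of_nat n + 1)^2 + 0) * (\<Sum>k\<le>n. t n k)
     + - ((2 * of_nat n + 3) * (17 * (of_nat n + 1)^2 + 17 * (of_nat n + 1) + 5)) * (\<Sum>k\<le>n + 1. t (n + 1) k)
     + (of_nat n + 2)^3 * (\<Sum>k\<le>n + 2. t (n + 2) k) = 0" for n
  proof -
    define \<nu> :: rat where "\<nu> = of_nat n"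
    define \<tau> :: "nat \<Rightarrow> rat" where "\<tau> k = fact (n + k)^2 * ifact (int k)^4 * ifact (int n + 2 - int k)^2" for k
    define qa where "qa \<kappa> = ((\<nu> + 2 - \<kappa>) * (\<nu> + 1 - \<kappa>))^2" for \<kappa> :: rat
    define qb where "qb \<kappa> = ((\<nu> + \<kappa> + 1) * (\<nu> + 2 - \<kappa>))^2" for \<kappa> :: rat
    define qc where "qc \<kappa> = ((\<nu> + \<kappa> + 1) * (\<nu> + \<kappa> + 2))^2" for \<kappa> :: rat
    define N where "N \<kappa> = ((\<nu> + \<kappa> + 1) * (\<nu> + 2 - \<kappa>))^2" for \<kappa> :: rat
    define D where "D \<kappa> = \<kappa>^4" for \<kappa> :: rat
    define x where "x \<kappa> = 4 * (2*\<nu> + 3) * ((- 8 - 12*\<nu> - 4*\<nu>^2) + (- 3)*\<kappa> + (2)*\<kappa>^2)" for \<kappa> :: rat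
    show ?thesis unfolding \<nu>_def[symmetric]
    proof (rule creative_telescoping[where t = t and n = n and \<tau> = \<tau> and qa = qa and qb = qb and qc = qc
          and D = D and N = N and x = x])
      show "t n k = qa (of_nat k) * \<tau> k" for k
        unfolding t_def \<tau>_def qa_def \<nu>_def unfolding binomial_mult_binomial_add_shift[of n k] by algebra
      show "t (n + 1) k = qb (of_nat k) * \<tau> k" for k
        unfolding t_def \<tau>_def qb_def \<nu>_def unfolding binomial_mult_binomial_add_shift[of n k] by algebra
      show "t (n + 2) k = qc (of_nat k) * \<tau> k" for k
        unfolding t_def \<tau>_def qc_def \<nu>_def unfolding binomial_mult_binomial_add_shift[of n k] by algebra
      show "D (of_nat k + 1) * \<tau> (Suc k) = N (of_nat k) * \<tau> k" for k
        unfolding \<tau>_def \<nu>_def D_def N_def index_shift(2-4,6) index_shift(5)[of k n] index_shift(1)[of k] by algebra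
      show "(\<nu> + 1) * (1 * (\<nu> + 1)^2 + 0) * qa \<kappa> + - ((2 * \<nu> + 3) * (17 * (\<nu> + 1)^2 + 17 * (\<nu> + 1) + 5)) * qb \<kappa> + (\<nu> + 2)^3 * qc \<kappa>
        = x (\<kappa> + 1) * N \<kappa> - x \<kappa> * D \<kappa>" for \<kappa>
        unfolding qa_def qb_def qc_def x_def D_def N_def by algebra
    qed (simp_all add: t_def \<tau>_def D_def)
  qed
  then show ?thesis by (simp add: sum) (simp add: t_def)
qed

definition sequence_epsilon :: "nat \<Rightarrow> int" where
  "sequence_epsilon n = (\<Sum>k\<le>n. int ((n choose k)^2 * (2 * k choose n)^2))"

lemma nat_solution_sequence_epsilon: "nat_solution (Cubic 12 4 16 0) (\<lambda>n. of_int (sequence_epsilon n))"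
proof -
  define t :: "nat \<Rightarrow> nat \<Rightarrow> rat" where "t m k = (of_nat (m choose k) * of_nat (2 * k choose m))^2" for m k
  have sum: "of_int (sequence_epsilon m) = (\<Sum>k\<le>m. t m k)" for m
    by (simp add: sequence_epsilon_def t_def power2_eq_square mult_ac)
  have "(of_nat n + 1) * (16 * (of_nat n + 1)^2 + 0) * (\<Sum>k\<le>n. t n k)
     + - ((2 * of_nat n + 3) * (12 * (of_nat n + 1)^2 + 12 * (of_nat n + 1) + 4)) * (\<Sum>k\<le>n + 1. t (n + 1) k)
     + (of_nat n + 2)^3 * (\<Sum>k\<le>n + 2. t (n + 2) k) = 0" for n
  proof -
    define \<nu> :: rat where "\<nu> = of_nat n"
    define \<tau> :: "nat \<Rightarrow> rat" where "\<tau> k = fact (2 * k)^2 * ifact (int k)^2 * ifact (int n + 2 - int k)^2 * ifact (2 * int k - int n)^2" for k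
    define qa where "qa \<kappa> = ((\<nu> + 2 - \<kappa>) * (\<nu> + 1 - \<kappa>))^2" for \<kappa> :: rat
    define qb where "qb \<kappa> = ((\<nu> + 2 - \<kappa>) * (2 * \<kappa> - \<nu>))^2" for \<kappa> :: rat
    define qc where "qc \<kappa> = ((2 * \<kappa> - \<nu> - 1) * (2 * \<kappa> - \<nu>))^2" for \<kappa> :: rat
    define N where "N \<kappa> = 4 * (2 * \<kappa> + 1)^2 * (\<nu> + 2 - \<kappa>)^2" for \<kappa> :: rat
    define D where "D \<kappa> = ((2 * \<kappa> - \<nu>) * (2 * \<kappa> - 1 - \<nu>))^2" for \<kappa> :: rat
    define x where "x \<kappa> = ((40 + 68*\<nu> + 38*\<nu>^2 + 7*\<nu>^3) + (- 48 - 56*\<nu> - 16*\<nu>^2)*\<kappa> + (12 + 8*\<nu>)*\<kappa>^2)" for \<kappa> :: rat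
    show ?thesis unfolding \<nu>_def[symmetric]
    proof (rule creative_telescoping[where t = t and n = n and \<tau> = \<tau> and qa = qa and qb = qb and qc = qc
          and D = D and N = N and x = x])
      show "t n k = qa (of_nat k) * \<tau> k" for k
        unfolding t_def \<tau>_def qa_def \<nu>_def unfolding binomial_mult_binomial_double_shift[of n k] by algebra
      show "t (n + 1) k = qb (of_nat k) * \<tau> k" for k
        unfolding t_def \<tau>_def qb_def \<nu>_def unfolding binomial_mult_binomial_double_shift[of n k] by algebra
      show "t (n + 2) k = qc (of_nat k) * \<tau> k" for k
        unfolding t_def \<tau>_def qc_def \<nu>_def unfolding binomial_mult_binomial_double_shift[of n k] by algebra
      show "D (of_nat k + 1) * \<tau> (Suc k) = N (of_nat k) * \<tau> k" for k
        unfolding \<tau>_def \<nu>_def D_def N_def index_shift(2-4,6) index_shift(5)[of k n] index_shift(1)[of k] by algebra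
      show "(\<nu> + 1) * (16 * (\<nu> + 1)^2 + 0) * qa \<kappa> + - ((2 * \<nu> + 3) * (12 * (\<nu> + 1)^2 + 12 * (\<nu> + 1) + 4)) * qb \<kappa> + (\<nu> + 2)^3 * qc \<kappa>
        = x (\<kappa> + 1) * N \<kappa> - x \<kappa> * D \<kappa>" for \<kappa>
        unfolding qa_def qb_def qc_def x_def D_def N_def by algebra
      \<comment> \<open>\<open>D 0\<close> is nonzero for \<open>n > 0\<close>; there the other
        factor vanishes, since \<open>\<tau> 0\<close> contains \<open>ifact (- n)\<close>.\<close>
      show "D 0 * \<tau> 0 = 0"
        by (cases "n = 0") (simp_all add: D_def \<tau>_def \<nu>_def)
    qed (simp_all add: t_def \<tau>_def D_def)
  qed
  then show ?thesis by (simp add: sum) (simp add: t_def)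
qed

definition cooper_7 :: "nat \<Rightarrow> int" where
  "cooper_7 n = (\<Sum>k\<le>n. int ((n choose k)^2 * (n + k choose k) * (2 * k choose n)))"

lemma nat_solution_cooper_7: "nat_solution (Cubic 13 4 (- 27) 3) (\<lambda>n. of_int (cooper_7 n))"
proof -
  define t :: "nat \<Rightarrow> nat \<Rightarrow> rat" where "t m k = (of_nat (m choose k) * of_nat (m + k choose k)) * (of_nat (m choose k) * of_nat (2 * k choose m))" for m k
  have sum: "of_int (cooper_7 m) = (\<Sum>k\<le>m. t m k)" for m
    by (simp add: cooper_7_def t_def power2_eq_square mult_ac)
  have "(of_nat n + 1) * ((- 27) * (of_nat n + 1)^2 + 3) * (\<Sum>k\<le>n. t n k)
     + - ((2 * of_nat n + 3) * (13 * (of_nat n + 1)^2 + 13 * (of_nat n + 1) + 4)) * (\<Sum>k\<le>n + 1. t (n + 1) k)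
     + (of_nat n + 2)^3 * (\<Sum>k\<le>n + 2. t (n + 2) k) = 0" for n
  proof -
    define \<nu> :: rat where "\<nu> = of_nat n"
    define \<tau> :: "nat \<Rightarrow> rat" where "\<tau> k = fact (n + k) * fact (2 * k) * ifact (int k)^3 * ifact (int n + 2 - int k)^2 * ifact (2 * int k - int n)" for k
    define qa where "qa \<kappa> = ((\<nu> + 2 - \<kappa>) * (\<nu> + 1 - \<kappa>))^2" for \<kappa> :: rat
    define qb where "qb \<kappa> = (\<nu> + \<kappa> + 1) * (\<nu> + 2 - \<kappa>)^2 * (2 * \<kappa> - \<nu>)" for \<kappa> :: rat
    define qc where "qc \<kappa> = (\<nu> + \<kappa> + 1) * (\<nu> + \<kappa> + 2) * (2 * \<kappa> - \<nu> - 1) * (2 * \<kappa> - \<nu>)" for \<kappa> :: rat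
    define N where "N \<kappa> = 2 * (2 * \<kappa> + 1) * (\<nu> + \<kappa> + 1) * (\<nu> + 2 - \<kappa>)^2" for \<kappa> :: rat
    define D where "D \<kappa> = \<kappa>^2 * (2 * \<kappa> - \<nu>) * (2 * \<kappa> - 1 - \<nu>)" for \<kappa> :: rat
    define x where "x \<kappa> = ((44 + 72*\<nu> + 39*\<nu>^2 + 7*\<nu>^3) + (- 78 - 91*\<nu> - 26*\<nu>^2)*\<kappa> + (22 + 15*\<nu>)*\<kappa>^2)" for \<kappa> :: rat
    show ?thesis unfolding \<nu>_def[symmetric]
    proof (rule creative_telescoping[where t = t and n = n and \<tau> = \<tau> and qa = qa and qb = qb and qc = qc
          and D = D and N = N and x = x])
      show "t n k = qa (of_nat k) * \<tau> k" for k
        unfolding t_def \<tau>_def qa_def \<nu>_def unfolding binomial_mult_binomial_add_shift[of n k] binomial_mult_binomial_double_shift[of n k] by algebra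
      show "t (n + 1) k = qb (of_nat k) * \<tau> k" for k
        unfolding t_def \<tau>_def qb_def \<nu>_def unfolding binomial_mult_binomial_add_shift[of n k] binomial_mult_binomial_double_shift[of n k] by algebra
      show "t (n + 2) k = qc (of_nat k) * \<tau> k" for k
        unfolding t_def \<tau>_def qc_def \<nu>_def unfolding binomial_mult_binomial_add_shift[of n k] binomial_mult_binomial_double_shift[of n k] by algebra
      show "D (of_nat k + 1) * \<tau> (Suc k) = N (of_nat k) * \<tau> k" for k
        unfolding \<tau>_def \<nu>_def D_def N_def index_shift(2-4,6) index_shift(5)[of k n] index_shift(1)[of k] by algebra
      show "(\<nu> + 1) * ((- 27) * (\<nu> + 1)^2 + 3) * qa \<kappa> + - ((2 * \<nu> + 3) * (13 * (\<nu> + 1)^2 + 13 * (\<nu> + 1) + 4)) * qb \<kappa> + (\<nu> + 2)^3 * qc \<kappa>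
        = x (\<kappa> + 1) * N \<kappa> - x \<kappa> * D \<kappa>" for \<kappa>
        unfolding qa_def qb_def qc_def x_def D_def N_def by algebra
    qed (simp_all add: t_def \<tau>_def D_def)
  qed
  then show ?thesis by (simp add: sum) (simp add: t_def)
qed

definition cooper_10 :: "nat \<Rightarrow> int" where
  "cooper_10 n = (\<Sum>k\<le>n. int ((n choose k)^4))"

lemma nat_solution_cooper_10: "nat_solution (Cubic 6 2 (- 64) 4) (\<lambda>n. of_int (cooper_10 n))"
proof -
  define t :: "nat \<Rightarrow> nat \<Rightarrow> rat" where "t m k = of_nat (m choose k)^4" for m k
  have sum: "of_int (cooper_10 m) = (\<Sum>k\<le>m. t m k)" for m
    by (simp add: cooper_10_def t_def power2_eq_square mult_ac)
  have "(of_nat n + 1) * ((- 64) * (of_nat n + 1)^2 + 4) * (\<Sum>k\<le>n. t n k)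
     + - ((2 * of_nat n + 3) * (6 * (of_nat n + 1)^2 + 6 * (of_nat n + 1) + 2)) * (\<Sum>k\<le>n + 1. t (n + 1) k)
     + (of_nat n + 2)^3 * (\<Sum>k\<le>n + 2. t (n + 2) k) = 0" for n
  proof -
    define \<nu> :: rat where "\<nu> = of_nat n"
    define \<tau> :: "nat \<Rightarrow> rat" where "\<tau> k = fact n^4 * ifact (int k)^4 * ifact (int n + 2 - int k)^4" for k
    define qa where "qa \<kappa> = ((\<nu> + 2 - \<kappa>) * (\<nu> + 1 - \<kappa>))^4" for \<kappa> :: rat
    define qb where "qb \<kappa> = ((\<nu> + 1) * (\<nu> + 2 - \<kappa>))^4" for \<kappa> :: rat
    define qc where "qc \<kappa> = ((\<nu> + 1) * (\<nu> + 2))^4" for \<kappa> :: rat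
    define N where "N \<kappa> = (\<nu> + 2 - \<kappa>)^4" for \<kappa> :: rat
    define D where "D \<kappa> = \<kappa>^4" for \<kappa> :: rat
    define x where "x \<kappa> = (\<nu> + 1) * ((- 1080 - 4300*\<nu> - 7030*\<nu>^2 - 6045*\<nu>^3 - 2885*\<nu>^4 - 725*\<nu>^5 - 75*\<nu>^6) + (2256 + 7520*\<nu> + 9892*\<nu>^2 + 6420*\<nu>^3 + 2056*\<nu>^4 + 260*\<nu>^5)*\<kappa> + (- 1980 - 5322*\<nu> - 5298*\<nu>^2 - 2314*\<nu>^3 - 374*\<nu>^4)*\<kappa>^2 + (900 + 1844*\<nu> + 1244*\<nu>^2 + 276*\<nu>^3)*\<kappa>^3 + (- 210 - 298*\<nu> - 104*\<nu>^2)*\<kappa>^4 + (20 + 16*\<nu>)*\<kappa>^5)" for \<kappa> :: rat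
    show ?thesis unfolding \<nu>_def[symmetric]
    proof (rule creative_telescoping[where t = t and n = n and \<tau> = \<tau> and qa = qa and qb = qb and qc = qc
          and D = D and N = N and x = x])
      show "t n k = qa (of_nat k) * \<tau> k" for k
        unfolding t_def \<tau>_def qa_def \<nu>_def unfolding binomial_ifact_shift[of n k] by algebra
      show "t (n + 1) k = qb (of_nat k) * \<tau> k" for k
        unfolding t_def \<tau>_def qb_def \<nu>_def unfolding binomial_ifact_shift[of n k] by algebra
      show "t (n + 2) k = qc (of_nat k) * \<tau> k" for k
        unfolding t_def \<tau>_def qc_def \<nu>_def unfolding binomial_ifact_shift[of n k] by algebra
      show "D (of_nat k + 1) * \<tau> (Suc k) = N (of_nat k) * \<tau> k" for k
        unfolding \<tau>_def \<nu>_def D_def N_def index_shift(2-4,6) index_shift(5)[of k n] index_shift(1)[of k] by algebra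
      show "(\<nu> + 1) * ((- 64) * (\<nu> + 1)^2 + 4) * qa \<kappa> + - ((2 * \<nu> + 3) * (6 * (\<nu> + 1)^2 + 6 * (\<nu> + 1) + 2)) * qb \<kappa> + (\<nu> + 2)^3 * qc \<kappa>
        = x (\<kappa> + 1) * N \<kappa> - x \<kappa> * D \<kappa>" for \<kappa>
        unfolding qa_def qb_def qc_def x_def D_def N_def by algebra
    qed (simp_all add: t_def \<tau>_def D_def)
  qed
  then show ?thesis by (simp add: sum) (simp add: t_def)
qed

section \<open>Sums with powers of 3: the sequences B and \<delta>\<close>

definition zagier_B :: "nat \<Rightarrow> int" where
  "zagier_B n = (\<Sum>k\<le>n. (-1)^k * 3^(n - 3 * k) * int ((n choose (3 * k)) * (3 * k choose k) * (2 * k choose k)))"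

lemma nat_solution_zagier_B: "nat_solution (Quadratic 9 3 27) (\<lambda>n. of_int (zagier_B n))"
proof -
  \<comment> \<open>\<open>3^(m - 3 k)\<close> is split into \<open>3^m\<close> and
    \<open>27^(- k)\<close>: the summand becomes hypergeometric in \<open>m\<close> and
    \<open>k\<close>, without a truncated exponent.\<close>
  define t :: "nat \<Rightarrow> nat \<Rightarrow> rat" where "t m k = (- 1 / 27)^k * 3^m * (of_nat (m choose (3 * k)) * of_nat (3 * k choose k) * of_nat (2 * k choose k))" for m k
  have sum: "of_int (zagier_B m) = (\<Sum>k\<le>m. t m k)" for m
    unfolding zagier_B_def of_int_sum
  proof (rule sum.cong)
    fix k assume "k \<in> {..m}"
    have "(3 :: rat)^m = 27^k * 3^(m - 3 * k)" if "3 * k \<le> m"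
      using that power_add[of "3 :: rat" "3 * k" "m - 3 * k"] by (simp add: power_mult)
    moreover have "(- 1 / 27 :: rat)^k * 27^k = (- 1)^k" by (simp flip: power_mult_distrib)
    ultimately show "of_int ((-1)^k * 3^(m - 3 * k) * int ((m choose (3 * k)) * (3 * k choose k) * (2 * k choose k))) = t m k"
      by (cases "3 * k \<le> m") (simp_all add: t_def)
  qed simp
  have "27 * (of_nat n + 1)^2 * (\<Sum>k\<le>n. t n k)
     + - (9 * (of_nat n + 1)^2 + 9 * (of_nat n + 1) + 3) * (\<Sum>k\<le>n + 1. t (n + 1) k)
     + (of_nat n + 2)^2 * (\<Sum>k\<le>n + 2. t (n + 2) k) = 0" for n
  proof -
    define \<nu> :: rat where "\<nu> = of_nat n"
    define \<tau> :: "nat \<Rightarrow> rat" where "\<tau> k = (- 1 / 27)^k * 3^n * fact n * ifact (int k)^3 * ifact (int n + 2 - 3 * int k)" for k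
    define qa where "qa \<kappa> = (\<nu> + 2 - 3 * \<kappa>) * (\<nu> + 1 - 3 * \<kappa>)" for \<kappa> :: rat
    define qb where "qb \<kappa> = 3 * (\<nu> + 1) * (\<nu> + 2 - 3 * \<kappa>)" for \<kappa> :: rat
    define qc where "qc \<kappa> = 9 * (\<nu> + 1) * (\<nu> + 2)" for \<kappa> :: rat
    define N where "N \<kappa> = - 1 / 27 * ((\<nu> + 2 - 3 * \<kappa>) * (\<nu> + 1 - 3 * \<kappa>) * (\<nu> - 3 * \<kappa>))" for \<kappa> :: rat
    define D where "D \<kappa> = \<kappa>^3" for \<kappa> :: rat
    define x where "x \<kappa> = 243 * (\<nu> + 1) * ((- 1))" for \<kappa> :: rat
    show ?thesis unfolding \<nu>_def[symmetric]
    proof (rule creative_telescoping[where t = t and n = n and \<tau> = \<tau> and qa = qa and qb = qb and qc = qc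
          and D = D and N = N and x = x])
      show "t n k = qa (of_nat k) * \<tau> k" for k
        unfolding t_def \<tau>_def qa_def \<nu>_def unfolding trinomial_shift[of n k] by (simp add: power_add)
      show "t (n + 1) k = qb (of_nat k) * \<tau> k" for k
        unfolding t_def \<tau>_def qb_def \<nu>_def unfolding trinomial_shift[of n k] by (simp add: power_add)
      show "t (n + 2) k = qc (of_nat k) * \<tau> k" for k
        unfolding t_def \<tau>_def qc_def \<nu>_def unfolding trinomial_shift[of n k] by (simp add: power_add)
      show "D (of_nat k + 1) * \<tau> (Suc k) = N (of_nat k) * \<tau> k" for k
        unfolding \<tau>_def \<nu>_def D_def N_def index_shift(2-4,6) index_shift(5)[of k n] index_shift(1)[of k] power_Suc by algebra
      show "27 * (\<nu> + 1)^2 * qa \<kappa> + - (9 * (\<nu> + 1)^2 + 9 * (\<nu> + 1) + 3) * qb \<kappa> + (\<nu> + 2)^2 * qc \<kappa>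
        = x (\<kappa> + 1) * N \<kappa> - x \<kappa> * D \<kappa>" for \<kappa>
        unfolding qa_def qb_def qc_def x_def D_def N_def by algebra
    qed (simp_all add: t_def \<tau>_def D_def)
  qed
  then show ?thesis by (simp add: sum) (simp add: t_def)
qed

text \<open>As in \<open>zagier_B\<close>, the quotient \<open>(3 k)! / k!^3\<close> appears as
  \<open>(3 k choose k) * (2 k choose k)\<close>, and the exponent \<open>n - 3 k\<close> is
  truncated only where \<open>n choose (3 k)\<close> is 0.\<close>

definition sequence_delta :: "nat \<Rightarrow> int" where
  "sequence_delta n = (\<Sum>k\<le>n. (-1)^k * 3^(n - 3 * k) * int ((n choose (3 * k)) * (3 * k choose k) * (2 * k choose k) * (n + k choose k)))"

lemma nat_solution_sequence_delta: "nat_solution (Cubic 7 3 81 0) (\<lambda>n. of_int (sequence_delta n))"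
proof -
  define t :: "nat \<Rightarrow> nat \<Rightarrow> rat" where "t m k = (- 1 / 27)^k * 3^m * (of_nat (m choose (3 * k)) * of_nat (3 * k choose k) * of_nat (2 * k choose k) * of_nat (m + k choose k))" for m k
  have sum: "of_int (sequence_delta m) = (\<Sum>k\<le>m. t m k)" for m
    unfolding sequence_delta_def of_int_sum
  proof (rule sum.cong)
    fix k assume "k \<in> {..m}"
    have "(3 :: rat)^m = 27^k * 3^(m - 3 * k)" if "3 * k \<le> m"
      using that power_add[of "3 :: rat" "3 * k" "m - 3 * k"] by (simp add: power_mult)
    moreover have "(- 1 / 27 :: rat)^k * 27^k = (- 1)^k" by (simp flip: power_mult_distrib)
    ultimately show "of_int ((-1)^k * 3^(m - 3 * k) * int ((m choose (3 * k)) * (3 * k choose k) * (2 * k choose k) * (m + k choose k))) = t m k"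
      by (cases "3 * k \<le> m") (simp_all add: t_def)
  qed simp
  have "(of_nat n + 1) * (81 * (of_nat n + 1)^2 + 0) * (\<Sum>k\<le>n. t n k)
     + - ((2 * of_nat n + 3) * (7 * (of_nat n + 1)^2 + 7 * (of_nat n + 1) + 3)) * (\<Sum>k\<le>n + 1. t (n + 1) k)
     + (of_nat n + 2)^3 * (\<Sum>k\<le>n + 2. t (n + 2) k) = 0" for n
  proof -
    define \<nu> :: rat where "\<nu> = of_nat n"
    define \<tau> :: "nat \<Rightarrow> rat" where "\<tau> k = (- 1 / 27)^k * 3^n * fact (n + k) * ifact (int k)^4 * ifact (int n + 2 - 3 * int k)" for k
    define qa where "qa \<kappa> = (\<nu> + 2 - 3 * \<kappa>) * (\<nu> + 1 - 3 * \<kappa>)" for \<kappa> :: rat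
    define qb where "qb \<kappa> = 3 * (\<nu> + \<kappa> + 1) * (\<nu> + 2 - 3 * \<kappa>)" for \<kappa> :: rat
    define qc where "qc \<kappa> = 9 * (\<nu> + \<kappa> + 1) * (\<nu> + \<kappa> + 2)" for \<kappa> :: rat
    define N where "N \<kappa> = - 1 / 27 * ((\<nu> + \<kappa> + 1) * (\<nu> + 2 - 3 * \<kappa>) * (\<nu> + 1 - 3 * \<kappa>) * (\<nu> - 3 * \<kappa>))" for \<kappa> :: rat
    define D where "D \<kappa> = \<kappa>^4" for \<kappa> :: rat
    define x where "x \<kappa> = 324 * ((- 5 - 4*\<nu>))" for \<kappa> :: rat
    show ?thesis unfolding \<nu>_def[symmetric]
    proof (rule creative_telescoping[where t = t and n = n and \<tau> = \<tau> and qa = qa and qb = qb and qc = qc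
          and D = D and N = N and x = x])
      show "t n k = qa (of_nat k) * \<tau> k" for k
        unfolding t_def \<tau>_def qa_def \<nu>_def unfolding trinomial_mult_binomial_add_shift[of n k] by (simp add: power_add)
      show "t (n + 1) k = qb (of_nat k) * \<tau> k" for k
        unfolding t_def \<tau>_def qb_def \<nu>_def unfolding trinomial_mult_binomial_add_shift[of n k] by (simp add: power_add)
      show "t (n + 2) k = qc (of_nat k) * \<tau> k" for k
        unfolding t_def \<tau>_def qc_def \<nu>_def unfolding trinomial_mult_binomial_add_shift[of n k] by (simp add: power_add)
      show "D (of_nat k + 1) * \<tau> (Suc k) = N (of_nat k) * \<tau> k" for k
        unfolding \<tau>_def \<nu>_def D_def N_def index_shift(2-4,6) index_shift(5)[of k n] index_shift(1)[of k] power_Suc by algebra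
      show "(\<nu> + 1) * (81 * (\<nu> + 1)^2 + 0) * qa \<kappa> + - ((2 * \<nu> + 3) * (7 * (\<nu> + 1)^2 + 7 * (\<nu> + 1) + 3)) * qb \<kappa> + (\<nu> + 2)^3 * qc \<kappa>
        = x (\<kappa> + 1) * N \<kappa> - x \<kappa> * D \<kappa>" for \<kappa>
        unfolding qa_def qb_def qc_def x_def D_def N_def by algebra
    qed (simp_all add: t_def \<tau>_def D_def)
  qed
  then show ?thesis by (simp add: sum) (simp add: t_def)
qed

definition zagier_E :: "nat \<Rightarrow> int" where
  "zagier_E n = (\<Sum>k\<le>n. int ((n choose k) * (2 * k choose k) * (2 * (n - k) choose (n - k))))"

lemma nat_solution_zagier_E: "nat_solution (Quadratic 12 4 32) (\<lambda>n. of_int (zagier_E n))"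
proof -
  \<comment> \<open>The integer argument keeps the recurrence of the central binomial coefficient
    valid past \<open>k = m\<close>, where truncated subtraction would produce the value 1.\<close>
  define t :: "nat \<Rightarrow> nat \<Rightarrow> rat" where "t m k = of_nat (2 * k choose k) * (of_nat (m choose k) * central_binomial (int m - int k))" for m k
  have sum: "of_int (zagier_E m) = (\<Sum>k\<le>m. t m k)" for m
    by (auto simp: zagier_E_def t_def central_binomial_def nat_diff_distrib power2_eq_square mult_ac of_nat_diff intro!: sum.cong)
  have "32 * (of_nat n + 1)^2 * (\<Sum>k\<le>n. t n k)
     + - (12 * (of_nat n + 1)^2 + 12 * (of_nat n + 1) + 4) * (\<Sum>k\<le>n + 1. t (n + 1) k)
     + (of_nat n + 2)^2 * (\<Sum>k\<le>n + 2. t (n + 2) k) = 0" for n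
  proof -
    define \<nu> :: rat where "\<nu> = of_nat n"
    define \<tau> :: "nat \<Rightarrow> rat" where "\<tau> k = fact n * fact (2 * k) * ifact (int k)^3 * ifact (int n + 2 - int k) * central_base n k" for k
    define qa where "qa \<kappa> = ((\<nu> + 2 - \<kappa>) * (\<nu> + 1 - \<kappa>))^2" for \<kappa> :: rat
    define qb where "qb \<kappa> = 2 * (\<nu> + 1) * (\<nu> + 2 - \<kappa>)^2 * (2 * \<nu> - 2 * \<kappa> + 1)" for \<kappa> :: rat
    define qc where "qc \<kappa> = 4 * (\<nu> + 1) * (\<nu> + 2) * (2 * \<nu> - 2 * \<kappa> + 3) * (2 * \<nu> - 2 * \<kappa> + 1)" for \<kappa> :: rat
    define N where "N \<kappa> = 2 * (2 * \<kappa> + 1) * (\<nu> + 2 - \<kappa>)^2" for \<kappa> :: rat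
    define D where "D \<kappa> = \<kappa>^2 * (2 * (2 * \<nu> - 2 * \<kappa> + 1))" for \<kappa> :: rat
    define x where "x \<kappa> = 2 * (\<nu> + 1) * ((- 2 - 5*\<nu> - 2*\<nu>^2) + (2 + 2*\<nu>)*\<kappa>)" for \<kappa> :: rat
    show ?thesis unfolding \<nu>_def[symmetric]
    proof (rule creative_telescoping[where t = t and n = n and \<tau> = \<tau> and qa = qa and qb = qb and qc = qc
          and D = D and N = N and x = x])
      show "t n k = qa (of_nat k) * \<tau> k" for k
        unfolding t_def \<tau>_def qa_def \<nu>_def unfolding central_binomial_fact binomial_mult_central_shift[of n k] by algebra
      show "t (n + 1) k = qb (of_nat k) * \<tau> k" for k
        unfolding t_def \<tau>_def qb_def \<nu>_def unfolding central_binomial_fact binomial_mult_central_shift[of n k] by algebra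
      show "t (n + 2) k = qc (of_nat k) * \<tau> k" for k
        unfolding t_def \<tau>_def qc_def \<nu>_def unfolding central_binomial_fact binomial_mult_central_shift[of n k] by algebra
      show "D (of_nat k + 1) * \<tau> (Suc k) = N (of_nat k) * \<tau> k" for k
        using central_base_shift(4)[of n k] unfolding \<tau>_def \<nu>_def D_def N_def index_shift(2-4,6) index_shift(5)[of k n] index_shift(1)[of k] by algebra
      show "32 * (\<nu> + 1)^2 * qa \<kappa> + - (12 * (\<nu> + 1)^2 + 12 * (\<nu> + 1) + 4) * qb \<kappa> + (\<nu> + 2)^2 * qc \<kappa>
        = x (\<kappa> + 1) * N \<kappa> - x \<kappa> * D \<kappa>" for \<kappa>
        unfolding qa_def qb_def qc_def x_def D_def N_def by algebra
    qed (use central_base_zero[of n] in \<open>simp_all add: t_def \<tau>_def D_def central_binomial_def\<close>)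
  qed
  then show ?thesis by (simp add: sum) (simp add: t_def central_binomial_def)
qed

definition domb :: "nat \<Rightarrow> int" where
  "domb n = (\<Sum>k\<le>n. int ((n choose k)^2 * (2 * k choose k) * (2 * (n - k) choose (n - k))))"

lemma nat_solution_domb: "nat_solution (Cubic 10 4 64 0) (\<lambda>n. of_int (domb n))"
proof -
  define t :: "nat \<Rightarrow> nat \<Rightarrow> rat" where "t m k = of_nat (2 * k choose k) * of_nat (m choose k) * (of_nat (m choose k) * central_binomial (int m - int k))" for m k
  have sum: "of_int (domb m) = (\<Sum>k\<le>m. t m k)" for m
    by (auto simp: domb_def t_def central_binomial_def nat_diff_distrib power2_eq_square mult_ac of_nat_diff intro!: sum.cong)
  have "(of_nat n + 1) * (64 * (of_nat n + 1)^2 + 0) * (\<Sum>k\<le>n. t n k)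
     + - ((2 * of_nat n + 3) * (10 * (of_nat n + 1)^2 + 10 * (of_nat n + 1) + 4)) * (\<Sum>k\<le>n + 1. t (n + 1) k)
     + (of_nat n + 2)^3 * (\<Sum>k\<le>n + 2. t (n + 2) k) = 0" for n
  proof -
    define \<nu> :: rat where "\<nu> = of_nat n"
    define \<tau> :: "nat \<Rightarrow> rat" where "\<tau> k = fact n^2 * fact (2 * k) * ifact (int k)^4 * ifact (int n + 2 - int k)^2 * central_base n k" for k
    define qa where "qa \<kappa> = ((\<nu> + 2 - \<kappa>) * (\<nu> + 1 - \<kappa>))^3" for \<kappa> :: rat
    define qb where "qb \<kappa> = 2 * (\<nu> + 1)^2 * (\<nu> + 2 - \<kappa>)^3 * (2 * \<nu> - 2 * \<kappa> + 1)" for \<kappa> :: rat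
    define qc where "qc \<kappa> = 4 * ((\<nu> + 1) * (\<nu> + 2))^2 * (2 * \<nu> - 2 * \<kappa> + 3) * (2 * \<nu> - 2 * \<kappa> + 1)" for \<kappa> :: rat
    define N where "N \<kappa> = 2 * (2 * \<kappa> + 1) * (\<nu> + 2 - \<kappa>)^3" for \<kappa> :: rat
    define D where "D \<kappa> = \<kappa>^3 * (2 * (2 * \<nu> - 2 * \<kappa> + 1))" for \<kappa> :: rat
    define x where "x \<kappa> = 2 * (\<nu> + 1) * (\<nu> + 1) * ((- 56 - 104*\<nu> - 62*\<nu>^2 - 12*\<nu>^3) + (74 + 89*\<nu> + 26*\<nu>^2)*\<kappa> + (- 30 - 18*\<nu>)*\<kappa>^2 + (4)*\<kappa>^3)" for \<kappa> :: rat
    show ?thesis unfolding \<nu>_def[symmetric]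
    proof (rule creative_telescoping[where t = t and n = n and \<tau> = \<tau> and qa = qa and qb = qb and qc = qc
          and D = D and N = N and x = x])
      show "t n k = qa (of_nat k) * \<tau> k" for k
        unfolding t_def \<tau>_def qa_def \<nu>_def unfolding central_binomial_fact binomial_mult_central_shift[of n k] unfolding binomial_ifact_shift[of n k] by algebra
      show "t (n + 1) k = qb (of_nat k) * \<tau> k" for k
        unfolding t_def \<tau>_def qb_def \<nu>_def unfolding central_binomial_fact binomial_mult_central_shift[of n k] unfolding binomial_ifact_shift[of n k] by algebra
      show "t (n + 2) k = qc (of_nat k) * \<tau> k" for k
        unfolding t_def \<tau>_def qc_def \<nu>_def unfolding central_binomial_fact binomial_mult_central_shift[of n k] unfolding binomial_ifact_shift[of n k] by algebra
      show "D (of_nat k + 1) * \<tau> (Suc k) = N (of_nat k) * \<tau> k" for k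
        using central_base_shift(4)[of n k] unfolding \<tau>_def \<nu>_def D_def N_def index_shift(2-4,6) index_shift(5)[of k n] index_shift(1)[of k] by algebra
      show "(\<nu> + 1) * (64 * (\<nu> + 1)^2 + 0) * qa \<kappa> + - ((2 * \<nu> + 3) * (10 * (\<nu> + 1)^2 + 10 * (\<nu> + 1) + 4)) * qb \<kappa> + (\<nu> + 2)^3 * qc \<kappa>
        = x (\<kappa> + 1) * N \<kappa> - x \<kappa> * D \<kappa>" for \<kappa>
        unfolding qa_def qb_def qc_def x_def D_def N_def by algebra
    qed (use central_base_zero[of n] in \<open>simp_all add: t_def \<tau>_def D_def central_binomial_def\<close>)
  qed
  then show ?thesis by (simp add: sum) (simp add: t_def central_binomial_def)
qed

text \<open>The closed forms for \<open>s\<^sub>1\<^sub>8\<close> and \<open>\<eta>\<close> give \<open>2\<close> rather than \<open>1\<close> at \<open>n = 0\<close>, hence the separate treatment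
  of \<open>n = 0\<close> in the definitions of the two sequences; truncated subtraction is harmless thanks to the guards.\<close>

definition cooper_18_factor :: "nat \<Rightarrow> nat \<Rightarrow> int" where
  "cooper_18_factor n k
    = (if 3 * k \<le> n then int ((2 * n - 3 * k - 1 choose n) + (2 * n - 3 * k choose n)) else 0)"

definition cooper_18 :: "nat \<Rightarrow> int" where
  "cooper_18 n = (\<Sum>k\<le>n. (-1)^k * int ((n choose k) * (2 * k choose k) * (2 * (n - k) choose (n - k)))
    * (if n = 0 then 1 else cooper_18_factor n k))"

text \<open>The common part of the three shifted factors. From \<open>3 k <= n + 2\<close> and
  \<open>n >= 2\<close> follows \<open>3 k < 2 n\<close>, so that \<open>2 n - 3 k - 1\<close> is a
  genuine difference; this is the origin of the bound \<open>2 <= n\<close> below.\<close>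

definition cooper_18_base :: "nat \<Rightarrow> nat \<Rightarrow> rat" where
  "cooper_18_base n k = (if 3 * k \<le> n + 2 then fact (2 * n - 3 * k - 1) * ifact (int n + 2 - 3 * int k) else 0)"

text \<open>The sum of the two coefficients is \<open>(2 m - n) / m\<close> times
  \<open>m choose n\<close>, a single hypergeometric term. For \<open>m = 2 n - 3 k\<close> the
  linear factor is \<open>3 (n - 2 k)\<close>; for \<open>m = 4 n - 5 k\<close> over the lower index
  \<open>3 n\<close> it is \<open>5 (n - 2 k)\<close>.\<close>

lemma binomial_plus_pred:
  assumes "0 < m"
  shows "of_nat ((m - 1 choose n) + (m choose n)) * (fact n :: rat)
    = (2 * of_nat m - of_nat n) * fact (m - 1) * ifact (int m - int n)"
proof -
  obtain l where m: "m = Suc l" using assms by (cases m) auto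
  have "int l - int n = int (Suc l) - int n - 1" by simp
  then have "of_nat ((l choose n) + (Suc l choose n))
    = (2 * of_nat (Suc l) - of_nat n) * fact l * ifact (int (Suc l) - int n) * ifact (int n)"
    unfolding of_nat_add of_nat_binomial_ifact by (simp only: ifact_rec) (simp add: algebra_simps)
  then have "of_nat ((l choose n) + (Suc l choose n)) * fact n
    = (2 * of_nat (Suc l) - of_nat n) * fact l * ifact (int (Suc l) - int n) * (fact n * ifact (int n))"
    by (simp only: mult_ac)
  then show ?thesis unfolding ifact_fact m by simp
qed

lemma cooper_18_factor_closed:
  assumes "0 < n"
  shows "of_int (cooper_18_factor n k) * fact n
    = (if 3 * k \<le> n then 3 * (of_nat n - 2 * of_nat k) * fact (2 * n - 3 * k - 1) * ifact (int n - 3 * int k) else 0)"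
proof (cases "3 * k \<le> n")
  case True
  then have m: "0 < 2 * n - 3 * k" "int (2 * n - 3 * k) - int n = int n - 3 * int k"
    "of_nat (2 * n - 3 * k) = (2 * of_nat n - 3 * of_nat k :: rat)"
    using assms by (auto simp: of_nat_diff)
  show ?thesis
    using binomial_plus_pred[OF m(1), of n] True unfolding m(2,3) by (simp add: cooper_18_factor_def algebra_simps)
qed (simp add: cooper_18_factor_def)

lemma cooper_18_base_shift:
  assumes "2 \<le> n"
  shows
  "of_int (cooper_18_factor n k) * fact n
    = 3 * (of_nat n - 2 * of_nat k) * (of_nat n + 2 - 3 * of_nat k) * (of_nat n + 1 - 3 * of_nat k) * cooper_18_base n k"
  "of_int (cooper_18_factor (n + 1) k) * ((of_nat n + 1) * fact n)
    = 3 * (of_nat n + 1 - 2 * of_nat k) * (2 * of_nat n - 3 * of_nat k) * (2 * of_nat n - 3 * of_nat k + 1)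
      * (of_nat n + 2 - 3 * of_nat k) * cooper_18_base n k"
  "of_int (cooper_18_factor (n + 2) k) * ((of_nat n + 1) * (of_nat n + 2) * fact n)
    = 3 * (of_nat n + 2 - 2 * of_nat k) * (2 * of_nat n - 3 * of_nat k) * (2 * of_nat n - 3 * of_nat k + 1)
      * (2 * of_nat n - 3 * of_nat k + 2) * (2 * of_nat n - 3 * of_nat k + 3) * cooper_18_base n k"
  "(2 * of_nat n - 3 * of_nat k - 1) * (2 * of_nat n - 3 * of_nat k - 2) * (2 * of_nat n - 3 * of_nat k - 3)
      * cooper_18_base n (Suc k)
    = (of_nat n + 2 - 3 * of_nat k) * (of_nat n + 1 - 3 * of_nat k) * (of_nat n - 3 * of_nat k) * cooper_18_base n k"
proof -
  define I where "I = ifact (int n + 2 - 3 * int k)"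
  \<comment> \<open>The guards of the three factors end at \<open>n\<close>, \<open>n + 1\<close>,
    \<open>n + 2\<close>, the base only at \<open>n + 2\<close>; in between, the linear factors
    \<open>n + 1 - 3 k\<close> and \<open>n + 2 - 3 k\<close> provide the zeros.\<close>
  consider "3 * k \<le> n" | "3 * k = n + 1" | "3 * k = n + 2" | "3 * k > n + 2" by linarith
  note cs = this
  have I: "ifact (int n - 3 * int k) = (of_nat n + 1 - 3 * of_nat k) * (of_nat n + 2 - 3 * of_nat k) * I"
    "ifact (int (n + 1) - 3 * int k) = (of_nat n + 2 - 3 * of_nat k) * I"
    "ifact (int (n + 2) - 3 * int k) = I"
    using ifact_diff_triple[of n k] by (simp_all add: I_def add.commute)
  have fs: "fact (2 * (n + 1) - 3 * k - 1)
      = (2 * of_nat n - 3 * of_nat k + 1) * (2 * of_nat n - 3 * of_nat k) * (fact (2 * n - 3 * k - 1) :: rat)"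
    "fact (2 * (n + 2) - 3 * k - 1)
      = (2 * of_nat n - 3 * of_nat k + 3) * (2 * of_nat n - 3 * of_nat k + 2)
        * (2 * of_nat n - 3 * of_nat k + 1) * (2 * of_nat n - 3 * of_nat k) * (fact (2 * n - 3 * k - 1) :: rat)"
    if "3 * k \<le> n + 2"
  proof -
    define j where "j = 2 * n - 3 * k - 1"
    show "fact (2 * (n + 1) - 3 * k - 1)
      = (2 * of_nat n - 3 * of_nat k + 1) * (2 * of_nat n - 3 * of_nat k) * (fact (2 * n - 3 * k - 1) :: rat)"
      "fact (2 * (n + 2) - 3 * k - 1)
      = (2 * of_nat n - 3 * of_nat k + 3) * (2 * of_nat n - 3 * of_nat k + 2)
        * (2 * of_nat n - 3 * of_nat k + 1) * (2 * of_nat n - 3 * of_nat k) * (fact (2 * n - 3 * k - 1) :: rat)"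
    proof -
      have "2 * n > 3 * k" using that assms by presburger
      then have e: "2 * n = Suc (j + 3 * k)" by (simp add: j_def)
      then have r: "2 * of_nat n = (of_nat j + 1 + 3 * of_nat k :: rat)"
        by (metis add.commute add.left_commute of_nat_Suc of_nat_add of_nat_mult of_nat_numeral)
      have idx: "2 * n - 3 * k - 1 = j" "2 * (n + 1) - 3 * k - 1 = Suc (Suc j)"
        "2 * (n + 2) - 3 * k - 1 = Suc (Suc (Suc (Suc j)))" using e by simp_all
      show "fact (2 * (n + 1) - 3 * k - 1)
      = (2 * of_nat n - 3 * of_nat k + 1) * (2 * of_nat n - 3 * of_nat k) * (fact (2 * n - 3 * k - 1) :: rat)"
      "fact (2 * (n + 2) - 3 * k - 1)
      = (2 * of_nat n - 3 * of_nat k + 3) * (2 * of_nat n - 3 * of_nat k + 2)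
        * (2 * of_nat n - 3 * of_nat k + 1) * (2 * of_nat n - 3 * of_nat k) * (fact (2 * n - 3 * k - 1) :: rat)"
        unfolding idx r by (simp_all add: algebra_simps)
    qed
  qed
  have zero: "(of_nat n + 1 - 3 * of_nat k :: rat) = 0" if "3 * k = n + 1"
    using that by (metis diff_self of_nat_1 of_nat_add of_nat_mult of_nat_numeral)
  have zero': "(of_nat n + 2 - 3 * of_nat k :: rat) = 0" if "3 * k = n + 2"
    using that by (metis diff_self of_nat_add of_nat_mult of_nat_numeral)
  show "of_int (cooper_18_factor n k) * fact n
    = 3 * (of_nat n - 2 * of_nat k) * (of_nat n + 2 - 3 * of_nat k) * (of_nat n + 1 - 3 * of_nat k) * cooper_18_base n k"
    using cs cooper_18_factor_closed[of n k] assms I(1) zero zero'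
    by cases (auto simp: cooper_18_base_def I_def[symmetric])
  show "of_int (cooper_18_factor (n + 1) k) * ((of_nat n + 1) * fact n)
    = 3 * (of_nat n + 1 - 2 * of_nat k) * (2 * of_nat n - 3 * of_nat k) * (2 * of_nat n - 3 * of_nat k + 1)
      * (of_nat n + 2 - 3 * of_nat k) * cooper_18_base n k"
    using cooper_18_factor_closed[of "n + 1" k] fs(1) zero'
    unfolding I(2) fact_reduce[of "n + 1"] I_def cooper_18_base_def
    by (cases "3 * k \<le> n + 1"; cases "3 * k = n + 2") (simp_all add: mult_ac add_ac)
  show "of_int (cooper_18_factor (n + 2) k) * ((of_nat n + 1) * (of_nat n + 2) * fact n)
    = 3 * (of_nat n + 2 - 2 * of_nat k) * (2 * of_nat n - 3 * of_nat k) * (2 * of_nat n - 3 * of_nat k + 1)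
      * (2 * of_nat n - 3 * of_nat k + 2) * (2 * of_nat n - 3 * of_nat k + 3) * cooper_18_base n k"
    using cooper_18_factor_closed[of "n + 2" k] fs(2) zero'
    unfolding I(3) I_def cooper_18_base_def
    by (cases "3 * k \<le> n + 2") (simp_all add: mult_ac add_ac)
  show "(2 * of_nat n - 3 * of_nat k - 1) * (2 * of_nat n - 3 * of_nat k - 2) * (2 * of_nat n - 3 * of_nat k - 3)
      * cooper_18_base n (Suc k)
    = (of_nat n + 2 - 3 * of_nat k) * (of_nat n + 1 - 3 * of_nat k) * (of_nat n - 3 * of_nat k) * cooper_18_base n k"
  proof (cases "3 * Suc k \<le> n + 2")
    case True
    define j where "j = 2 * n - 3 * Suc k - 1"
    have "2 * n > 3 * Suc k" using True assms by presburger
    then have e: "2 * n = j + 3 * k + 4" by (simp add: j_def)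
    then have r: "2 * of_nat n = (of_nat j + 3 * of_nat k + 4 :: rat)"
      by (metis of_nat_add of_nat_mult of_nat_numeral)
    have idx: "2 * n - 3 * k - 1 = Suc (Suc (Suc j))" "2 * n - 3 * Suc k - 1 = j" using e by simp_all
    show ?thesis
      using True unfolding cooper_18_base_def index_shift(6) idx r I_def[symmetric] by (simp add: algebra_simps)
  next
    case False
    then show ?thesis
      using index_shift(6)[of n k] ifact_neg[of "int n + 2 - 3 * int (Suc k)"]
      by (auto simp: cooper_18_base_def)
  qed
qed

lemma nat_solution_cooper_18: "nat_solution (Cubic 14 6 192 (- 12)) (\<lambda>n. of_int (cooper_18 n))"
proof -
  \<comment> \<open>At \<open>n = 0\<close> the sum is replaced by 1, and at \<open>n = 1\<close>
    the base of the shifts breaks down for \<open>k = 1\<close>; the recurrence at these two indices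
    is checked on the first four values.\<close>
  have init: "cooper_18 0 = 1" "cooper_18 (Suc 0) = 6" "cooper_18 (Suc (Suc 0)) = 54" "cooper_18 (Suc (Suc (Suc 0))) = 564"
    by code_simp+
  define t :: "nat \<Rightarrow> nat \<Rightarrow> rat" where "t m k = (- 1)^k * of_nat (2 * k choose k) * (of_nat (m choose k) * central_binomial (int m - int k)) * of_int (cooper_18_factor m k)" for m k
  have sum: "of_int (cooper_18 m) = (\<Sum>k\<le>m. t m k)" if "0 < m" for m
    using that by (auto simp: cooper_18_def t_def central_binomial_def nat_diff_distrib of_nat_diff mult_ac intro!: sum.cong)
  have "(of_nat n + 1) * (192 * (of_nat n + 1)^2 + (- 12)) * (\<Sum>k\<le>n. t n k)
     + - ((2 * of_nat n + 3) * (14 * (of_nat n + 1)^2 + 14 * (of_nat n + 1) + 6)) * (\<Sum>k\<le>n + 1. t (n + 1) k)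
     + (of_nat n + 2)^3 * (\<Sum>k\<le>n + 2. t (n + 2) k) = 0" if "2 \<le> n" for n
  proof -
    define \<nu> :: rat where "\<nu> = of_nat n"
    define \<tau> :: "nat \<Rightarrow> rat" where "\<tau> k = (- 1)^k * fact (2 * k) * ifact (int k)^3 * ifact (int n + 2 - int k) * central_base n k * cooper_18_base n k" for k
    define qa where "qa \<kappa> = 3 * (\<nu> - 2 * \<kappa>) * ((\<nu> + 2 - \<kappa>) * (\<nu> + 1 - \<kappa>))^2 * ((\<nu> + 2 - 3 * \<kappa>) * (\<nu> + 1 - 3 * \<kappa>))" for \<kappa> :: rat
    define qb where "qb \<kappa> = 3 * (\<nu> + 1 - 2 * \<kappa>) * 2 * (\<nu> + 2 - \<kappa>)^2 * (2 * \<nu> - 2 * \<kappa> + 1) * ((2 * \<nu> - 3 * \<kappa>) * (2 * \<nu> - 3 * \<kappa> + 1)) * (\<nu> + 2 - 3 * \<kappa>)" for \<kappa> :: rat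
    define qc where "qc \<kappa> = 3 * (\<nu> + 2 - 2 * \<kappa>) * 4 * (2 * \<nu> - 2 * \<kappa> + 3) * (2 * \<nu> - 2 * \<kappa> + 1) * ((2 * \<nu> - 3 * \<kappa>) * (2 * \<nu> - 3 * \<kappa> + 1) * (2 * \<nu> - 3 * \<kappa> + 2) * (2 * \<nu> - 3 * \<kappa> + 3))" for \<kappa> :: rat
    define N where "N \<kappa> = - (2 * (2 * \<kappa> + 1) * (\<nu> + 2 - \<kappa>)^2 * ((\<nu> + 2 - 3 * \<kappa>) * (\<nu> + 1 - 3 * \<kappa>) * (\<nu> - 3 * \<kappa>)))" for \<kappa> :: rat
    define D where "D \<kappa> = \<kappa>^2 * (2 * (2 * \<nu> - 2 * \<kappa> + 1)) * ((2 * \<nu> - 3 * \<kappa> + 2) * (2 * \<nu> - 3 * \<kappa> + 1) * (2 * \<nu> - 3 * \<kappa>))" for \<kappa> :: rat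
    define x where "x \<kappa> = 6 * ((- 24 - 84*\<nu> - 98*\<nu>^2 - 47*\<nu>^3 - 8*\<nu>^4) + (38*\<nu> + 47*\<nu>^2 + 14*\<nu>^3)*\<kappa> + (9 - 3*\<nu> - 6*\<nu>^2)*\<kappa>^2)" for \<kappa> :: rat
    show ?thesis unfolding \<nu>_def[symmetric]
    proof (rule creative_telescoping[where t = t and n = n and \<tau> = \<tau> and qa = qa and qb = qb and qc = qc
          and D = D and N = N and x = x])
      show "t n k = qa (of_nat k) * \<tau> k" for k
        proof -
        \<comment> \<open>Naming the sign makes it an indeterminate, so that \<open>algebra\<close>
          faces a purely polynomial identity.\<close>
        define s :: rat where "s = (- 1)^k"
        show ?thesis
          unfolding t_def \<tau>_def qa_def \<nu>_def unfolding central_binomial_fact binomial_mult_central_shift[of n k] s_def[symmetric]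
          using cooper_18_base_shift(1)[OF that, of k] by algebra
      qed
      show "t (n + 1) k = qb (of_nat k) * \<tau> k" for k
        proof -
        define s :: rat where "s = (- 1)^k"
        show ?thesis
          unfolding t_def \<tau>_def qb_def \<nu>_def unfolding central_binomial_fact binomial_mult_central_shift[of n k] s_def[symmetric]
          using cooper_18_base_shift(2)[OF that, of k] by algebra
      qed
      show "t (n + 2) k = qc (of_nat k) * \<tau> k" for k
        proof -
        define s :: rat where "s = (- 1)^k"
        show ?thesis
          unfolding t_def \<tau>_def qc_def \<nu>_def unfolding central_binomial_fact binomial_mult_central_shift[of n k] s_def[symmetric]
          using cooper_18_base_shift(3)[OF that, of k] by algebra
      qed
      show "D (of_nat k + 1) * \<tau> (Suc k) = N (of_nat k) * \<tau> k" for k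
        proof -
        define s :: rat where "s = (- 1)^k"
        show ?thesis
          unfolding \<tau>_def \<nu>_def D_def N_def power_Suc index_shift(2,4) index_shift(1)[of k] s_def[symmetric]
          using central_base_shift(4)[of n k] cooper_18_base_shift(4)[OF that, of k] by algebra
      qed
      show "(\<nu> + 1) * (192 * (\<nu> + 1)^2 + (- 12)) * qa \<kappa> + - ((2 * \<nu> + 3) * (14 * (\<nu> + 1)^2 + 14 * (\<nu> + 1) + 6)) * qb \<kappa> + (\<nu> + 2)^3 * qc \<kappa>
        = x (\<kappa> + 1) * N \<kappa> - x \<kappa> * D \<kappa>" for \<kappa>
        unfolding qa_def qb_def qc_def x_def D_def N_def by algebra
    qed (use central_base_zero[of n] in \<open>simp_all add: t_def \<tau>_def D_def\<close>)
  qed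
  then have rec: "(of_nat n + 1) * (192 * (of_nat n + 1)^2 + (- 12)) * of_int (cooper_18 n) + - ((2 * of_nat n + 3) * (14 * (of_nat n + 1)^2 + 14 * (of_nat n + 1) + 6)) * of_int (cooper_18 (n + 1)) + (of_nat n + 2)^3 * of_int (cooper_18 (n + 2)) = (0 :: rat)" if "2 \<le> n" for n
    using that sum[of n] sum[of "n + 1"] sum[of "n + 2"] by simp
  have "(of_nat n + 1) * (192 * (of_nat n + 1)^2 + (- 12)) * of_int (cooper_18 n) + - ((2 * of_nat n + 3) * (14 * (of_nat n + 1)^2 + 14 * (of_nat n + 1) + 6)) * of_int (cooper_18 (n + 1)) + (of_nat n + 2)^3 * of_int (cooper_18 (n + 2)) = (0 :: rat)" for n
  proof (cases "2 \<le> n")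
    case False
    then have "n = 0 \<or> n = 1" by linarith
    then show ?thesis
      by (auto simp: init numeral_2_eq_2 numeral_3_eq_3)
  qed (rule rec)
  then show ?thesis by (simp add: init)
qed

definition eta_factor :: "nat \<Rightarrow> nat \<Rightarrow> int" where
  "eta_factor n k
    = (if 5 * k \<le> n then int ((4 * n - 5 * k - 1 choose (3 * n)) + (4 * n - 5 * k choose (3 * n))) else 0)"

definition sequence_eta :: "nat \<Rightarrow> int" where
  "sequence_eta n = (\<Sum>k\<le>n. (-1)^k * int ((n choose k)^3) * (if n = 0 then 1 else eta_factor n k))"

text \<open>Besides the analogue of \<open>cooper_18_base\<close> it contains
  \<open>ifact (3 n + 6)\<close>, since \<open>n\<close> also enters the lower index
  \<open>3 n\<close>. On \<open>5 k <= n + 2\<close> the difference \<open>4 n - 5 k - 1\<close> is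
  genuine as soon as \<open>n >= 1\<close>, so only the recurrence at \<open>n = 0\<close> is left
  to be checked on values.\<close>

definition eta_base :: "nat \<Rightarrow> nat \<Rightarrow> rat" where
  "eta_base n k = (if 5 * k \<le> n + 2 then fact (4 * n - 5 * k - 1) * ifact (int n + 2 - 5 * int k) else 0) * ifact (3 * int n + 6)"

lemma eta_factor_closed:
  assumes "0 < n"
  shows "of_int (eta_factor n k)
    = (if 5 * k \<le> n then 5 * (of_nat n - 2 * of_nat k) * fact (4 * n - 5 * k - 1) * ifact (int n - 5 * int k) else 0)
      * ifact (3 * int n)"
proof (cases "5 * k \<le> n")
  case True
  then have m: "0 < 4 * n - 5 * k" "int (4 * n - 5 * k) - int (3 * n) = int n - 5 * int k"
    "of_nat (4 * n - 5 * k) = (4 * of_nat n - 5 * of_nat k :: rat)"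
    using assms by (auto simp: of_nat_diff)
  have "of_int (eta_factor n k) * fact (3 * n)
    = 5 * (of_nat n - 2 * of_nat k) * fact (4 * n - 5 * k - 1) * ifact (int n - 5 * int k)"
    using binomial_plus_pred[OF m(1), of "3 * n"] True unfolding m(2,3) by (simp add: eta_factor_def algebra_simps)
  then have "of_int (eta_factor n k) * (fact (3 * n) * ifact (int (3 * n)))
    = 5 * (of_nat n - 2 * of_nat k) * fact (4 * n - 5 * k - 1) * ifact (int n - 5 * int k) * ifact (int (3 * n))"
    by (simp only: mult.assoc[symmetric])
  then show ?thesis using True unfolding ifact_fact by simp
qed (simp add: eta_factor_def)

lemma ifact_triple_shift:
  "ifact (3 * int n) = (3 * of_nat n + 1) * (3 * of_nat n + 2) * (3 * of_nat n + 3) * (3 * of_nat n + 4)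
    * (3 * of_nat n + 5) * (3 * of_nat n + 6) * ifact (3 * int n + 6)"
  "ifact (3 * int (n + 1)) = (3 * of_nat n + 4) * (3 * of_nat n + 5) * (3 * of_nat n + 6) * ifact (3 * int n + 6)"
  "ifact (3 * int (n + 2)) = ifact (3 * int n + 6)"
proof -
  have *: "3 * int n = 3 * int n + 6 - 1 - 1 - 1 - 1 - 1 - 1" "3 * int (n + 1) = 3 * int n + 6 - 1 - 1 - 1" by simp_all
  show "ifact (3 * int n) = (3 * of_nat n + 1) * (3 * of_nat n + 2) * (3 * of_nat n + 3) * (3 * of_nat n + 4)
    * (3 * of_nat n + 5) * (3 * of_nat n + 6) * ifact (3 * int n + 6)"
    by (subst *(1)) (simp only: ifact_rec, simp add: add_ac mult_ac)
  show "ifact (3 * int (n + 1)) = (3 * of_nat n + 4) * (3 * of_nat n + 5) * (3 * of_nat n + 6) * ifact (3 * int n + 6)"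
    by (subst *(2)) (simp only: ifact_rec, simp add: add_ac mult_ac)
  show "ifact (3 * int (n + 2)) = ifact (3 * int n + 6)" by (simp add: algebra_simps)
qed

lemma eta_base_shift:
  assumes "1 \<le> n"
  shows
  "of_int (eta_factor n k) = 5 * (of_nat n - 2 * of_nat k)
      * ((3 * of_nat n + 1) * (3 * of_nat n + 2) * (3 * of_nat n + 3) * (3 * of_nat n + 4) * (3 * of_nat n + 5) * (3 * of_nat n + 6))
      * ((of_nat n + 2 - 5 * of_nat k) * (of_nat n + 1 - 5 * of_nat k)) * eta_base n k"
  "of_int (eta_factor (n + 1) k) = 5 * (of_nat n + 1 - 2 * of_nat k)
      * ((3 * of_nat n + 4) * (3 * of_nat n + 5) * (3 * of_nat n + 6))
      * ((4 * of_nat n - 5 * of_nat k) * (4 * of_nat n - 5 * of_nat k + 1) * (4 * of_nat n - 5 * of_nat k + 2) * (4 * of_nat n - 5 * of_nat k + 3))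
      * (of_nat n + 2 - 5 * of_nat k) * eta_base n k"
  "of_int (eta_factor (n + 2) k) = 5 * (of_nat n + 2 - 2 * of_nat k)
      * ((4 * of_nat n - 5 * of_nat k) * (4 * of_nat n - 5 * of_nat k + 1) * (4 * of_nat n - 5 * of_nat k + 2) * (4 * of_nat n - 5 * of_nat k + 3)
        * (4 * of_nat n - 5 * of_nat k + 4) * (4 * of_nat n - 5 * of_nat k + 5) * (4 * of_nat n - 5 * of_nat k + 6) * (4 * of_nat n - 5 * of_nat k + 7))
      * eta_base n k"
  "(4 * of_nat n - 5 * of_nat k - 1) * (4 * of_nat n - 5 * of_nat k - 2) * (4 * of_nat n - 5 * of_nat k - 3)
      * (4 * of_nat n - 5 * of_nat k - 4) * (4 * of_nat n - 5 * of_nat k - 5) * eta_base n (Suc k)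
    = (of_nat n + 2 - 5 * of_nat k) * (of_nat n + 1 - 5 * of_nat k) * (of_nat n - 5 * of_nat k)
      * (of_nat n - 1 - 5 * of_nat k) * (of_nat n - 2 - 5 * of_nat k) * eta_base n k"
proof -
  define I where "I = ifact (int n + 2 - 5 * int k)"
  have *: "int n - 5 * int k = int n + 2 - 5 * int k - 1 - 1" "int (n + 1) - 5 * int k = int n + 2 - 5 * int k - 1"
    "int (n + 2) - 5 * int k = int n + 2 - 5 * int k"
    "int n + 2 - 5 * int (Suc k) = int n + 2 - 5 * int k - 1 - 1 - 1 - 1 - 1" by simp_all
  have I: "ifact (int n - 5 * int k) = (of_nat n + 1 - 5 * of_nat k) * (of_nat n + 2 - 5 * of_nat k) * I"
    "ifact (int (n + 1) - 5 * int k) = (of_nat n + 2 - 5 * of_nat k) * I"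
    "ifact (int (n + 2) - 5 * int k) = I"
    "ifact (int n + 2 - 5 * int (Suc k)) = (of_nat n + 2 - 5 * of_nat k) * (of_nat n + 1 - 5 * of_nat k)
      * (of_nat n - 5 * of_nat k) * (of_nat n - 1 - 5 * of_nat k) * (of_nat n - 2 - 5 * of_nat k) * I"
    unfolding * I_def by (simp_all only: ifact_rec, simp_all add: algebra_simps)
  define j where "j = 4 * n - 5 * k - 1"
  have r: "4 * of_nat n = (of_nat j + 1 + 5 * of_nat k :: rat)"
    and idx: "4 * (n + 1) - 5 * k - 1 = Suc (Suc (Suc (Suc j)))"
      "4 * (n + 2) - 5 * k - 1 = Suc (Suc (Suc (Suc (Suc (Suc (Suc (Suc j)))))))"
    if "5 * k \<le> n + 2"
  proof -
    have "4 * n > 5 * k" using that assms by presburger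
    then have e: "4 * n = Suc (j + 5 * k)" by (simp add: j_def)
    then show "4 * of_nat n = (of_nat j + 1 + 5 * of_nat k :: rat)"
      by (metis add.commute add.left_commute of_nat_Suc of_nat_add of_nat_mult of_nat_numeral)
    show "4 * (n + 1) - 5 * k - 1 = Suc (Suc (Suc (Suc j)))"
      "4 * (n + 2) - 5 * k - 1 = Suc (Suc (Suc (Suc (Suc (Suc (Suc (Suc j)))))))" using e by simp_all
  qed
  have zero: "(of_nat n + 1 - 5 * of_nat k :: rat) = 0" if "5 * k = n + 1"
    using that by (metis diff_self of_nat_1 of_nat_add of_nat_mult of_nat_numeral)
  have zero': "(of_nat n + 2 - 5 * of_nat k :: rat) = 0" if "5 * k = n + 2"
    using that by (metis diff_self of_nat_add of_nat_mult of_nat_numeral)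
  consider "5 * k \<le> n" | "5 * k = n + 1" | "5 * k = n + 2" | "5 * k > n + 2" by linarith
  note cs = this
  show "of_int (eta_factor n k) = 5 * (of_nat n - 2 * of_nat k)
      * ((3 * of_nat n + 1) * (3 * of_nat n + 2) * (3 * of_nat n + 3) * (3 * of_nat n + 4) * (3 * of_nat n + 5) * (3 * of_nat n + 6))
      * ((of_nat n + 2 - 5 * of_nat k) * (of_nat n + 1 - 5 * of_nat k)) * eta_base n k"
  proof -
    have e: "of_int (eta_factor n k) = (if 5 * k \<le> n then 5 * (of_nat n - 2 * of_nat k) * fact j
        * ((of_nat n + 1 - 5 * of_nat k) * (of_nat n + 2 - 5 * of_nat k) * I) else 0) * ifact (3 * int n)"
      using eta_factor_closed[of n k] assms unfolding I(1) j_def by simp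
    show ?thesis unfolding e ifact_triple_shift[of n] eta_base_def j_def[symmetric] I_def[symmetric]
      using cs zero zero' by cases simp_all
  qed
  show "of_int (eta_factor (n + 1) k) = 5 * (of_nat n + 1 - 2 * of_nat k)
      * ((3 * of_nat n + 4) * (3 * of_nat n + 5) * (3 * of_nat n + 6))
      * ((4 * of_nat n - 5 * of_nat k) * (4 * of_nat n - 5 * of_nat k + 1) * (4 * of_nat n - 5 * of_nat k + 2) * (4 * of_nat n - 5 * of_nat k + 3))
      * (of_nat n + 2 - 5 * of_nat k) * eta_base n k"
  proof (cases "5 * k \<le> n + 1")
    case True
    then have le: "5 * k \<le> n + 2" by simp
    have e: "of_int (eta_factor (n + 1) k) = 5 * (of_nat n + 1 - 2 * of_nat k) * fact (4 * (n + 1) - 5 * k - 1)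
        * ((of_nat n + 2 - 5 * of_nat k) * I) * ifact (3 * int (n + 1))"
      using eta_factor_closed[of "n + 1" k] True unfolding I(2) by simp
    have f: "fact (Suc (Suc (Suc (Suc j)))) = (of_nat j + 4) * (of_nat j + 3) * (of_nat j + 2) * (of_nat j + 1) * (fact j :: rat)"
      by (simp add: add_ac mult_ac)
    show ?thesis unfolding e ifact_triple_shift[of n] eta_base_def j_def[symmetric] I_def[symmetric] idx(1)[OF le] f r[OF le]
      unfolding if_P[OF le] by algebra
  next
    case False
    then show ?thesis using zero' eta_factor_closed[of "n + 1" k] by (cases "5 * k = n + 2") (simp_all add: eta_base_def)
  qed
  show "of_int (eta_factor (n + 2) k) = 5 * (of_nat n + 2 - 2 * of_nat k)
      * ((4 * of_nat n - 5 * of_nat k) * (4 * of_nat n - 5 * of_nat k + 1) * (4 * of_nat n - 5 * of_nat k + 2) * (4 * of_nat n - 5 * of_nat k + 3)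
        * (4 * of_nat n - 5 * of_nat k + 4) * (4 * of_nat n - 5 * of_nat k + 5) * (4 * of_nat n - 5 * of_nat k + 6) * (4 * of_nat n - 5 * of_nat k + 7))
      * eta_base n k"
  proof (cases "5 * k \<le> n + 2")
    case True
    have e: "of_int (eta_factor (n + 2) k) = 5 * (of_nat n + 2 - 2 * of_nat k) * fact (4 * (n + 2) - 5 * k - 1)
        * I * ifact (3 * int (n + 2))"
      using eta_factor_closed[of "n + 2" k] True unfolding I(3) by simp
    have f: "fact (Suc (Suc (Suc (Suc (Suc (Suc (Suc (Suc j)))))))) = (of_nat j + 8) * (of_nat j + 7) * (of_nat j + 6) * (of_nat j + 5)
        * (of_nat j + 4) * (of_nat j + 3) * (of_nat j + 2) * (of_nat j + 1) * (fact j :: rat)"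
      by (simp add: add_ac mult_ac)
    show ?thesis unfolding e ifact_triple_shift[of n] eta_base_def j_def[symmetric] I_def[symmetric] idx(2)[OF True] f r[OF True]
      unfolding if_P[OF True] by algebra
  next
    case False
    then show ?thesis using eta_factor_closed[of "n + 2" k] by (simp add: eta_base_def)
  qed
  show "(4 * of_nat n - 5 * of_nat k - 1) * (4 * of_nat n - 5 * of_nat k - 2) * (4 * of_nat n - 5 * of_nat k - 3)
      * (4 * of_nat n - 5 * of_nat k - 4) * (4 * of_nat n - 5 * of_nat k - 5) * eta_base n (Suc k)
    = (of_nat n + 2 - 5 * of_nat k) * (of_nat n + 1 - 5 * of_nat k) * (of_nat n - 5 * of_nat k)
      * (of_nat n - 1 - 5 * of_nat k) * (of_nat n - 2 - 5 * of_nat k) * eta_base n k"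
  proof (cases "5 * Suc k \<le> n + 2")
    case True
    define i where "i = 4 * n - 5 * Suc k - 1"
    have "4 * n > 5 * Suc k" using True assms by presburger
    then have e: "4 * n = i + 5 * k + 6" by (simp add: i_def)
    then have r: "4 * of_nat n = (of_nat i + 5 * of_nat k + 6 :: rat)"
      by (metis of_nat_add of_nat_mult of_nat_numeral)
    have idx: "4 * n - 5 * k - 1 = Suc (Suc (Suc (Suc (Suc i))))" "4 * n - 5 * Suc k - 1 = i" using e by simp_all
    have f: "fact (Suc (Suc (Suc (Suc (Suc i))))) = (of_nat i + 5) * (of_nat i + 4) * (of_nat i + 3) * (of_nat i + 2) * (of_nat i + 1) * (fact i :: rat)"
      by (simp add: add_ac mult_ac)
    show ?thesis
      using True unfolding eta_base_def I(4) idx f r I_def[symmetric] by (simp add: add_ac)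
  next
    case False
    then show ?thesis
      using I(4) ifact_neg[of "int n + 2 - 5 * int (Suc k)"]
      by (auto simp: eta_base_def I_def)
  qed
qed

lemma nat_solution_sequence_eta: "nat_solution (Cubic 11 5 125 0) (\<lambda>n. of_int (sequence_eta n))"
proof -
  have init: "sequence_eta 0 = 1" "sequence_eta (Suc 0) = 5" "sequence_eta (Suc (Suc 0)) = 35"
    by code_simp+
  define t :: "nat \<Rightarrow> nat \<Rightarrow> rat" where "t m k = (- 1)^k * of_nat (m choose k)^3 * of_int (eta_factor m k)" for m k
  have sum: "of_int (sequence_eta m) = (\<Sum>k\<le>m. t m k)" if "0 < m" for m
    using that by (simp add: sequence_eta_def t_def)
  have "(of_nat n + 1) * (125 * (of_nat n + 1)^2 + 0) * (\<Sum>k\<le>n. t n k)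
     + - ((2 * of_nat n + 3) * (11 * (of_nat n + 1)^2 + 11 * (of_nat n + 1) + 5)) * (\<Sum>k\<le>n + 1. t (n + 1) k)
     + (of_nat n + 2)^3 * (\<Sum>k\<le>n + 2. t (n + 2) k) = 0" if "1 \<le> n" for n
  proof -
    define \<nu> :: rat where "\<nu> = of_nat n"
    define \<tau> :: "nat \<Rightarrow> rat" where "\<tau> k = (- 1)^k * fact n^3 * ifact (int k)^3 * ifact (int n + 2 - int k)^3 * eta_base n k" for k
    define qa where "qa \<kappa> = 5 * (\<nu> - 2 * \<kappa>) * ((\<nu> + 2 - \<kappa>) * (\<nu> + 1 - \<kappa>))^3 * ((3 * \<nu> + 1) * (3 * \<nu> + 2) * (3 * \<nu> + 3) * (3 * \<nu> + 4) * (3 * \<nu> + 5) * (3 * \<nu> + 6)) * ((\<nu> + 2 - 5 * \<kappa>) * (\<nu> + 1 - 5 * \<kappa>))" for \<kappa> :: rat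
    define qb where "qb \<kappa> = 5 * (\<nu> + 1 - 2 * \<kappa>) * ((\<nu> + 1) * (\<nu> + 2 - \<kappa>))^3 * ((3 * \<nu> + 4) * (3 * \<nu> + 5) * (3 * \<nu> + 6)) * ((4 * \<nu> - 5 * \<kappa>) * (4 * \<nu> - 5 * \<kappa> + 1) * (4 * \<nu> - 5 * \<kappa> + 2) * (4 * \<nu> - 5 * \<kappa> + 3)) * (\<nu> + 2 - 5 * \<kappa>)" for \<kappa> :: rat
    define qc where "qc \<kappa> = 5 * (\<nu> + 2 - 2 * \<kappa>) * ((\<nu> + 1) * (\<nu> + 2))^3 * ((4 * \<nu> - 5 * \<kappa>) * (4 * \<nu> - 5 * \<kappa> + 1) * (4 * \<nu> - 5 * \<kappa> + 2) * (4 * \<nu> - 5 * \<kappa> + 3) * (4 * \<nu> - 5 * \<kappa> + 4) * (4 * \<nu> - 5 * \<kappa> + 5) * (4 * \<nu> - 5 * \<kappa> + 6) * (4 * \<nu> - 5 * \<kappa> + 7))" for \<kappa> :: rat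
    define N where "N \<kappa> = - ((\<nu> + 2 - \<kappa>)^3 * ((\<nu> + 2 - 5 * \<kappa>) * (\<nu> + 1 - 5 * \<kappa>) * (\<nu> - 5 * \<kappa>) * (\<nu> - 1 - 5 * \<kappa>) * (\<nu> - 2 - 5 * \<kappa>)))" for \<kappa> :: rat
    define D where "D \<kappa> = \<kappa>^3 * ((4 * \<nu> - 5 * \<kappa> + 4) * (4 * \<nu> - 5 * \<kappa> + 3) * (4 * \<nu> - 5 * \<kappa> + 2) * (4 * \<nu> - 5 * \<kappa> + 1) * (4 * \<nu> - 5 * \<kappa>))" for \<kappa> :: rat
    define x where "x \<kappa> = 5 * (\<nu> + 1) * (\<nu> + 1) * (\<nu> + 1) * (\<nu> + 2) * ((- 92640 - 345712*\<nu> - 531600*\<nu>^2 - 431408*\<nu>^3 - 195002*\<nu>^4 - 46581*\<nu>^5 - 4597*\<nu>^6) + (194600 + 608488*\<nu> + 754186*\<nu>^2 + 463144*\<nu>^3 + 140936*\<nu>^4 + 17006*\<nu>^5)*\<kappa> + (- 152660 - 387080*\<nu> - 365075*\<nu>^2 - 151770*\<nu>^3 - 23460*\<nu>^4)*\<kappa>^2 + (53200 + 103950*\<nu> + 67050*\<nu>^2 + 14300*\<nu>^3)*\<kappa>^3 + (- 7000 - 9625*\<nu> - 3250*\<nu>^2)*\<kappa>^4)" for \<kappa> :: rat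
    show ?thesis unfolding \<nu>_def[symmetric]
    proof (rule creative_telescoping[where t = t and n = n and \<tau> = \<tau> and qa = qa and qb = qb and qc = qc
          and D = D and N = N and x = x])
      show "t n k = qa (of_nat k) * \<tau> k" for k
        unfolding t_def \<tau>_def qa_def \<nu>_def unfolding eta_base_shift[OF that] binomial_ifact_shift[of n k] by algebra
      show "t (n + 1) k = qb (of_nat k) * \<tau> k" for k
        unfolding t_def \<tau>_def qb_def \<nu>_def unfolding eta_base_shift[OF that] binomial_ifact_shift[of n k] by algebra
      show "t (n + 2) k = qc (of_nat k) * \<tau> k" for k
        unfolding t_def \<tau>_def qc_def \<nu>_def unfolding eta_base_shift[OF that] binomial_ifact_shift[of n k] by algebra
      show "D (of_nat k + 1) * \<tau> (Suc k) = N (of_nat k) * \<tau> k" for k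
        proof -
        define s :: rat where "s = (- 1)^k"
        show ?thesis
          unfolding \<tau>_def \<nu>_def D_def N_def power_Suc index_shift(2) index_shift(1)[of k] s_def[symmetric]
          using eta_base_shift(4)[OF that, of k] by algebra
      qed
      show "(\<nu> + 1) * (125 * (\<nu> + 1)^2 + 0) * qa \<kappa> + - ((2 * \<nu> + 3) * (11 * (\<nu> + 1)^2 + 11 * (\<nu> + 1) + 5)) * qb \<kappa> + (\<nu> + 2)^3 * qc \<kappa>
        = x (\<kappa> + 1) * N \<kappa> - x \<kappa> * D \<kappa>" for \<kappa>
        unfolding qa_def qb_def qc_def x_def D_def N_def by algebra
    qed (simp_all add: t_def \<tau>_def D_def)
  qed
  then have rec: "(of_nat n + 1) * (125 * (of_nat n + 1)^2 + 0) * of_int (sequence_eta n) + - ((2 * of_nat n + 3) * (11 * (of_nat n + 1)^2 + 11 * (of_nat n + 1) + 5)) * of_int (sequence_eta (n + 1)) + (of_nat n + 2)^3 * of_int (sequence_eta (n + 2)) = (0 :: rat)" if "1 \<le> n" for n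
    using that sum[of n] sum[of "n + 1"] sum[of "n + 2"] by simp
  have "(of_nat n + 1) * (125 * (of_nat n + 1)^2 + 0) * of_int (sequence_eta n) + - ((2 * of_nat n + 3) * (11 * (of_nat n + 1)^2 + 11 * (of_nat n + 1) + 5)) * of_int (sequence_eta (n + 1)) + (of_nat n + 2)^3 * of_int (sequence_eta (n + 2)) = (0 :: rat)" for n
  proof (cases "1 \<le> n")
    case False
    then have "n = 0" by linarith
    then show ?thesis
      by (auto simp: init numeral_2_eq_2 numeral_3_eq_3)
  qed (rule rec)
  then show ?thesis by (simp add: init)
qed

section \<open>Sums beyond a single hypergeometric term: the sequences \<zeta> and F\<close>

definition sequence_zeta :: "nat \<Rightarrow> int" where
  "sequence_zeta n = (\<Sum>k\<le>n. \<Sum>l\<le>n. int ((n choose k)^2 * (n choose l) * (k choose l) * (k + l choose n)))"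

text \<open>A double sum takes two certificates: the recurrence operator applied to the summand is a
  difference of \<open>G\<close> in \<open>k\<close> plus a difference of \<open>H\<close> in
  \<open>l\<close>, and each part telescopes in its own index.\<close>

lemma nat_solution_sequence_zeta: "nat_solution (Cubic 9 3 (- 27) 0) (\<lambda>n. of_int (sequence_zeta n))"
proof -
  have init: "sequence_zeta 0 = 1" "sequence_zeta (Suc 0) = 3" "sequence_zeta (Suc (Suc 0)) = 27"
    by code_simp+
  define t :: "nat \<Rightarrow> nat \<Rightarrow> nat \<Rightarrow> rat" where
    "t m k l = of_nat (m choose k)^2 * of_nat (m choose l) * of_nat (k choose l) * of_nat (k + l choose m)" for m k l
  have closed: "t m k l = fact m^2 * fact (k + l) * ifact (int k) * ifact (int l)^2 * ifact (int m - int k)^2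
    * ifact (int m - int l) * ifact (int k - int l) * ifact (int (k + l) - int m)" for m k l
  proof -
    have "t m k l = fact m^2 * fact (k + l) * ifact (int k) * ifact (int l)^2 * ifact (int m - int k)^2
      * ifact (int m - int l) * ifact (int k - int l) * ifact (int (k + l) - int m)
      * (fact m * ifact (int m)) * (fact k * ifact (int k))"
      unfolding t_def of_nat_binomial_ifact by (simp add: power2_eq_square mult_ac)
    then show ?thesis unfolding ifact_fact by simp
  qed
  have "(of_nat n + 1) * (- 27 * (of_nat n + 1)^2 + 0) * of_int (sequence_zeta n)
    + - ((2 * of_nat n + 3) * (9 * (of_nat n + 1)^2 + 9 * (of_nat n + 1) + 3)) * of_int (sequence_zeta (n + 1))
    + (of_nat n + 2)^3 * of_int (sequence_zeta (n + 2)) = (0 :: rat)" if n: "0 < n" for n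
  proof -
    define \<nu> :: rat where "\<nu> = of_nat n"
    define c0 where "c0 = (\<nu> + 1) * (- 27 * (\<nu> + 1)^2 + 0)"
    define c1 where "c1 = - ((2 * \<nu> + 3) * (9 * (\<nu> + 1)^2 + 9 * (\<nu> + 1) + 3))"
    define c2 where "c2 = (\<nu> + 2)^3"
    define \<tau> where "\<tau> k l = fact n^2 * fact (k + l) * ifact (int k) * ifact (int l)^2 * ifact (int n + 2 - int k)^2
      * ifact (int n + 2 - int l) * ifact (int k - int l) * ifact (int k + int l - int n)" for k l
    define x where "x \<kappa> \<mu> = (\<nu> + 1)^2 * ((- 80 - 264*\<nu> - 340*\<nu>^2 - 214*\<nu>^3 - 66*\<nu>^4 - 8*\<nu>^5) + (- 24 + 56*\<nu> + 138*\<nu>^2 + 84*\<nu>^3 + 16*\<nu>^4)*\<mu> + (- 40 - 72*\<nu> - 42*\<nu>^2 - 8*\<nu>^3)*\<mu>^2 + (48 + 248*\<nu> + 324*\<nu>^2 + 162*\<nu>^3 + 28*\<nu>^4)*\<kappa> + (- 110 - 279*\<nu> - 216*\<nu>^2 - 52*\<nu>^3)*\<kappa>*\<mu> + (- 22 - 93*\<nu> - 87*\<nu>^2 - 23*\<nu>^3)*\<kappa>^2 + (51 + 87*\<nu> + 36*\<nu>^2)*\<kappa>^2*\<mu> + (9 + 9*\<nu>)*\<kappa>^2*\<mu>^2)" for \<kappa> \<mu> :: rat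
    define y where "y \<kappa> \<mu> = (\<nu> + 1)^2 * ((160 + 528*\<nu> + 680*\<nu>^2 + 428*\<nu>^3 + 132*\<nu>^4 + 16*\<nu>^5) + (- 180 - 472*\<nu> - 465*\<nu>^2 - 201*\<nu>^3 - 32*\<nu>^4)*\<mu> + (- 40 - 72*\<nu> - 42*\<nu>^2 - 8*\<nu>^3)*\<mu>^2 + (- 324 - 856*\<nu> - 837*\<nu>^2 - 357*\<nu>^3 - 56*\<nu>^4)*\<kappa> + (280 + 618*\<nu> + 441*\<nu>^2 + 101*\<nu>^3)*\<kappa>*\<mu> + (224 + 462*\<nu> + 309*\<nu>^2 + 67*\<nu>^3)*\<kappa>^2 + (- 156 - 255*\<nu> - 99*\<nu>^2)*\<kappa>^2*\<mu> + (9 + 9*\<nu>)*\<kappa>^2*\<mu>^2 + (- 54 - 81*\<nu> - 27*\<nu>^2)*\<kappa>^3 + (27 + 27*\<nu>)*\<kappa>^3*\<mu>)" for \<kappa> \<mu> :: rat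
    \<comment> \<open>The certificates have the denominator \<open>k + l\<close>, which the factor
      \<open>(k + l)!\<close> of \<open>\<tau>\<close> absorbs after a shift of \<open>k\<close> or
      \<open>l\<close>. At \<open>k + l = 0\<close> the quotient is 0 by convention; this is
      consistent because \<open>\<tau> 0 0\<close> contains \<open>ifact (- n)\<close> and
      \<open>n > 0\<close>.\<close>
    define G where "G k l = x (of_nat k) (of_nat l) * of_nat k * (of_nat k - of_nat l) * (of_nat k + of_nat l - \<nu>)
      * (\<tau> k l / of_nat (k + l))" for k l
    define H where "H k l = y (of_nat k) (of_nat l) * of_nat l^2 * (of_nat k + of_nat l - \<nu>)
      * (\<tau> k l / of_nat (k + l))" for k l
    have sum: "of_int (sequence_zeta m) = (\<Sum>k<n + 3. \<Sum>l<n + 3. t m k l)" if "m \<le> n + 2" for m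
    proof -
      have "of_int (sequence_zeta m) = (\<Sum>k\<le>m. \<Sum>l\<le>m. t m k l)"
        by (simp add: sequence_zeta_def t_def)
      also have "\<dots> = (\<Sum>k\<le>m. \<Sum>l<n + 3. t m k l)"
        using that by (intro sum.cong refl sum.mono_neutral_left) (auto simp: t_def)
      also have "\<dots> = (\<Sum>k<n + 3. \<Sum>l<n + 3. t m k l)"
      proof (rule sum.mono_neutral_left)
        show "\<forall>k\<in>{..<n + 3} - {..m}. (\<Sum>l<n + 3. t m k l) = 0"
        proof
          fix k assume "k \<in> {..<n + 3} - {..m}"
          then have "m choose k = 0" by simp
          then show "(\<Sum>l<n + 3. t m k l) = 0" by (simp add: t_def binomial_eq_0)
        qed
      qed (use that in auto)
      finally show ?thesis .
    qed
    have "c0 * t n k l + c1 * t (n + 1) k l + c2 * t (n + 2) k l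
      = (G (Suc k) l - G k l) + (H k (Suc l) - H k l)" for k l
    proof -
      define \<kappa> :: rat where "\<kappa> = of_nat k"
      define \<mu> :: rat where "\<mu> = of_nat l"
      have idx: "int (n + 1) - int j = int n + 1 - int j" "int (n + 2) - int j = int n + 2 - int j"
        "int (k + l) - int n = int k + int l - int n"
        "int (k + l) - int (n + 1) = int k + int l - int n - 1"
        "int (k + l) - int (n + 2) = int k + int l - int n - 1 - 1" for j
        by simp_all
      have f: "fact (n + 1) = (\<nu> + 1) * fact n" "fact (n + 2) = (\<nu> + 2) * (\<nu> + 1) * fact n"
        by (simp_all add: \<nu>_def algebra_simps)
      have t: "t n k l = ((\<nu> + 2 - \<kappa>) * (\<nu> + 1 - \<kappa>))^2 * (\<nu> + 2 - \<mu>) * (\<nu> + 1 - \<mu>) * \<tau> k l"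
        "t (n + 1) k l = (\<nu> + 1)^2 * (\<nu> + 2 - \<kappa>)^2 * (\<nu> + 2 - \<mu>) * (\<kappa> + \<mu> - \<nu>) * \<tau> k l"
        "t (n + 2) k l = ((\<nu> + 1) * (\<nu> + 2))^2 * (\<kappa> + \<mu> - \<nu>) * (\<kappa> + \<mu> - \<nu> - 1) * \<tau> k l"
        unfolding closed idx ifact_diff f ifact_rec \<tau>_def of_int_diff of_int_add of_int_of_nat_eq of_int_1
          \<nu>_def[symmetric] \<kappa>_def[symmetric] \<mu>_def[symmetric] by algebra+
      have G: "G (Suc k) l = x (\<kappa> + 1) \<mu> * (\<nu> + 2 - \<kappa>)^2 * \<tau> k l"
      proof -
        have "\<tau> (Suc k) l / of_nat (Suc k + l) = fact n^2 * fact (k + l) * ifact (int (Suc k)) * ifact (int l)^2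
          * ((\<nu> + 2 - \<kappa>) * ifact (int n + 2 - int k))^2
          * ifact (int n + 2 - int l) * ifact (int (Suc k) - int l) * ifact (int (Suc k) + int l - int n)"
          unfolding \<tau>_def index_shift(2) \<nu>_def \<kappa>_def by (simp del: of_nat_Suc of_nat_add)
        moreover have "ifact (int k - int l) = (\<kappa> + 1 - \<mu>) * ifact (int (Suc k) - int l)"
          using ifact_rec[of "int (Suc k) - int l"] by (simp add: \<kappa>_def \<mu>_def algebra_simps)
        moreover have "ifact (int k + int l - int n) = (\<kappa> + 1 + \<mu> - \<nu>) * ifact (int (Suc k) + int l - int n)"
          using ifact_rec[of "int (Suc k) + int l - int n"] by (simp add: \<kappa>_def \<mu>_def \<nu>_def algebra_simps)
        moreover have "of_nat (Suc k) = \<kappa> + 1" by (simp add: \<kappa>_def)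
        ultimately show ?thesis
          unfolding G_def \<tau>_def index_shift(1)[of k] \<kappa>_def[symmetric] \<mu>_def[symmetric] by (simp only: power_mult_distrib mult_ac add_ac)
      qed
      have H: "H k (Suc l) = y \<kappa> (\<mu> + 1) * (\<nu> + 2 - \<mu>) * (\<kappa> - \<mu>) * \<tau> k l"
      proof -
        have "int k - int (Suc l) = int k - int l - 1" by simp
        then have "\<tau> k (Suc l) / of_nat (k + Suc l) = fact n^2 * fact (k + l) * ifact (int k) * ifact (int (Suc l))^2
          * ifact (int n + 2 - int k)^2 * ((\<nu> + 2 - \<mu>) * ifact (int n + 2 - int l))
          * ((\<kappa> - \<mu>) * ifact (int k - int l)) * ifact (int k + int (Suc l) - int n)"
          unfolding \<tau>_def index_shift(2) \<nu>_def \<kappa>_def \<mu>_def by (simp only: ifact_rec) (simp del: of_nat_Suc of_nat_add)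
        moreover have "ifact (int k + int l - int n) = (\<kappa> + \<mu> + 1 - \<nu>) * ifact (int k + int (Suc l) - int n)"
          using ifact_rec[of "int k + int (Suc l) - int n"] by (simp add: \<kappa>_def \<mu>_def \<nu>_def algebra_simps)
        moreover have "of_nat (Suc l) = \<mu> + 1" by (simp add: \<mu>_def)
        ultimately show ?thesis
          unfolding H_def \<tau>_def index_shift(1)[of l] \<kappa>_def[symmetric] \<mu>_def[symmetric]
          by (simp only: power_mult_distrib power2_eq_square mult_ac add_ac)
      qed
      show ?thesis
      proof (cases "k + l = 0")
        case True
        then have "\<tau> k l = 0" using n by (simp add: \<tau>_def)
        then show ?thesis using True unfolding t G H by (simp add: G_def H_def)
      next
        case False
        define \<rho> where "\<rho> = \<tau> k l / of_nat (k + l)"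
        have \<rho>: "\<tau> k l = (\<kappa> + \<mu>) * \<rho>" using False by (simp add: \<rho>_def \<kappa>_def \<mu>_def flip: of_nat_add)
        have "G k l = x \<kappa> \<mu> * \<kappa> * (\<kappa> - \<mu>) * (\<kappa> + \<mu> - \<nu>) * \<rho>" "H k l = y \<kappa> \<mu> * \<mu>^2 * (\<kappa> + \<mu> - \<nu>) * \<rho>"
          by (simp_all add: G_def H_def \<rho>_def \<kappa>_def \<mu>_def)
        then show ?thesis unfolding t G H \<rho> c0_def c1_def c2_def x_def y_def by algebra
      qed
    qed
    then have "c0 * of_int (sequence_zeta n) + c1 * of_int (sequence_zeta (n + 1)) + c2 * of_int (sequence_zeta (n + 2))
      = (\<Sum>k<n + 3. \<Sum>l<n + 3. (G (Suc k) l - G k l) + (H k (Suc l) - H k l))"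
      by (simp only: sum le_add1 order_refl add_le_mono one_le_numeral sum_distrib_left sum.distrib[symmetric])
    also have "\<dots> = (\<Sum>l<n + 3. \<Sum>k<n + 3. G (Suc k) l - G k l) + (\<Sum>k<n + 3. \<Sum>l<n + 3. H k (Suc l) - H k l)"
      unfolding sum.distrib by (rule arg_cong2[of _ _ _ _ "(+)"]) (rule sum.swap, rule refl)
    also have "\<dots> = (\<Sum>l<n + 3. G (n + 3) l - G 0 l) + (\<Sum>k<n + 3. H k (n + 3) - H k 0)"
      by (simp only: sum_lessThan_telescope[where f = "\<lambda>k. G k l" for l] sum_lessThan_telescope[where f = "H k" for k])
    \<comment> \<open>The lower ends vanish through the factors \<open>k\<close> and
      \<open>l^2\<close>, the upper ends through \<open>ifact (- 1)\<close> in
      \<open>\<tau>\<close>.\<close>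
    also have "\<dots> = 0" by (simp add: G_def H_def \<tau>_def)
    finally show ?thesis by (simp only: c0_def c1_def c2_def \<nu>_def)
  qed
  then have rec: "(of_nat n + 1) * (- 27 * (of_nat n + 1)^2 + 0) * of_int (sequence_zeta n)
    + - ((2 * of_nat n + 3) * (9 * (of_nat n + 1)^2 + 9 * (of_nat n + 1) + 3)) * of_int (sequence_zeta (n + 1))
    + (of_nat n + 2)^3 * of_int (sequence_zeta (n + 2)) = (0 :: rat)" for n
    by (cases "n = 0") (simp_all add: init numeral_2_eq_2)
  then show ?thesis by (simp add: init)
qed

definition zagier_F_of :: "(nat \<Rightarrow> int) \<Rightarrow> nat \<Rightarrow> int" where
  "zagier_F_of f n = (\<Sum>k\<le>n. (- 1)^k * 8^(n - k) * int (n choose k) * f k)"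

text \<open>The inner sequence is not hypergeometric, so the certificate has two components:
  \<open>G\<close> combines \<open>u k\<close> and \<open>u (k - 1)\<close>, and the recurrence of
  \<open>u\<close> eliminates \<open>u (k + 1)\<close> from the difference of
  \<open>G\<close>.\<close>

lemma nat_solution_zagier_F_of:
  assumes f: "nat_solution (Quadratic 7 2 (- 8)) (\<lambda>n. of_int (f n))"
  shows "nat_solution (Quadratic 17 6 72) (\<lambda>n. of_int (zagier_F_of f n))"
proof -
  define u :: "nat \<Rightarrow> rat" where "u k = of_int (f k)" for k
  have u0: "u 0 = 1" "u 1 = 2" using f by (simp_all add: u_def)
  \<comment> \<open>At \<open>k = 0\<close> the truncated index \<open>k - 1\<close> is multiplied
    by \<open>k^2 = 0\<close>; the same happens in \<open>G\<close>.\<close>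
  have u: "(of_nat k + 1)^2 * u (Suc k) = (7 * of_nat k^2 + 7 * of_nat k + 2) * u k + 8 * of_nat k^2 * u (k - 1)" for k
  proof (cases k)
    case 0
    then show ?thesis using u0 by simp
  next
    case (Suc j)
    have "- 8 * (of_nat j + 1)^2 * u j + - (7 * (of_nat j + 1)^2 + 7 * (of_nat j + 1) + 2) * u (j + 1)
      + (of_nat j + 2)^2 * u (j + 2) = 0"
      using f by (simp add: u_def)
    then show ?thesis unfolding Suc by (simp add: algebra_simps power2_eq_square)
  qed
  define t :: "nat \<Rightarrow> nat \<Rightarrow> rat" where "t m k = (- 1 / 8)^k * 8^m * of_nat (m choose k) * u k" for m k
  have sum: "of_int (zagier_F_of f m) = (\<Sum>k<n + 3. t m k)" if "m \<le> n + 2" for m n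
  proof -
    have "of_int (zagier_F_of f m) = (\<Sum>k\<le>m. t m k)"
      unfolding zagier_F_of_def of_int_sum
    proof (rule sum.cong)
      fix k assume k: "k \<in> {..m}"
      then have "(8 :: rat)^m = 8^k * 8^(m - k)" by (simp flip: power_add)
      moreover have "(- 1 / 8 :: rat)^k * 8^k = (- 1)^k" by (simp flip: power_mult_distrib)
      ultimately show "of_int ((- 1)^k * 8^(m - k) * int (m choose k) * f k) = t m k"
        by (simp add: t_def u_def)
    qed simp
    also have "\<dots> = (\<Sum>k<n + 3. t m k)"
      using that by (intro sum.mono_neutral_left) (auto simp: t_def)
    finally show ?thesis .
  qed
  have "72 * (of_nat n + 1)^2 * of_int (zagier_F_of f n)
    + - (17 * (of_nat n + 1)^2 + 17 * (of_nat n + 1) + 6) * of_int (zagier_F_of f (n + 1))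
    + (of_nat n + 2)^2 * of_int (zagier_F_of f (n + 2)) = (0 :: rat)" for n
  proof -
    define \<nu> :: rat where "\<nu> = of_nat n"
    define \<tau> :: "nat \<Rightarrow> rat" where
      "\<tau> k = (- 1 / 8)^k * 8^n * fact n * ifact (int k) * ifact (int n + 2 - int k)" for k
    define G where "G k = 64 * (\<nu> + 1) * of_nat k^2 * \<tau> k * ((\<nu> + 2 - of_nat k) * u (k - 1) - of_nat k * u k)" for k
    have "72 * (\<nu> + 1)^2 * t n k + - (17 * (\<nu> + 1)^2 + 17 * (\<nu> + 1) + 6) * t (n + 1) k
      + (\<nu> + 2)^2 * t (n + 2) k = G (Suc k) - G k" for k
    proof -
      define \<kappa> :: rat where "\<kappa> = of_nat k"
      define s where "s = (- 1 / 8 :: rat)^k"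
      have "t n k = (\<nu> + 1 - \<kappa>) * (\<nu> + 2 - \<kappa>) * \<tau> k * u k"
        "t (n + 1) k = 8 * (\<nu> + 1) * (\<nu> + 2 - \<kappa>) * \<tau> k * u k"
        "t (n + 2) k = 64 * (\<nu> + 1) * (\<nu> + 2) * \<tau> k * u k"
        unfolding t_def \<tau>_def \<nu>_def \<kappa>_def binomial_ifact_shift[of n k] by (simp_all add: power_add)
      moreover have "(\<kappa> + 1) * \<tau> (Suc k) = - 1 / 8 * (\<nu> + 2 - \<kappa>) * \<tau> k"
        unfolding \<tau>_def \<nu>_def \<kappa>_def power_Suc index_shift(2) index_shift(1)[of k] by (simp add: mult_ac)
      moreover have "G (Suc k) = 64 * (\<nu> + 1) * (\<kappa> + 1) * ((\<kappa> + 1) * \<tau> (Suc k)) * ((\<nu> + 1 - \<kappa>) * u k - (\<kappa> + 1) * u (Suc k))"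
        by (simp add: G_def \<kappa>_def power2_eq_square algebra_simps)
      moreover have "(\<kappa> + 1)^2 * u (Suc k) = (7 * \<kappa>^2 + 7 * \<kappa> + 2) * u k + 8 * \<kappa>^2 * u (k - 1)"
        using u[of k] by (simp add: \<kappa>_def)
      moreover have "G k = 64 * (\<nu> + 1) * \<kappa>^2 * \<tau> k * ((\<nu> + 2 - \<kappa>) * u (k - 1) - \<kappa> * u k)"
        by (simp add: G_def \<kappa>_def)
      ultimately show ?thesis by algebra
    qed
    then have "72 * (\<nu> + 1)^2 * of_int (zagier_F_of f n)
      + - (17 * (\<nu> + 1)^2 + 17 * (\<nu> + 1) + 6) * of_int (zagier_F_of f (n + 1))
      + (\<nu> + 2)^2 * of_int (zagier_F_of f (n + 2)) = (\<Sum>k<n + 3. G (Suc k) - G k)"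
      using sum[of n n] sum[of "n + 1" n] sum[of "n + 2" n] by (simp only: le_add1 order_refl add_le_mono one_le_numeral sum_distrib_left sum.distrib[symmetric])
    also have "\<dots> = G (n + 3) - G 0" by (rule sum_lessThan_telescope)
    also have "\<dots> = 0" by (simp add: G_def \<tau>_def)
    finally show ?thesis by (simp only: \<nu>_def)
  qed
  moreover have "zagier_F_of f 0 = 1" "zagier_F_of f 1 = 6"
    using u0 by (simp_all add: zagier_F_of_def u_def)
  ultimately show ?thesis by simp
qed

section \<open>Congruences in the localization at an odd prime\<close>

text \<open>Any fraction with denominator prime to \<open>p\<close> will do, since the reduced
  denominator divides every other one. Closure under the ring operations can then be shown without
  reducing fractions.\<close>

lemma localization_iff:
  assumes "prime p"
  shows "x \<in> localization p \<longleftrightarrow> (\<exists>a b. \<not> int p dvd b \<and> x = of_int a / of_int b)"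
proof
  assume x: "x \<in> localization p"
  obtain a b where ab: "quotient_of x = (a, b)" by fastforce
  then have "x = of_int a / of_int b" by (rule quotient_of_div)
  then show "\<exists>a b. \<not> int p dvd b \<and> x = of_int a / of_int b"
    using x ab by (auto simp: localization_def)
next
  assume "\<exists>a b. \<not> int p dvd b \<and> x = of_int a / of_int b"
  then obtain a b where b: "\<not> int p dvd b" and x: "x = of_int a / of_int b" by blast
  obtain c d where cd: "quotient_of x = (c, d)" by fastforce
  have x': "x = of_int c / of_int d" and "d > 0" and cop: "coprime c d"
    using cd by (auto simp: quotient_of_div quotient_of_denom_pos quotient_of_coprime)
  have "b \<noteq> 0" using b by auto
  then have "of_int (c * b) = (of_int (a * d) :: rat)"
    using x x' \<open>d > 0\<close> by (simp add: field_simps)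
  then have "c * b = a * d" by (simp only: of_int_eq_iff)
  then have "d dvd b" using cop by (metis coprime_commute coprime_dvd_mult_right_iff dvd_triv_right)
  then show "x \<in> localization p" using b cd by (auto simp: localization_def dest: dvd_trans)
qed

locale odd_prime =
  fixes p :: nat
  assumes prime: "prime p" and ge3: "p \<ge> 3"
begin

lemma p_pos: "p > 0" and p_nonzero: "of_nat p \<noteq> (0 :: rat)"
  using ge3 by auto

lemma prime_int: "prime (int p)" using prime by simp

lemma odd_p: "odd p" using prime ge3 by (metis prime_odd_nat less_le_trans numeral_3_eq_3 lessI numeral_2_eq_2)

lemma localization_of_int [simp, intro]: "of_int a \<in> localization p"
proof -
  have "\<not> int p dvd 1" using prime_int not_prime_unit by blast
  then show ?thesis unfolding localization_iff[OF prime] by (intro exI[of _ a] exI[of _ 1]) simp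
qed

lemma localization_of_nat [simp, intro]: "of_nat a \<in> localization p"
  using localization_of_int[of "int a"] by simp

lemma localization_0 [simp, intro]: "0 \<in> localization p" and localization_1 [simp, intro]: "1 \<in> localization p"
  using localization_of_int[of 0] localization_of_int[of 1] by simp_all

lemma localization_numeral [simp, intro]: "numeral m \<in> localization p"
  using localization_of_int[of "numeral m"] by simp

lemma localization_mult [intro]:
  assumes "x \<in> localization p" "y \<in> localization p"
  shows "x * y \<in> localization p"
proof -
  obtain a b c d where "\<not> int p dvd b" "x = of_int a / of_int b" "\<not> int p dvd d" "y = of_int c / of_int d"
    using assms unfolding localization_iff[OF prime] by blast
  then show ?thesis unfolding localization_iff[OF prime]
    by (intro exI[of _ "a * c"] exI[of _ "b * d"]) (simp add: prime_dvd_mult_iff[OF prime_int])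
qed

lemma localization_add [intro]:
  assumes "x \<in> localization p" "y \<in> localization p"
  shows "x + y \<in> localization p"
proof -
  obtain a b c d where *: "\<not> int p dvd b" "x = of_int a / of_int b" "\<not> int p dvd d" "y = of_int c / of_int d"
    using assms unfolding localization_iff[OF prime] by blast
  moreover have "b \<noteq> 0" "d \<noteq> 0" using * by auto
  ultimately show ?thesis unfolding localization_iff[OF prime]
    by (intro exI[of _ "a * d + c * b"] exI[of _ "b * d"]) (simp add: prime_dvd_mult_iff[OF prime_int] field_simps)
qed

lemma localization_uminus [intro]: "x \<in> localization p \<Longrightarrow> - x \<in> localization p"
  using localization_mult[OF localization_of_int[of "- 1"], of x] by simp

lemma localization_diff [intro]: "x \<in> localization p \<Longrightarrow> y \<in> localization p \<Longrightarrow> x - y \<in> localization p"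
  using localization_add[of x "- y"] by (simp add: localization_uminus)

lemma localization_power [intro]: "x \<in> localization p \<Longrightarrow> x ^ n \<in> localization p"
  by (induction n) auto

lemma localization_sum [intro]: "(\<And>i. i \<in> I \<Longrightarrow> f i \<in> localization p) \<Longrightarrow> sum f I \<in> localization p"
  by (induction I rule: infinite_finite_induct) auto

lemma localization_prod [intro]: "(\<And>i. i \<in> I \<Longrightarrow> f i \<in> localization p) \<Longrightarrow> prod f I \<in> localization p"
  by (induction I rule: infinite_finite_induct) auto

lemma localization_inverse [intro]: "\<not> int p dvd b \<Longrightarrow> inverse (of_int b) \<in> localization p"
  unfolding localization_iff[OF prime] by (intro exI[of _ 1] exI[of _ b]) (simp add: inverse_eq_divide)

lemma localization_divide:
  "x \<in> localization p \<Longrightarrow> \<not> int p dvd b \<Longrightarrow> x / of_int b \<in> localization p"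
  unfolding divide_inverse by blast

lemma localization_divide_nat:
  "x \<in> localization p \<Longrightarrow> \<not> p dvd b \<Longrightarrow> x / of_nat b \<in> localization p"
  using localization_divide[of x "int b"] by simp

lemma not_dvd_small: "0 < k \<Longrightarrow> k < p \<Longrightarrow> \<not> p dvd k"
  using nat_dvd_not_less by blast

text \<open>Only the difference has to be \<open>p^e\<close> times a \<open>p\<close>-integral
  number; integrality of \<open>x\<close> and \<open>y\<close> is a separate premise where products
  call for it. The exponent is a parameter because congruences modulo \<open>p\<close> feed those
  modulo \<open>p^2\<close>.\<close>

definition pcong :: "nat \<Rightarrow> rat \<Rightarrow> rat \<Rightarrow> bool" where
  "pcong e x y \<longleftrightarrow> (\<exists>z\<in>localization p. x - y = of_nat p ^ e * z)"

lemma pcong_refl [simp, intro]: "pcong e x x"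
  unfolding pcong_def by (intro bexI[of _ 0]) auto

lemma pcong_sym: "pcong e x y \<Longrightarrow> pcong e y x"
  unfolding pcong_def
proof (elim bexE)
  fix z assume "z \<in> localization p" "x - y = of_nat p ^ e * z"
  then show "\<exists>z\<in>localization p. y - x = of_nat p ^ e * z"
    by (intro bexI[of _ "- z"]) (auto simp: algebra_simps)
qed

lemma pcong_add:
  assumes "pcong e x y" "pcong e x' y'"
  shows "pcong e (x + x') (y + y')"
proof -
  obtain z z' where "z \<in> localization p" "x - y = of_nat p ^ e * z" "z' \<in> localization p" "x' - y' = of_nat p ^ e * z'"
    using assms unfolding pcong_def by blast
  then show ?thesis unfolding pcong_def by (intro bexI[of _ "z + z'"]) (auto simp: algebra_simps)
qed

lemma pcong_trans [trans]: "pcong e x y \<Longrightarrow> pcong e y z \<Longrightarrow> pcong e x z"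
  using pcong_add[of e x y y z] unfolding pcong_def by simp

lemma pcong_trans_eq [trans]: "pcong e x y \<Longrightarrow> y = z \<Longrightarrow> pcong e x z" "x = y \<Longrightarrow> pcong e y z \<Longrightarrow> pcong e x z"
  by simp_all

lemma pcong_scale:
  assumes "c \<in> localization p" "pcong e x y"
  shows "pcong e (c * x) (c * y)"
proof -
  obtain z where "z \<in> localization p" "x - y = of_nat p ^ e * z" using assms unfolding pcong_def by blast
  then show ?thesis using assms(1) unfolding pcong_def by (intro bexI[of _ "c * z"]) (auto simp: algebra_simps)
qed

lemma pcong_uminus: "pcong e x y \<Longrightarrow> pcong e (- x) (- y)"
  using pcong_scale[OF localization_of_int[of "- 1"], of e x y] by simp

lemma pcong_diff: "pcong e x y \<Longrightarrow> pcong e x' y' \<Longrightarrow> pcong e (x - x') (y - y')"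
  using pcong_add[of e x y "- x'" "- y'"] pcong_uminus by simp

lemma pcong_mult:
  assumes "pcong e x y" "pcong e x' y'" "x \<in> localization p" "y' \<in> localization p"
  shows "pcong e (x * x') (y * y')"
proof -
  have "pcong e (x * x') (x * y')" using assms by (intro pcong_scale)
  also have "pcong e (x * y') (y * y')" using pcong_scale[of y' e x y] assms by (simp add: mult.commute)
  finally show ?thesis .
qed

lemma pcong_sum: "(\<And>i. i \<in> I \<Longrightarrow> pcong e (f i) (g i)) \<Longrightarrow> pcong e (sum f I) (sum g I)"
  by (induction I rule: infinite_finite_induct) (auto intro: pcong_add)

lemma pcong_localization: "pcong e x y \<Longrightarrow> y \<in> localization p \<Longrightarrow> x \<in> localization p"
proof -
  assume "pcong e x y" and y: "y \<in> localization p"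
  then obtain z where "z \<in> localization p" "x - y = of_nat p ^ e * z" unfolding pcong_def by blast
  then have "x = y + of_nat p ^ e * z" by simp
  then show ?thesis using y \<open>z \<in> localization p\<close> by auto
qed

lemma pcong_power: "pcong e x y \<Longrightarrow> y \<in> localization p \<Longrightarrow> pcong e (x ^ n) (y ^ n)"
  by (induction n) (auto intro!: pcong_mult dest: pcong_localization)

lemma pcong_mono: "pcong e x y \<Longrightarrow> d \<le> e \<Longrightarrow> pcong d x y"
proof -
  assume "pcong e x y" "d \<le> e"
  then obtain z where "z \<in> localization p" "x - y = of_nat p ^ e * z" unfolding pcong_def by blast
  then show ?thesis using \<open>d \<le> e\<close> unfolding pcong_def
    by (intro bexI[of _ "of_nat p ^ (e - d) * z"]) (auto simp flip: power_add mult.assoc)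
qed

lemma pcong_p_mult: "pcong e x y \<Longrightarrow> pcong (Suc e) (of_nat p * x) (of_nat p * y)"
  unfolding pcong_def by (auto simp flip: right_diff_distrib simp: mult.assoc)

lemma pcong_0I: "z \<in> localization p \<Longrightarrow> x = of_nat p ^ e * z \<Longrightarrow> pcong e x 0"
  unfolding pcong_def by auto

lemma pcong_0_mult:
  assumes "pcong d x 0" "pcong e y 0"
  shows "pcong (d + e) (x * y) 0"
proof -
  obtain z z' where "z \<in> localization p" "x = of_nat p ^ d * z" "z' \<in> localization p" "y = of_nat p ^ e * z'"
    using assms unfolding pcong_def by auto
  then show ?thesis by (intro pcong_0I[of "z * z'"]) (auto simp: power_add)
qed

lemma pcong_divide:
  assumes "pcong e x y" "\<not> int p dvd b"
  shows "pcong e (x / of_int b) (y / of_int b)"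
  using pcong_scale[OF localization_inverse[OF assms(2)] assms(1)] by (simp only: divide_inverse mult.commute)

lemma pcong_divide_nat: "pcong e x y \<Longrightarrow> \<not> p dvd b \<Longrightarrow> pcong e (x / of_nat b) (y / of_nat b)"
  using pcong_divide[of e x y "int b"] by simp

lemma pcong_cancel:
  assumes "pcong e (of_int b * x) (of_int b * y)" "\<not> int p dvd b"
  shows "pcong e x y"
proof -
  have "b \<noteq> 0" using assms by auto
  then show ?thesis using pcong_divide[OF assms] by simp
qed

text \<open>The power \<open>p^e\<close> is prime to the denominator of the
  \<open>p\<close>-integral quotient, so it divides the integer difference itself.\<close>

lemma pcong_of_int: "pcong e (of_int a) (of_int b) \<longleftrightarrow> [a = b] (mod int p ^ e)"
proof
  assume "pcong e (of_int a) (of_int b)"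
  then obtain z where z: "z \<in> localization p" "of_int a - of_int b = of_nat p ^ e * z" unfolding pcong_def by blast
  then obtain u v where uv: "\<not> int p dvd v" "z = of_int u / of_int v" unfolding localization_iff[OF prime] by blast
  then have "v \<noteq> 0" by auto
  then have "of_int ((a - b) * v) = (of_int (int p ^ e * u) :: rat)"
    using z uv by (simp add: field_simps)
  then have "(a - b) * v = int p ^ e * u" by (simp only: of_int_eq_iff)
  then have "int p ^ e dvd (a - b) * v" by simp
  moreover have "coprime (int p ^ e) v" using uv prime_int by (simp add: prime_imp_coprime)
  ultimately show "[a = b] (mod int p ^ e)"
    by (simp add: coprime_dvd_mult_left_iff cong_iff_dvd_diff)
next
  assume "[a = b] (mod int p ^ e)"
  then obtain c where "a - b = int p ^ e * c" by (auto simp: cong_iff_dvd_diff)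
  then have "of_int a - of_int b = (of_nat p ^ e * of_int c :: rat)"
    by (metis of_int_diff of_int_mult of_int_of_nat_eq of_int_power)
  then show "pcong e (of_int a) (of_int b)" unfolding pcong_def by blast
qed

lemma cong_localization_iff:
  "cong_localization p x y (p^e) \<longleftrightarrow> x \<in> localization p \<and> y \<in> localization p \<and> pcong e x y"
  by (simp add: cong_localization_def pcong_def)

end

section \<open>Reduction to the supercongruence\<close>

text \<open>Induction along Horner's form produces an integral second-order remainder directly,
  without halving a second derivative.\<close>

lemma poly_taylor1:
  fixes q :: "int poly"
  shows "\<exists>c. poly q (x + h) = poly q x + h * poly (pderiv q) x + h^2 * c"
proof (induction q)
  case (pCons a q)
  then obtain c where c: "poly q (x + h) = poly q x + h * poly (pderiv q) x + h^2 * c" by blast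
  have "poly (pCons a q) (x + h) = poly (pCons a q) x + h * poly (pderiv (pCons a q)) x
    + h^2 * (poly (pderiv q) x + x * c + h * c)"
    unfolding poly_pCons pderiv_pCons poly_add c by (simp add: algebra_simps power2_eq_square)
  then show ?case by blast
qed simp

context odd_prime
begin

lemma pcong_poly_shift:
  assumes "e \<le> 2"
  shows "pcong e (of_int (poly q (int k + int p * int n)))
    (of_int (poly q (int k)) + of_nat (p * n) * of_int (poly (pderiv q) (int k)))"
proof -
  obtain c where c: "poly q (int k + int p * int n)
      = poly q (int k) + int p * int n * poly (pderiv q) (int k) + (int p * int n)^2 * c"
    using poly_taylor1 by blast
  have "pcong 2 (of_int (poly q (int k + int p * int n)))
    (of_int (poly q (int k)) + of_nat (p * n) * of_int (poly (pderiv q) (int k)))"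
    unfolding pcong_def
  proof (rule bexI[of _ "of_int (int n^2 * c)"])
    show "of_int (int n^2 * c) \<in> localization p" by (rule localization_of_int)
  qed (simp add: c power_mult_distrib)
  then show ?thesis using assms by (rule pcong_mono)
qed

text \<open>The leading coefficient at \<open>k\<close> is \<open>k^2\<close> or \<open>k^3\<close>,
  a unit for \<open>0 < k < p\<close>, so solving for \<open>A' k\<close> introduces no denominator
  divisible by \<open>p\<close>.\<close>

lemma formal_derivative_localization:
  assumes A: "\<And>n. A (int n) = of_int (a n)" "\<And>j. j < 0 \<Longrightarrow> A j = 0" and A': "formal_derivative r A A'" and "k < p"
  shows "A' (int k) \<in> localization p"
  using \<open>k < p\<close>
proof (induction k rule: less_induct)
  case (less k)
  show ?case
  proof (cases "k = 0")
    case True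
    then show ?thesis using A' by (simp add: formal_derivative_def)
  next
    case False
    have locA: "A j \<in> localization p" for j
      using A by (cases j rule: int_cases) auto
    have locA': "A' (int k - int j) \<in> localization p" if "j > 0" for j
    proof (cases "j \<le> k")
      case True
      then show ?thesis using less.IH[of "k - j"] less.prems that False by (simp add: of_nat_diff)
    next
      case False
      then show ?thesis using A' by (simp add: formal_derivative_def)
    qed
    have "(\<Sum>j\<le>2. of_int (poly (rec_coeff r j) (int k)) * A' (int k - int j))
      + (\<Sum>j\<le>2. of_int (poly (pderiv (rec_coeff r j)) (int k)) * A (int k - int j)) = 0"
      using A' False by (simp add: formal_derivative_def)
    then have "of_int (poly (rec_coeff r 0) (int k)) * A' (int k)
      = - (of_int (poly (rec_coeff r 1) (int k)) * A' (int k - int 1) + of_int (poly (rec_coeff r 2) (int k)) * A' (int k - int 2)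
        + (\<Sum>j\<le>2. of_int (poly (pderiv (rec_coeff r j)) (int k)) * A (int k - int j)))"
      by (simp add: numeral_2_eq_2)
    also have "\<dots> \<in> localization p"
      using locA locA'[of 1] locA'[of 2] by (intro localization_uminus localization_add localization_mult localization_sum) auto
    finally have loc: "of_int (poly (rec_coeff r 0) (int k)) * A' (int k) \<in> localization p" .
    have "\<not> int p dvd int k" using False less.prems by (simp add: not_dvd_small)
    then have unit: "\<not> int p dvd poly (rec_coeff r 0) (int k)"
      by (cases r) (simp_all add: prime_dvd_power_iff[OF prime_int])
    have "of_int (poly (rec_coeff r 0) (int k)) * A' (int k) / of_int (poly (rec_coeff r 0) (int k)) \<in> localization p"
      by (rule localization_divide[OF loc unit])
    moreover have "poly (rec_coeff r 0) (int k) \<noteq> 0" using unit by auto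
    ultimately show ?thesis by (metis nonzero_mult_div_cancel_left of_int_eq_0_iff)
  qed
qed

text \<open>With \<open>h = p n\<close>, the predicted value \<open>Y k = A n (A k + h A' k)\<close>
  satisfies the recurrence with coefficients \<open>c + h c'\<close> up to \<open>h^2\<close>, and
  the leading coefficient is a unit. The induction starts from \<open>base\<close>;
  \<open>low\<close> covers \<open>k = 1\<close>, where the recurrence reaches back to
  \<open>p n - 1\<close>. The exponent \<open>e\<close> is left open because the case
  \<open>e = 1\<close> serves to verify \<open>low\<close> for \<open>e = 2\<close>.\<close>

lemma gessel_lucas_step:
  assumes A: "apery_seq r A" and int: "\<And>n. A (int n) = of_int (a n)" and A': "formal_derivative r A A'"
    and e: "e \<le> 2"
    and base: "pcong e (A (int (p * n))) (A (int n))"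
    and low: "pcong e (of_int (poly (rec_coeff r 2) (int (p * n) + 1)) * A (int (p * n) - 1)) 0"
    and k: "k < p"
  shows "pcong e (A (int (p * n) + int k)) (A (int n) * (A (int k) + of_nat (p * n) * A' (int k)))"
  using k
proof (induction k rule: less_induct)
  case (less k)
  have neg: "A j = 0" if "j < 0" for j using A that by (simp add: apery_seq_def)
  have locA: "A j \<in> localization p" for j
    using int neg by (cases j rule: int_cases) auto
  have neg': "A' j = 0" if "j \<le> 0" for j using A' that by (simp add: formal_derivative_def)
  have locA': "A' (int k - int j) \<in> localization p" for j
    using formal_derivative_localization[OF int neg A', of "k - j"] less.prems neg'[of "int k - int j"]
    by (cases "j \<le> k") (auto simp: of_nat_diff)
  define h where "h = (of_nat (p * n) :: rat)"
  have hp: "h \<in> localization p" unfolding h_def by (rule localization_of_nat)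
  define X where "X j = A (int (p * n) + j)" for j
  define Y where "Y j = A (int n) * (A j + h * A' j)" for j
  define c where "c j = (of_int (poly (rec_coeff r j) (int k)) :: rat)" for j
  define d where "d j = (of_int (poly (pderiv (rec_coeff r j)) (int k)) :: rat)" for j
  define C where "C j = (of_int (poly (rec_coeff r j) (int k + int p * int n)) :: rat)" for j
  have C: "pcong e (C j) (c j + h * d j)" for j
    unfolding C_def c_def d_def h_def by (rule pcong_poly_shift[OF e])
  have hh: "pcong e (h * h) 0"
  proof (rule pcong_mono[OF pcong_0I[OF localization_of_nat] e])
    show "h * h = of_nat p ^ 2 * of_nat (n * n)" by (simp add: h_def power2_eq_square)
  qed
  show ?case
  proof (cases "k = 0")
    case True
    then show ?thesis using base A neg' by (simp add: apery_seq_def)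
  next
    case False
    have recA: "c 0 * A (int k) + c 1 * A (int k - 1) + c 2 * A (int k - 2) = 0"
    proof -
      have "(\<Sum>j\<le>2. of_int (poly (rec_coeff r j) (int k)) * A (int k - int j)) = 0"
        using A False unfolding apery_seq_def satisfies_rec_iff by auto
      then show ?thesis by (simp add: numeral_2_eq_2 c_def)
    qed
    have recA': "c 0 * A' (int k) + c 1 * A' (int k - 1) + c 2 * A' (int k - 2)
      + (d 0 * A (int k) + d 1 * A (int k - 1) + d 2 * A (int k - 2)) = 0"
    proof -
      have "(\<Sum>j\<le>2. of_int (poly (rec_coeff r j) (int k)) * A' (int k - int j))
        + (\<Sum>j\<le>2. of_int (poly (pderiv (rec_coeff r j)) (int k)) * A (int k - int j)) = 0"
        using A' False by (simp add: formal_derivative_def)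
      then show ?thesis by (simp add: numeral_2_eq_2 c_def d_def)
    qed
    have recX: "C 0 * X (int k) + C 1 * X (int k - 1) + C 2 * X (int k - 2) = 0"
    proof -
      have "(\<Sum>j\<le>2. of_int (poly (rec_coeff r j) (int k + int p * int n)) * A (int k + int p * int n - int j)) = 0"
      proof -
        have "1 \<le> int k" using False by simp
        then have "1 \<le> int k + int p * int n" by (simp add: add_increasing2)
        then show ?thesis using A unfolding apery_seq_def satisfies_rec_iff by blast
      qed
      then show ?thesis by (simp add: numeral_2_eq_2 C_def X_def algebra_simps)
    qed
    have locY: "Y (int k - int j) \<in> localization p" for j
      unfolding Y_def by (intro localization_mult localization_add locA locA' hp)
    have locC: "C j \<in> localization p" for j unfolding C_def by simp
    have Xk1: "pcong e (C 1 * X (int k - 1)) ((c 1 + h * d 1) * Y (int k - 1))"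
    proof (rule pcong_mult[OF C _ locC])
      show "pcong e (X (int k - 1)) (Y (int k - 1))"
        using less.IH[of "k - 1"] less.prems False by (simp add: X_def Y_def h_def of_nat_diff)
      show "Y (int k - 1) \<in> localization p" using locY[of 1] by simp
    qed
    have Xk2: "pcong e (C 2 * X (int k - 2)) ((c 2 + h * d 2) * Y (int k - 2))"
    proof (cases "k = 1")
      case True
      \<comment> \<open>At the index \<open>- 1\<close> the prediction is 0, while
        \<open>A (p n - 1)\<close> need not be; \<open>low\<close> says that it vanishes once
        multiplied by its coefficient.\<close>
      have "Y (int k - 2) = 0" using neg neg' True by (simp add: Y_def)
      moreover have "pcong e (C 2 * X (int k - 2)) 0"
        using low True by (simp add: C_def X_def add.commute)
      ultimately show ?thesis by simp
    next
      case False
      with \<open>k \<noteq> 0\<close> have k2: "k \<ge> 2" by simp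
      show ?thesis
      proof (rule pcong_mult[OF C _ locC])
        show "pcong e (X (int k - 2)) (Y (int k - 2))"
          using less.IH[of "k - 2"] less.prems k2 by (simp add: X_def Y_def h_def of_nat_diff)
        show "Y (int k - 2) \<in> localization p" using locY[of 2] by simp
      qed
    qed
    have "pcong e (C 0 * X (int k)) (- ((c 1 + h * d 1) * Y (int k - 1) + (c 2 + h * d 2) * Y (int k - 2)))"
    proof -
      have "C 0 * X (int k) = - (C 1 * X (int k - 1) + C 2 * X (int k - 2))" using recX by (simp add: algebra_simps add_eq_0_iff)
      then show ?thesis by (simp only:) (rule pcong_uminus[OF pcong_add[OF Xk1 Xk2]])
    qed
    \<comment> \<open>Expanded in powers of \<open>h\<close>, the constant part is the recurrence of
      \<open>A\<close> and the linear part that of \<open>A'\<close>; what remains is the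
      \<open>h^2\<close> part.\<close>
    also have "- ((c 1 + h * d 1) * Y (int k - 1) + (c 2 + h * d 2) * Y (int k - 2))
      = (c 0 + h * d 0) * Y (int k) - h * h * (A (int n) * (d 0 * A' (int k) + d 1 * A' (int k - 1) + d 2 * A' (int k - 2)))"
      using recA recA' unfolding Y_def by algebra
    also have "pcong e \<dots> (C 0 * Y (int k) - 0 * (A (int n) * (d 0 * A' (int k) + d 1 * A' (int k - 1) + d 2 * A' (int k - 2))))"
    proof (rule pcong_diff)
      show "pcong e ((c 0 + h * d 0) * Y (int k)) (C 0 * Y (int k))"
        using locY[of 0] unfolding c_def d_def
        by (intro pcong_mult pcong_sym[OF C[of 0, unfolded c_def d_def]] pcong_refl
            localization_add localization_mult hp localization_of_int) simp
      show "pcong e (h * h * (A (int n) * (d 0 * A' (int k) + d 1 * A' (int k - 1) + d 2 * A' (int k - 2))))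
        (0 * (A (int n) * (d 0 * A' (int k) + d 1 * A' (int k - 1) + d 2 * A' (int k - 2))))"
        using locA'[of 0] locA'[of 1] locA'[of 2] unfolding d_def
        by (intro pcong_mult hh pcong_refl localization_mult localization_add hp locA localization_of_int) simp_all
    qed
    finally have "pcong e (C 0 * X (int k)) (C 0 * Y (int k))" by simp
    moreover have "\<not> int p dvd poly (rec_coeff r 0) (int k + int p * int n)"
    proof -
      have "\<not> int p dvd int k" using False less.prems by (simp add: not_dvd_small)
      then have "\<not> int p dvd int k + int p * int n" by (metis dvd_add_left_iff dvd_triv_left)
      then show ?thesis by (cases r) (simp_all add: prime_dvd_power_iff[OF prime_int])
    qed
    ultimately have "pcong e (X (int k)) (Y (int k))" unfolding C_def by (rule pcong_cancel)
    then show ?thesis by (simp add: X_def Y_def h_def)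
  qed
qed

end

text \<open>The coefficient of \<open>h\<close> in \<open>c_2(1 + h)\<close>, which is
  \<open>c h^2\<close> or \<open>h (c h^2 + d)\<close>: the obstruction to
  \<open>c_2(p n + 1)\<close> being divisible by \<open>p^2\<close>.\<close>

fun linear_term :: "apery_rec \<Rightarrow> int" where
  "linear_term (Quadratic a b c) = 0"
| "linear_term (Cubic a b c d) = d"

theorem (in odd_prime) gessel_lucas:
  assumes A: "apery_seq r A" and int: "\<And>n. A (int n) = of_int (a n)" and A': "formal_derivative r A A'"
    and super: "\<And>n. [a (p * n) = a n] (mod int p ^ 2)"
    and last: "linear_term r \<noteq> 0 \<Longrightarrow> int p dvd a (p - 1)"
    and k: "k < p"
  shows "cong_localization p (A (int (p * n + k)))
    (A (int k) * A (int n) + of_nat (p * n) * A' (int k) * A (int n)) (p^2)"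
proof -
  have neg: "A j = 0" if "j < 0" for j using A that by (simp add: apery_seq_def)
  have super': "pcong 2 (A (int (p * n))) (A (int n))" for n
    using super unfolding int pcong_of_int by simp
  have low_coeff: "\<exists>c. poly (rec_coeff r 2) (int (p * n) + 1) = int p ^ 2 * c + int p * int n * linear_term r" for n
    by (cases r) (auto simp: power2_eq_square power3_eq_cube algebra_simps intro!: exI)
  \<comment> \<open>Modulo \<open>p\<close> the coefficient alone makes the product vanish, so
    \<open>gessel_lucas_step\<close> is available with \<open>e = 1\<close> for all
    \<open>n\<close>.\<close>
  have low1: "pcong 1 (of_int (poly (rec_coeff r 2) (int (p * n) + 1)) * A (int (p * n) - 1)) 0" for n
  proof -
    obtain c where c: "poly (rec_coeff r 2) (int (p * n) + 1) = int p ^ 2 * c + int p * int n * linear_term r"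
      using low_coeff by blast
    have loc: "A j \<in> localization p" for j using int neg by (cases j rule: int_cases) auto
    have "int p ^ 2 * c + int p * int n * linear_term r = int p * (int p * c + int n * linear_term r)"
      by (simp add: power2_eq_square algebra_simps)
    then have "of_int (poly (rec_coeff r 2) (int (p * n) + 1)) * A (int (p * n) - 1)
      = of_nat p ^ 1 * (of_int (int p * c + int n * linear_term r) * A (int (p * n) - 1))"
      unfolding c by (simp only: of_int_mult of_int_of_nat_eq power_one_right mult.assoc)
    then show ?thesis using loc by (intro pcong_0I[OF localization_mult[OF localization_of_int]])
  qed
  have low: "pcong 2 (of_int (poly (rec_coeff r 2) (int (p * n) + 1)) * A (int (p * n) - 1)) 0"
  proof -
    obtain c where c: "poly (rec_coeff r 2) (int (p * n) + 1) = int p ^ 2 * c + int p * int n * linear_term r"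
      using low_coeff by blast
    consider "n = 0" | "n > 0" "linear_term r = 0" | "n > 0" "linear_term r \<noteq> 0" by auto
    then show ?thesis
    proof cases
      case 1
      then show ?thesis by (simp add: neg)
    next
      case 2
      have loc: "A j \<in> localization p" for j using int neg by (cases j rule: int_cases) auto
      have "of_int (poly (rec_coeff r 2) (int (p * n) + 1)) * A (int (p * n) - 1) = of_nat p ^ 2 * (of_int c * A (int (p * n) - 1))"
        unfolding c 2 by simp
      then show ?thesis using loc by (intro pcong_0I[OF localization_mult[OF localization_of_int]])
    next
      case 3
      \<comment> \<open>In base \<open>p\<close>, the number \<open>p n - 1\<close> has quotient
        \<open>n - 1\<close> and last digit \<open>p - 1\<close>. The step modulo \<open>p\<close>
        reduces \<open>A (p n - 1)\<close> to \<open>A (n - 1) A (p - 1)\<close>, which supplies a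
        factor \<open>p\<close> besides that of the coefficient.\<close>
      have idx: "int (p * n) - 1 = int (p * (n - 1)) + int (p - 1)"
        using 3 p_pos by (simp add: of_nat_diff algebra_simps)
      have "pcong 1 (A (int (p * (n - 1)) + int (p - 1)))
        (A (int (n - 1)) * (A (int (p - 1)) + of_nat (p * (n - 1)) * A' (int (p - 1))))"
        using pcong_mono[OF super'[of "n - 1"], of 1] low1[of "n - 1"] p_pos
        by (intro gessel_lucas_step[OF A int A']) auto
      also have "pcong 1 \<dots> 0"
      proof -
        obtain b where b: "a (p - 1) = int p * b" using last 3 by blast
        have "A' (int (p - 1)) \<in> localization p"
          using p_pos by (intro formal_derivative_localization[OF int neg A']) auto
        then have "of_int (a (n - 1)) * (of_int b + of_nat (n - 1) * A' (int (p - 1))) \<in> localization p"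
          by (intro localization_mult localization_add) auto
        moreover have "A (int (n - 1)) * (A (int (p - 1)) + of_nat (p * (n - 1)) * A' (int (p - 1)))
          = of_nat p ^ 1 * (of_int (a (n - 1)) * (of_int b + of_nat (n - 1) * A' (int (p - 1))))"
          unfolding int b of_nat_mult of_int_mult of_int_of_nat_eq power_one_right by algebra
        ultimately show ?thesis by (rule pcong_0I)
      qed
      finally have "pcong 1 (A (int (p * n) - 1)) 0" unfolding idx .
      moreover have "pcong 1 (of_int (poly (rec_coeff r 2) (int (p * n) + 1))) 0"
        unfolding c by (rule pcong_0I[of "of_int (int p * c + int n * linear_term r)"])
          (rule localization_of_int, simp add: power2_eq_square algebra_simps)
      ultimately show ?thesis using pcong_0_mult[of 1 _ 1] by (simp add: numeral_2_eq_2)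
    qed
  qed
  define y where "y = A (int k) * A (int n) + of_nat (p * n) * A' (int k) * A (int n)"
  have "A' (int k) \<in> localization p" by (rule formal_derivative_localization[OF int neg A' k])
  then have y: "y \<in> localization p"
    unfolding y_def int by (intro localization_mult localization_add localization_of_int localization_of_nat)
  have "pcong 2 (A (int (p * n) + int k)) (A (int n) * (A (int k) + of_nat (p * n) * A' (int k)))"
    using super' low k by (intro gessel_lucas_step[OF A int A']) auto
  then have "pcong 2 (A (int (p * n + k))) y"
    by (simp only: y_def of_nat_add distrib_left mult_ac)
  then show ?thesis
    unfolding cong_localization_iff y_def[symmetric] using y pcong_localization by blast
qed

section \<open>Binomial coefficients modulo the square of a prime\<close>

lemma alternating_binomial_partial_sum:
  "(\<Sum>i\<le>m. (-1)^i * int (Suc N choose i)) = (-1)^m * int (N choose m)"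
  by (induction m) (simp_all add: algebra_simps)

context odd_prime
begin

lemma not_dvd_multiple_add: "0 < i \<Longrightarrow> i < p \<Longrightarrow> \<not> p dvd p * j + i"
  by (metis dvd_add_right_iff dvd_triv_left not_dvd_small)

lemma dvd_binomial: "\<not> p dvd k \<Longrightarrow> p dvd (p * n choose k)"
proof -
  assume k: "\<not> p dvd k"
  then have "0 < k" by (auto intro: Nat.gr0I)
  then have "k * (p * n choose k) = p * n * (p * n - 1 choose (k - 1))"
    by (rule times_binomial_minus1_eq)
  then have "p dvd k * (p * n choose k)" by simp
  then show ?thesis using k prime by (simp add: prime_dvd_mult_iff)
qed

lemma cong_binomial_0: "\<not> p dvd k \<Longrightarrow> [int (p * n choose k) = 0] (mod int p)"
  using dvd_binomial[of k n] by (simp add: cong_0_iff)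

lemma cong_p2_0:
  assumes "[x = 0] (mod int p)" "[y = 0] (mod int p)"
  shows "[x * y = 0] (mod int p ^ 2)"
  using assms by (simp add: cong_0_iff power2_eq_square mult_dvd_mono)

lemma cong_mod_p: "[x = y] (mod int p ^ 2) \<Longrightarrow> [x = y] (mod int p)"
  by (rule cong_dvd_modulus[of _ _ "int p ^ 2"]) (simp_all add: power2_eq_square)

text \<open>Vandermonde with \<open>p (a + 1) = p + p a\<close>: for \<open>0 < j < p\<close> both
  factors of the summand are divisible by \<open>p\<close>, so modulo \<open>p^2\<close> only
  \<open>j = 0\<close> and \<open>j = p\<close> survive, and these reproduce Pascal's rule.\<close>

lemma babbage: "[int (p * a choose (p * b)) = int (a choose b)] (mod int p ^ 2)"
proof (induction a arbitrary: b)
  case 0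
  then show ?case using p_pos by (cases b) (auto simp: binomial_eq_0)
next
  case (Suc a)
  show ?case
  proof (cases b)
    case 0
    then show ?thesis by simp
  next
    case (Suc c)
    define f where "f j = int (p choose j) * int (p * a choose (p * b - j))" for j
    have "int (p * Suc a choose (p * b)) = (\<Sum>j\<le>p * b. f j)"
      using vandermonde[of p "p * a" "p * b"] by (simp add: f_def flip: of_nat_mult of_nat_sum)
    also have "\<dots> = (\<Sum>j\<in>{0, p}. f j) + (\<Sum>j\<in>{..p * b} - {0, p}. f j)"
      using Suc by (subst add.commute) (intro sum.subset_diff; auto)
    also have "[\<dots> = (\<Sum>j\<in>{0, p}. f j) + (\<Sum>j\<in>{..p * b} - {0, p}. 0)] (mod int p ^ 2)"
    proof (intro cong_add cong_refl cong_sum)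
      fix j assume j: "j \<in> {..p * b} - {0, p}"
      show "[f j = 0] (mod int p ^ 2)"
      proof (cases "j < p")
        case True
        then have nd: "\<not> p dvd j" using j by (auto intro: not_dvd_small)
        then have "\<not> p dvd p * b - j" using j by (metis DiffD1 atMost_iff dvd_diffD1 dvd_triv_left)
        then show ?thesis unfolding f_def
          using nd cong_binomial_0[of j 1] by (intro cong_p2_0 cong_binomial_0) auto
      next
        case False
        then show ?thesis using j by (simp add: f_def binomial_eq_0)
      qed
    qed
    also have "(\<Sum>j\<in>{0, p}. f j) + (\<Sum>j\<in>{..p * b} - {0, p}. 0) = int (p * a choose (p * b)) + int (p * a choose (p * c))"
      using p_pos Suc by (simp add: f_def)
    also have "[\<dots> = int (a choose b) + int (a choose c)] (mod int p ^ 2)"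
      by (intro cong_add Suc.IH)
    also have "int (a choose b) + int (a choose c) = int (Suc a choose b)" using Suc by simp
    finally show ?thesis .
  qed
qed

lemma babbage':
  "m = p * a \<Longrightarrow> k = p * b \<Longrightarrow> [int (m choose k) = int (a choose b)] (mod int p ^ 2)"
  by (simp only: babbage)

text \<open>Vandermonde for the upper index \<open>p a + b\<close>: modulo \<open>p\<close> only
  multiples of \<open>p\<close> count in the first factor, and \<open>b < p\<close> together with
  \<open>d < p\<close> singles out \<open>p c\<close> among them.\<close>

lemma lucas:
  assumes "b < p" "d < p"
  shows "[int (p * a + b choose (p * c + d)) = int (a choose c) * int (b choose d)] (mod int p)"
proof -
  define f where "f j = int (p * a choose j) * int (b choose (p * c + d - j))" for j
  have "int (p * a + b choose (p * c + d)) = (\<Sum>j\<le>p * c + d. f j)"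
    using vandermonde[of "p * a" b "p * c + d"] by (simp add: f_def flip: of_nat_mult of_nat_sum)
  also have "\<dots> = f (p * c) + (\<Sum>j\<in>{..p * c + d} - {p * c}. f j)"
    by (intro sum.remove) auto
  also have "[\<dots> = f (p * c) + (\<Sum>j\<in>{..p * c + d} - {p * c}. 0)] (mod int p)"
  proof (intro cong_add cong_refl cong_sum)
    fix j assume j: "j \<in> {..p * c + d} - {p * c}"
    show "[f j = 0] (mod int p)"
    proof (cases "p dvd j")
      case True
      then obtain i where i: "j = p * i" by blast
      have "i < c"
      proof (rule ccontr)
        assume "\<not> i < c"
        then have "i \<ge> Suc c" using j i by (metis DiffE Suc_leI insertI1 linorder_neqE_nat)
        then have "p * i \<ge> p * Suc c" by (rule mult_le_mono2)
        then show False using j i assms by auto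
      qed
      then have "p * Suc i \<le> p * c" by (intro mult_le_mono2) simp
      then have "b < p * c + d - j" using assms i by simp
      then show ?thesis by (simp add: f_def binomial_eq_0)
    next
      case False
      then show ?thesis unfolding f_def
        using cong_mult[OF cong_binomial_0[OF False, of a] cong_refl[of "int (b choose (p * c + d - j))"]] by simp
    qed
  qed
  also have "f (p * c) + (\<Sum>j\<in>{..p * c + d} - {p * c}. 0) = int (p * a choose (p * c)) * int (b choose d)"
    by (simp add: f_def)
  also have "[\<dots> = int (a choose c) * int (b choose d)] (mod int p)"
    by (intro cong_mult cong_refl cong_mod_p babbage)
  finally show ?thesis .
qed

lemma lucas':
  "m = p * a + b \<Longrightarrow> k = p * c + d \<Longrightarrow> b < p \<Longrightarrow> d < p \<Longrightarrow>
    [int (m choose k) = int (a choose c) * int (b choose d)] (mod int p)"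
  by (simp only: lucas)

lemma lucas_0:
  assumes "m = p * a + b" "k = p * c + d" "b < d" "d < p"
  shows "[int (m choose k) = 0] (mod int p)"
  using lucas'[OF assms(1,2)] assms(3,4) by (simp add: binomial_eq_0)

lemma binomial_pred_prime: "i < p \<Longrightarrow> [int (p - 1 choose i) = (-1)^i] (mod int p)"
proof (induction i)
  case (Suc i)
  have "\<not> p dvd Suc i" using Suc.prems by (intro not_dvd_small) auto
  then have "[int (p choose Suc i) = 0] (mod int p)" using cong_binomial_0[of "Suc i" 1] by simp
  moreover have "int (p choose Suc i) = int (p - 1 choose i) + int (p - 1 choose Suc i)"
    using p_pos by (cases p) auto
  ultimately have "[int (p - 1 choose i) + int (p - 1 choose Suc i) - int (p - 1 choose i) = 0 - (-1)^i] (mod int p)"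
    using Suc by (intro cong_diff) auto
  then show ?case by simp
qed simp

lemma pcong_p_mult2: "pcong 1 x y \<Longrightarrow> pcong 2 (of_nat p * x) (of_nat p * y)"
  using pcong_p_mult[of 1] by (simp add: numeral_2_eq_2)

lemma pcong_of_nat_int: "[int a = b] (mod int p ^ e) \<Longrightarrow> pcong e (of_nat a) (of_int b)"
  using pcong_of_int[of e "int a" b] by simp

text \<open>Put \<open>k = p j + i\<close> in
  \<open>k (p n choose k) = p n (p n - 1 choose k - 1)\<close>. The digits of \<open>p n - 1\<close>
  are \<open>n - 1\<close> and \<open>p - 1\<close>, so Lucas evaluates the right-hand coefficient
  modulo \<open>p\<close>, and the outer factor \<open>p\<close> lifts the result to
  \<open>p^2\<close>.\<close>

lemma binomial_near_multiple:
  assumes "0 < i" "i < p" "0 < n"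
  shows "pcong 2 (of_nat (p * n choose (p * j + i)))
    (of_nat p * (of_nat n * of_nat (n - 1 choose j) * (- 1)^(i - 1) / of_nat i))"
proof -
  have nd: "\<not> p dvd p * j + i" using assms by (intro not_dvd_multiple_add)
  obtain c where c: "p * n choose (p * j + i) = p * c" using dvd_binomial[OF nd] by blast
  have i: "\<not> p dvd i" using assms by (simp add: not_dvd_small)
  have "p * n - 1 = p * (n - 1) + (p - 1)" "p * j + i - 1 = p * j + (i - 1)"
    using assms p_pos by (simp_all add: algebra_simps diff_mult_distrib2)
  then have "[int (p * n - 1 choose (p * j + i - 1)) = int (n - 1 choose j) * int (p - 1 choose (i - 1))] (mod int p)"
    using assms by (intro lucas') auto
  also have "[int (n - 1 choose j) * int (p - 1 choose (i - 1)) = int (n - 1 choose j) * (-1)^(i - 1)] (mod int p)"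
    using assms by (intro cong_mult cong_refl binomial_pred_prime) auto
  finally have 1: "pcong 1 (of_nat (p * n - 1 choose (p * j + i - 1))) (of_nat (n - 1 choose j) * (- 1)^(i - 1))"
    using pcong_of_int[of 1 "int (p * n - 1 choose (p * j + i - 1))" "int (n - 1 choose j) * (-1)^(i - 1)"] by simp
  have "(p * j + i) * (p * n choose (p * j + i)) = p * n * (p * n - 1 choose (p * j + i - 1))"
    using assms by (intro times_binomial_minus1_eq) simp
  \<comment> \<open>The binomial coefficient is \<open>p c\<close>, so replacing its multiplier
    \<open>p j + i\<close> by \<open>i\<close> costs only the multiple
    \<open>p^2 j c\<close>.\<close>
  then have eq: "of_nat i * (of_nat (p * c) :: rat)
      = of_nat p * (of_nat n * of_nat (p * n - 1 choose (p * j + i - 1))) - of_nat p ^ 2 * (of_nat j * of_nat c)"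
    unfolding c of_nat_eq_iff[where 'a = rat, symmetric] of_nat_add of_nat_mult by algebra
  have "pcong 2 (of_nat p ^ 2 * (of_nat j * of_nat c)) 0"
    by (rule pcong_0I[OF _ refl]) (intro localization_mult localization_of_nat)
  moreover have "pcong (Suc 1) (of_nat p * (of_nat n * of_nat (p * n - 1 choose (p * j + i - 1))))
    (of_nat p * (of_nat n * (of_nat (n - 1 choose j) * (- 1)^(i - 1))))"
    using 1 by (intro pcong_p_mult pcong_scale) auto
  ultimately have "pcong 2 (of_nat i * of_nat (p * c)) (of_nat p * (of_nat n * (of_nat (n - 1 choose j) * (- 1)^(i - 1))) - 0)"
    unfolding eq by (intro pcong_diff) (simp_all add: numeral_2_eq_2)
  from pcong_divide_nat[OF this i] show ?thesis
    using assms unfolding c by (simp add: mult_ac)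
qed

lemma sum_upto_multiple:
  fixes f :: "nat \<Rightarrow> 'a :: comm_monoid_add"
  shows "(\<Sum>k\<le>p * n. f k) = (\<Sum>k\<le>n. f (p * k)) + (\<Sum>j<n. \<Sum>i\<in>{1..<p}. f (p * j + i))"
proof (induction n)
  case (Suc n)
  have "{..p * Suc n} = {..p * n} \<union> (\<lambda>i. p * n + i) ` {1..<Suc p}"
  proof (intro equalityI subsetI)
    fix x assume x: "x \<in> {..p * Suc n}"
    show "x \<in> {..p * n} \<union> (\<lambda>i. p * n + i) ` {1..<Suc p}"
    proof (cases "x \<le> p * n")
      case False
      then show ?thesis using x by (intro UnI2 image_eqI[of _ _ "x - p * n"]) auto
    qed simp
  qed auto
  then have "(\<Sum>k\<le>p * Suc n. f k) = (\<Sum>k\<le>p * n. f k) + sum f ((\<lambda>i. p * n + i) ` {1..<Suc p})"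
    by (simp only:) (rule sum.union_disjoint, auto)
  also have "sum f ((\<lambda>i. p * n + i) ` {1..<Suc p}) = (\<Sum>i\<in>{1..<Suc p}. f (p * n + i))"
    by (subst sum.reindex) (auto simp: inj_on_def)
  also have "(\<Sum>i\<in>{1..<Suc p}. f (p * n + i)) = (\<Sum>i\<in>{1..<p}. f (p * n + i)) + f (p * Suc n)"
    using p_pos by (simp add: add.commute)
  finally show ?case by (simp only: Suc.IH sum.lessThan_Suc sum.atMost_Suc add_ac)
qed simp

lemma sum_inverse_reflect: "(\<Sum>i\<in>{1..<p}. f (p - i)) = (\<Sum>i\<in>{1..<p}. f i)"
  by (rule sum.reindex_bij_witness[of _ "\<lambda>i. p - i" "\<lambda>i. p - i"]) auto

text \<open>Pairing \<open>i\<close> with \<open>p - i\<close> gives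
  \<open>1/i + 1/(p - i) = p / (i (p - i))\<close>; this counts the sum twice, and 2 is a
  unit.\<close>

lemma harmonic_cong_0: "pcong 1 (\<Sum>i\<in>{1..<p}. 1 / of_nat i) 0"
proof -
  have loc: "1 / of_nat i \<in> localization p" if "i \<in> {1..<p}" for i
    using that by (intro localization_divide_nat) (auto simp: not_dvd_small)
  have "of_int 2 * (\<Sum>i\<in>{1..<p}. 1 / of_nat i :: rat) = (\<Sum>i\<in>{1..<p}. 1 / of_nat (p - i)) + (\<Sum>i\<in>{1..<p}. 1 / of_nat i)"
    unfolding sum_inverse_reflect[of "\<lambda>i. 1 / of_nat i"] by simp
  also have "\<dots> = of_nat p ^ 1 * (\<Sum>i\<in>{1..<p}. 1 / of_nat (p - i) * (1 / of_nat i))"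
    unfolding sum.distrib[symmetric] sum_distrib_left
    by (rule sum.cong) (auto simp: field_simps of_nat_diff)
  finally have eq: "of_int 2 * (\<Sum>i\<in>{1..<p}. 1 / of_nat i) = of_nat p ^ 1 * (\<Sum>i\<in>{1..<p}. 1 / of_nat (p - i) * (1 / of_nat i :: rat))" .
  have "(\<Sum>i\<in>{1..<p}. 1 / of_nat (p - i) * (1 / of_nat i)) \<in> localization p"
    by (intro localization_sum localization_mult loc) auto
  from pcong_0I[OF this eq] have "pcong 1 (of_int 2 * (\<Sum>i\<in>{1..<p}. 1 / of_nat i)) (of_int 2 * 0)"
    by simp
  moreover have "\<not> int p dvd 2" using ge3 zdvd_not_zless[of 2 "int p"] by simp
  ultimately show ?thesis by (rule pcong_cancel)
qed

lemma minus_one_power_p [simp]: "(- 1 :: 'a :: ring_1) ^ (p * k) = (- 1) ^ k"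
  using odd_p by (simp add: power_mult)

text \<open>The upper index is no multiple of \<open>p\<close>, but the coefficient is an
  alternating partial sum of the row with upper index \<open>p a\<close>. The terms at multiples of
  \<open>p\<close> give the right side through \<open>babbage\<close>, and each block in between is
  a multiple of \<open>p\<close> times a harmonic sum.\<close>

lemma babbage_pred:
  assumes "0 < a"
  shows "[int (p * a - 1 choose (p * b)) = int (a - 1 choose b)] (mod int p ^ 2)"
proof -
  obtain N where N: "p * a = Suc N" using assms p_pos by (cases "p * a") auto
  obtain M where M: "a = Suc M" using assms by (cases a) auto
  define f where "f i = (- 1 :: rat)^i * of_nat (p * a choose i)" for i
  have loc: "1 / of_nat i \<in> localization p" if "i \<in> {1..<p}" for i
    using that by (intro localization_divide_nat) (auto simp: not_dvd_small)
  have "(- 1)^(p * b) * of_nat (N choose (p * b)) = (\<Sum>i\<le>p * b. f i)"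
    using arg_cong[OF alternating_binomial_partial_sum[of N "p * b"], of "of_int :: int \<Rightarrow> rat"] unfolding f_def N
    by (simp only: of_int_sum of_int_mult of_int_power of_int_minus of_int_1 of_int_of_nat_eq)
  also have "\<dots> = (\<Sum>k\<le>b. f (p * k)) + (\<Sum>j<b. \<Sum>i\<in>{1..<p}. f (p * j + i))"
    by (rule sum_upto_multiple)
  also have "pcong 2 \<dots> ((\<Sum>k\<le>b. (- 1)^k * of_nat (a choose k)) + (\<Sum>j<b. 0))"
  proof (intro pcong_add pcong_sum)
    fix k
    show "pcong 2 (f (p * k)) ((- 1)^k * of_nat (a choose k))"
      using pcong_of_int[of 2 "(-1)^k * int (p * a choose (p * k))" "(-1)^k * int (a choose k)"] babbage[of a k]
      by (simp add: f_def cong_scalar_left)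
  next
    fix j
    have "pcong 2 (\<Sum>i\<in>{1..<p}. f (p * j + i))
      (\<Sum>i\<in>{1..<p}. of_nat p * ((- 1)^(j + 1) * of_nat a * of_nat (a - 1 choose j) * (1 / of_nat i)))"
    proof (rule pcong_sum)
      fix i assume i: "i \<in> {1..<p}"
      have "pcong 2 (f (p * j + i)) ((- 1)^(p * j + i) *
        (of_nat p * (of_nat a * of_nat (a - 1 choose j) * (- 1)^(i - 1) / of_nat i)))"
        unfolding f_def using i assms by (intro pcong_scale binomial_near_multiple) (auto intro!: localization_power)
      \<comment> \<open>The signs \<open>(- 1)^i\<close> and \<open>(- 1)^(i - 1)\<close> combine to
        a constant, so the block becomes a plain harmonic sum and not an alternating one.\<close>
      also have "(- 1 :: rat)^(p * j + i) * (of_nat p * (of_nat a * of_nat (a - 1 choose j) * (- 1)^(i - 1) / of_nat i))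
        = of_nat p * ((- 1)^(j + 1) * of_nat a * of_nat (a - 1 choose j) * (1 / of_nat i))"
        using i by (cases i) (auto simp: power_add)
      finally show "pcong 2 (f (p * j + i)) (of_nat p * ((- 1)^(j + 1) * of_nat a * of_nat (a - 1 choose j) * (1 / of_nat i)))" .
    qed
    also have "(\<Sum>i\<in>{1..<p}. of_nat p * ((- 1)^(j + 1) * of_nat a * of_nat (a - 1 choose j) * (1 / of_nat i)))
      = of_nat p * ((- 1)^(j + 1) * of_nat a * of_nat (a - 1 choose j) * (\<Sum>i\<in>{1..<p}. 1 / of_nat i))"
      by (simp only: sum_distrib_left)
    also have "pcong 2 \<dots> (of_nat p * ((- 1)^(j + 1) * of_nat a * of_nat (a - 1 choose j) * 0))"
      by (intro pcong_p_mult2 pcong_scale harmonic_cong_0) (auto intro!: localization_mult localization_power)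
    finally show "pcong 2 (\<Sum>i\<in>{1..<p}. f (p * j + i)) 0" by simp
  qed
  also have "(\<Sum>k\<le>b. (- 1)^k * of_nat (a choose k)) + (\<Sum>j<b. 0) = (- 1 :: rat)^b * of_nat (M choose b)"
    using arg_cong[OF alternating_binomial_partial_sum[of M b], of "of_int :: int \<Rightarrow> rat"] unfolding M by simp
  finally have "pcong 2 ((- 1)^b * of_nat (N choose (p * b))) ((- 1)^b * of_nat (M choose b))" by simp
  then have "pcong 2 (of_int ((- 1)^b) * ((- 1)^b * of_nat (N choose (p * b)))) (of_int ((- 1)^b) * ((- 1)^b * of_nat (M choose b)))"
    by (rule pcong_scale[OF localization_of_int])
  moreover have "of_int ((- 1)^b) * ((- 1)^b * x) = x" for x :: rat by (cases "even b") simp_all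
  ultimately have "pcong 2 (of_int (int (N choose (p * b)))) (of_int (int (M choose b)))"
    by (simp only: of_int_of_nat_eq)
  then show ?thesis unfolding pcong_of_int using N M by simp
qed

text \<open>If the last digit \<open>r\<close> of \<open>k\<close> exceeds \<open>p / 2\<close>,
  then the last digit of \<open>2 k\<close> is \<open>2 r - p < r\<close>, and Lucas gives
  0.\<close>

lemma cong_central_binomial_0:
  assumes "p < 2 * (k mod p)"
  shows "[int (2 * k choose k) = 0] (mod int p)"
proof (rule lucas_0)
  define q r where "q = k div p" and "r = k mod p"
  have k: "k = p * q + r" by (simp add: q_def r_def)
  show "k = p * (k div p) + k mod p" by (rule mult_div_mod_eq[symmetric])
  have "2 * k = p * (2 * q + 1) + (2 * r - p)"
    using assms k unfolding r_def[symmetric] by (simp add: algebra_simps)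
  then show "2 * k = p * (2 * (k div p) + 1) + (2 * (k mod p) - p)" by (simp only: q_def r_def)
  show "2 * (k mod p) - p < k mod p" "k mod p < p" using p_pos assms by (auto simp: less_diff_conv2 mod_less_divisor)
qed

text \<open>The last digits of \<open>k\<close> and \<open>p n - k\<close> add up to
  \<open>p\<close>, which is odd, so one of them exceeds \<open>p / 2\<close>.\<close>

lemma cong_central_binomial_mult_0:
  assumes "\<not> p dvd k" "k \<le> p * n"
  shows "[int (2 * k choose k) * int (2 * (p * n - k) choose (p * n - k)) = 0] (mod int p)"
proof (cases "p < 2 * (k mod p)")
  case True
  then show ?thesis using cong_mult[OF cong_central_binomial_0[OF True] cong_refl] by simp
next
  case False
  have k: "k = p * (k div p) + k mod p" by simp
  have "k mod p \<noteq> 0" using assms by (simp add: dvd_eq_mod_eq_0)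
  moreover have lt: "k mod p < p" using p_pos by simp
  moreover have "2 * (k mod p) \<noteq> p" using odd_p by (metis dvd_triv_left)
  ultimately have less: "p < 2 * (p - k mod p)" "p - k mod p < p" using False by linarith+
  have "k div p < n"
  proof (rule ccontr)
    assume "\<not> k div p < n"
    then have "p * n \<le> p * (k div p)" by simp
    then show False using k \<open>k mod p \<noteq> 0\<close> assms by linarith
  qed
  then obtain d where "n = Suc (k div p + d)" using less_imp_Suc_add by blast
  then have "p * n = p * (n - k div p - 1) + p * (k div p) + p"
    by (simp add: add_mult_distrib2)
  then have "p * n - k = p * (n - k div p - 1) + (p - k mod p)" using k lt by linarith
  moreover have "(p * d + c) mod p = c" if "c < p" for c d using that by simp
  ultimately have "(p * n - k) mod p = p - k mod p" using less by metis
  then have "p < 2 * ((p * n - k) mod p)" using less by simp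
  then show ?thesis using cong_mult[OF cong_refl cong_central_binomial_0] by simp
qed

lemma super_sum:
  fixes f g :: "nat \<Rightarrow> int"
  assumes "\<And>k. k \<le> n \<Longrightarrow> [f (p * k) = g k] (mod int p ^ 2)"
    and "\<And>k. \<not> p dvd k \<Longrightarrow> k \<le> p * n \<Longrightarrow> [f k = 0] (mod int p ^ 2)"
  shows "[(\<Sum>k\<le>p * n. f k) = (\<Sum>k\<le>n. g k)] (mod int p ^ 2)"
proof -
  have "(\<Sum>k\<le>p * n. f k) = (\<Sum>k\<le>n. f (p * k)) + (\<Sum>j<n. \<Sum>i\<in>{1..<p}. f (p * j + i))"
    by (rule sum_upto_multiple)
  also have "[\<dots> = (\<Sum>k\<le>n. g k) + (\<Sum>j<n. \<Sum>i\<in>{1..<p}. 0)] (mod int p ^ 2)"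
  proof (intro cong_add cong_sum assms)
    fix j i assume j: "j \<in> {..<n}" and i: "i \<in> {1..<p}"
    show "\<not> p dvd p * j + i" using i by (intro not_dvd_multiple_add) auto
    have "p * Suc j \<le> p * n" using j by (intro mult_le_mono2) simp
    then show "p * j + i \<le> p * n" using i by simp
  qed simp
  finally show ?thesis by simp
qed

lemma cong_square_binomial_0:
  "\<not> p dvd k \<Longrightarrow> [int ((p * n choose k)^2) = 0] (mod int p ^ 2)"
  using cong_p2_0[OF cong_binomial_0[of k n] cong_binomial_0[of k n]] by (simp add: power2_eq_square)

section \<open>Supercongruences proved summand by summand\<close>

lemma super_franel: "[franel (p * n) = franel n] (mod int p ^ 2)"
  unfolding franel_def
proof (rule super_sum)
  fix k
  show "[int ((p * n choose (p * k))^2 * (2 * (p * k) choose (p * n)))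
    = int ((n choose k)^2 * (2 * k choose n))] (mod int p ^ 2)"
    unfolding of_nat_mult of_nat_power by (intro cong_mult cong_pow babbage') simp_all
  assume "\<not> p dvd k"
  then show "[int ((p * n choose k)^2 * (2 * k choose (p * n))) = 0] (mod int p ^ 2)"
    using cong_mult[OF cong_square_binomial_0 cong_refl] by (simp only: of_nat_mult mult_zero_left) blast
qed

lemma super_zagier_C: "[zagier_C (p * n) = zagier_C n] (mod int p ^ 2)"
  unfolding zagier_C_def
proof (rule super_sum)
  fix k
  show "[int ((p * n choose (p * k))^2 * (2 * (p * k) choose (p * k)))
    = int ((n choose k)^2 * (2 * k choose k))] (mod int p ^ 2)"
    unfolding of_nat_mult of_nat_power by (intro cong_mult cong_pow babbage') simp_all
  assume "\<not> p dvd k"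
  then show "[int ((p * n choose k)^2 * (2 * k choose k)) = 0] (mod int p ^ 2)"
    using cong_mult[OF cong_square_binomial_0 cong_refl] by (simp only: of_nat_mult mult_zero_left) blast
qed

lemma cong_square_binomial_mult_0:
  assumes "\<not> p dvd k"
  shows "[int ((p * n choose k)^2 * a) = 0] (mod int p ^ 2)"
  using cong_mult[OF cong_square_binomial_0[OF assms, of n] cong_refl[of "int a"]] by simp

lemma super_zagier_D: "[zagier_D (p * n) = zagier_D n] (mod int p ^ 2)"
  unfolding zagier_D_def
proof (rule super_sum)
  fix k
  show "[int ((p * n choose (p * k))^2 * (p * n + p * k choose (p * k)))
    = int ((n choose k)^2 * (n + k choose k))] (mod int p ^ 2)"
    unfolding of_nat_mult of_nat_power by (intro cong_mult cong_pow babbage') (simp_all add: algebra_simps)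
qed (rule cong_square_binomial_mult_0)

lemma super_apery: "[apery (p * n) = apery n] (mod int p ^ 2)"
  unfolding apery_def
proof (rule super_sum)
  fix k
  show "[int ((p * n choose (p * k))^2 * (p * n + p * k choose (p * k))^2)
    = int ((n choose k)^2 * (n + k choose k)^2)] (mod int p ^ 2)"
    unfolding of_nat_mult of_nat_power by (intro cong_mult cong_pow babbage') (simp_all add: algebra_simps)
qed (rule cong_square_binomial_mult_0)

lemma super_sequence_epsilon: "[sequence_epsilon (p * n) = sequence_epsilon n] (mod int p ^ 2)"
  unfolding sequence_epsilon_def
proof (rule super_sum)
  fix k
  show "[int ((p * n choose (p * k))^2 * (2 * (p * k) choose (p * n))^2)
    = int ((n choose k)^2 * (2 * k choose n)^2)] (mod int p ^ 2)"
    unfolding of_nat_mult of_nat_power by (intro cong_mult cong_pow babbage') simp_all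
qed (rule cong_square_binomial_mult_0)

lemma super_cooper_7: "[cooper_7 (p * n) = cooper_7 n] (mod int p ^ 2)"
  unfolding cooper_7_def
proof (rule super_sum)
  fix k
  show "[int ((p * n choose (p * k))^2 * (p * n + p * k choose (p * k)) * (2 * (p * k) choose (p * n)))
    = int ((n choose k)^2 * (n + k choose k) * (2 * k choose n))] (mod int p ^ 2)"
    unfolding of_nat_mult of_nat_power by (intro cong_mult cong_pow babbage') (simp_all add: algebra_simps)
qed (unfold mult.assoc, rule cong_square_binomial_mult_0)

lemma super_cooper_10: "[cooper_10 (p * n) = cooper_10 n] (mod int p ^ 2)"
  unfolding cooper_10_def
proof (rule super_sum)
  fix k
  show "[int ((p * n choose (p * k))^4) = int ((n choose k)^4)] (mod int p ^ 2)"
    unfolding of_nat_power by (intro cong_pow babbage)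
  assume "\<not> p dvd k"
  then show "[int ((p * n choose k)^4) = 0] (mod int p ^ 2)"
    using cong_square_binomial_mult_0[of k n "(p * n choose k)^2"] by (simp flip: power_add)
qed

lemma super_domb: "[domb (p * n) = domb n] (mod int p ^ 2)"
  unfolding domb_def
proof (rule super_sum)
  fix k
  show "[int ((p * n choose (p * k))^2 * (2 * (p * k) choose (p * k)) * (2 * (p * n - p * k) choose (p * n - p * k)))
    = int ((n choose k)^2 * (2 * k choose k) * (2 * (n - k) choose (n - k)))] (mod int p ^ 2)"
    unfolding of_nat_mult of_nat_power by (intro cong_mult cong_pow babbage') (simp_all add: diff_mult_distrib2)
qed (unfold mult.assoc, rule cong_square_binomial_mult_0)

text \<open>One factor \<open>p\<close> comes from \<open>p n choose k\<close>, the other from the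
  two central coefficients together.\<close>

lemma cong_central_product_0:
  assumes "\<not> p dvd k" "k \<le> p * n"
  shows "[int ((p * n choose k) * (2 * k choose k) * (2 * (p * n - k) choose (p * n - k))) = 0] (mod int p ^ 2)"
  using cong_p2_0[OF cong_binomial_0[OF assms(1), of n] cong_central_binomial_mult_0[OF assms]] by (simp add: mult.assoc)

lemma super_zagier_E: "[zagier_E (p * n) = zagier_E n] (mod int p ^ 2)"
  unfolding zagier_E_def
proof (rule super_sum)
  fix k
  show "[int ((p * n choose (p * k)) * (2 * (p * k) choose (p * k)) * (2 * (p * n - p * k) choose (p * n - p * k)))
    = int ((n choose k) * (2 * k choose k) * (2 * (n - k) choose (n - k)))] (mod int p ^ 2)"
    unfolding of_nat_mult by (intro cong_mult babbage') (simp_all add: diff_mult_distrib2)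
qed (rule cong_central_product_0)

lemma super_cooper_18: "[cooper_18 (p * n) = cooper_18 n] (mod int p ^ 2)"
  unfolding cooper_18_def
proof (rule super_sum)
  fix k
  \<comment> \<open>Multiplying both indices by \<open>p\<close> leaves the guard
    \<open>3 k <= n\<close> unchanged; the two coefficients behind it are covered by
    \<open>babbage_pred\<close> and \<open>babbage\<close>.\<close>
  have "[cooper_18_factor (p * n) (p * k) = cooper_18_factor n k] (mod int p ^ 2)" if "0 < n"
  proof (cases "3 * k \<le> n")
    case True
    then have "3 * (p * k) \<le> p * n" by simp
    moreover have idx: "2 * (p * n) - 3 * (p * k) = p * (2 * n - 3 * k)" by (simp add: diff_mult_distrib2)
    moreover have "0 < 2 * n - 3 * k" using True that by simp
    ultimately show ?thesis unfolding cooper_18_factor_def idx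
      using True by (simp only: if_True of_nat_add) (intro cong_add babbage babbage_pred)
  next
    case False
    then have "\<not> 3 * (p * k) \<le> p * n" using p_pos by (metis mult.left_commute mult_le_cancel1)
    then show ?thesis using False by (simp add: cooper_18_factor_def)
  qed
  then have factor: "[(if p * n = 0 then 1 else cooper_18_factor (p * n) (p * k)) = (if n = 0 then 1 else cooper_18_factor n k)] (mod int p ^ 2)"
    using p_pos by simp
  show "[(- 1) ^ (p * k) * int ((p * n choose (p * k)) * (2 * (p * k) choose (p * k)) * (2 * (p * n - p * k) choose (p * n - p * k)))
      * (if p * n = 0 then 1 else cooper_18_factor (p * n) (p * k))
    = (- 1) ^ k * int ((n choose k) * (2 * k choose k) * (2 * (n - k) choose (n - k)))
      * (if n = 0 then 1 else cooper_18_factor n k)] (mod int p ^ 2)"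
    unfolding of_nat_mult minus_one_power_p
    by (intro cong_mult babbage' factor[unfolded of_nat_mult] cong_refl) (simp_all add: diff_mult_distrib2)
next
  fix k assume "\<not> p dvd k" "k \<le> p * n"
  from cong_mult[OF cong_mult[OF cong_refl cong_central_product_0[OF this]] cong_refl]
  show "[(- 1) ^ k * int ((p * n choose k) * (2 * k choose k) * (2 * (p * n - k) choose (p * n - k)))
      * (if p * n = 0 then 1 else cooper_18_factor (p * n) k) = 0] (mod int p ^ 2)"
    by (simp only: mult_zero_right mult_zero_left)
qed

lemma super_sequence_eta: "[sequence_eta (p * n) = sequence_eta n] (mod int p ^ 2)"
  unfolding sequence_eta_def
proof (rule super_sum)
  fix k
  have "[eta_factor (p * n) (p * k) = eta_factor n k] (mod int p ^ 2)" if "0 < n"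
  proof (cases "5 * k \<le> n")
    case True
    then have "5 * (p * k) \<le> p * n" by simp
    moreover have idx: "4 * (p * n) - 5 * (p * k) = p * (4 * n - 5 * k)" "3 * (p * n) = p * (3 * n)"
      by (simp_all add: diff_mult_distrib2)
    moreover have "0 < 4 * n - 5 * k" using True that by simp
    ultimately show ?thesis unfolding eta_factor_def idx
      using True by (simp only: if_True of_nat_add) (intro cong_add babbage babbage_pred)
  next
    case False
    then have "\<not> 5 * (p * k) \<le> p * n" using p_pos by (metis mult.left_commute mult_le_cancel1)
    then show ?thesis using False by (simp add: eta_factor_def)
  qed
  then have factor: "[(if p * n = 0 then 1 else eta_factor (p * n) (p * k)) = (if n = 0 then 1 else eta_factor n k)] (mod int p ^ 2)"
    using p_pos by simp
  show "[(- 1) ^ (p * k) * int ((p * n choose (p * k))^3) * (if p * n = 0 then 1 else eta_factor (p * n) (p * k))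
    = (- 1) ^ k * int ((n choose k)^3) * (if n = 0 then 1 else eta_factor n k)] (mod int p ^ 2)"
    unfolding of_nat_power minus_one_power_p by (intro cong_mult cong_pow babbage factor cong_refl)
next
  fix k assume "\<not> p dvd k" "k \<le> p * n"
  then have "[int ((p * n choose k)^3) = 0] (mod int p ^ 2)"
    using cong_square_binomial_mult_0[of k n "p * n choose k"] by (simp add: power3_eq_cube power2_eq_square)
  from cong_mult[OF cong_mult[OF cong_refl this] cong_refl]
  show "[(- 1) ^ k * int ((p * n choose k)^3) * (if p * n = 0 then 1 else eta_factor (p * n) k) = 0] (mod int p ^ 2)"
    by (simp only: mult_zero_right mult_zero_left)
qed

text \<open>For an outer index prime to \<open>p\<close> the square of \<open>p n choose k\<close>
  kills the whole inner sum. For an outer index \<open>p k\<close> and \<open>l\<close> prime to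
  \<open>p\<close>, the factors \<open>p n choose l\<close> and \<open>p k choose l\<close>
  contribute one \<open>p\<close> each.\<close>

lemma super_sequence_zeta: "[sequence_zeta (p * n) = sequence_zeta n] (mod int p ^ 2)"
  unfolding sequence_zeta_def
proof (rule super_sum)
  fix k
  show "[(\<Sum>l\<le>p * n. int ((p * n choose (p * k))^2 * (p * n choose l) * (p * k choose l) * (p * k + l choose (p * n))))
    = (\<Sum>l\<le>n. int ((n choose k)^2 * (n choose l) * (k choose l) * (k + l choose n)))] (mod int p ^ 2)"
  proof (rule super_sum)
    fix l
    show "[int ((p * n choose (p * k))^2 * (p * n choose (p * l)) * (p * k choose (p * l)) * (p * k + p * l choose (p * n)))
      = int ((n choose k)^2 * (n choose l) * (k choose l) * (k + l choose n))] (mod int p ^ 2)"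
      unfolding of_nat_mult of_nat_power by (intro cong_mult cong_pow babbage') (simp_all add: algebra_simps)
  next
    fix l assume l: "\<not> p dvd l"
    have "[int ((p * n choose (p * k))^2) * (int (p * n choose l) * int (p * k choose l)) * int (p * k + l choose (p * n))
      = int ((p * n choose (p * k))^2) * 0 * int (p * k + l choose (p * n))] (mod int p ^ 2)"
      by (intro cong_mult cong_refl cong_p2_0 cong_binomial_0 l)
    then show "[int ((p * n choose (p * k))^2 * (p * n choose l) * (p * k choose l) * (p * k + l choose (p * n))) = 0] (mod int p ^ 2)"
      by (simp add: mult_ac)
  qed
next
  fix k assume k: "\<not> p dvd k"
  have "[(\<Sum>l\<le>p * n. int ((p * n choose k)^2 * (p * n choose l) * (k choose l) * (k + l choose (p * n)))) = (\<Sum>l\<le>p * n. 0)] (mod int p ^ 2)"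
    by (rule cong_sum) (simp only: mult.assoc cong_square_binomial_mult_0[OF k])
  then show "[(\<Sum>l\<le>p * n. int ((p * n choose k)^2 * (p * n choose l) * (k choose l) * (k + l choose (p * n)))) = 0] (mod int p ^ 2)"
    by simp
qed

section \<open>Cooper's sequences at the index \<open>p - 1\<close>\<close>

lemma dvd_cooper_7: "int p dvd cooper_7 (p - 1)"
proof -
  have "[int ((p - 1 choose k)^2 * (p - 1 + k choose k) * (2 * k choose (p - 1))) = 0] (mod int p)" if "k \<le> p - 1" for k
  proof (cases "k = 0")
    case True
    then show ?thesis using ge3 by (simp add: binomial_eq_0)
  next
    case False
    \<comment> \<open>Adding \<open>k\<close> to \<open>p - 1\<close> carries and leaves the last
      digit \<open>k - 1 < k\<close>, so \<open>p - 1 + k choose k\<close> vanishes for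
      \<open>k > 0\<close>; at \<open>k = 0\<close> the factor \<open>0 choose p - 1\<close>
      does.\<close>
    then have "p - 1 + k = p * 1 + (k - 1)" "k = p * 0 + k" "k - 1 < k" "k < p" using that p_pos by auto
    then have "[int (p - 1 + k choose k) = 0] (mod int p)" by (rule lucas_0)
    then show ?thesis
      using cong_mult[OF cong_mult[OF cong_refl] cong_refl, of "int (p - 1 + k choose k)" 0 "int p" "int ((p - 1 choose k)^2)"]
      by (simp add: cong_0_iff)
  qed
  then have "[cooper_7 (p - 1) = (\<Sum>k\<le>p - 1. 0)] (mod int p)"
    unfolding cooper_7_def by (intro cong_sum) auto
  then show ?thesis by (simp add: cong_0_iff)
qed

text \<open>Each \<open>p - 1 choose k\<close> is 1 or \<open>- 1\<close> modulo \<open>p\<close>,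
  so the sum of fourth powers counts \<open>p\<close> ones.\<close>

lemma dvd_cooper_10: "int p dvd cooper_10 (p - 1)"
proof -
  have "[cooper_10 (p - 1) = (\<Sum>k\<le>p - 1. 1)] (mod int p)"
    unfolding cooper_10_def
  proof (rule cong_sum)
    fix k assume "k \<in> {..p - 1}"
    then have "[int (p - 1 choose k)^4 = ((- 1)^k)^4] (mod int p)"
      using p_pos by (intro cong_pow binomial_pred_prime) auto
    then show "[int ((p - 1 choose k)^4) = 1] (mod int p)" by (simp flip: power_mult)
  qed
  also have "(\<Sum>k\<le>p - 1. 1) = int p" using p_pos by simp
  finally show ?thesis by (simp add: cong_0_iff cong_dvd_iff)
qed

text \<open>Away from the middle, one of \<open>k\<close> and \<open>p - 1 - k\<close> exceeds
  \<open>p / 2\<close> and its central coefficient vanishes; at \<open>2 k = p - 1\<close> the guard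
  \<open>3 k <= p - 1\<close> fails.\<close>

lemma dvd_cooper_18: "int p dvd cooper_18 (p - 1)"
proof -
  have "[(- 1)^k * int ((p - 1 choose k) * (2 * k choose k) * (2 * (p - 1 - k) choose (p - 1 - k)))
    * (if p - 1 = 0 then 1 else cooper_18_factor (p - 1) k) = 0] (mod int p)" if k: "k \<le> p - 1" for k
  proof -
    have "p - 1 \<noteq> 0" using ge3 by simp
    obtain m where m: "p = 2 * m + 1" using odd_p by (elim oddE)
    consider "m < k" | "k < m" | "k = m" by linarith
    then consider "p < 2 * k" | "p < 2 * (p - 1 - k)" | "2 * k = p - 1"
      unfolding m by cases auto
    then show ?thesis
    proof cases
      case 1
      have "k mod p = k" using k p_pos by simp
      then have "int p dvd int (2 * k choose k)" using cong_central_binomial_0[of k] 1 by (simp add: cong_0_iff)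
      then show ?thesis by (simp add: cong_0_iff)
    next
      case 2
      have "(p - 1 - k) mod p = p - 1 - k" using p_pos by simp
      then have "int p dvd int (2 * (p - 1 - k) choose (p - 1 - k))"
        using cong_central_binomial_0[of "p - 1 - k"] 2 by (simp add: cong_0_iff)
      then show ?thesis by (simp add: cong_0_iff)
    next
      case 3
      then have "cooper_18_factor (p - 1) k = 0"
        using ge3 unfolding cooper_18_factor_def by (auto intro!: binomial_eq_0)
      then show ?thesis using \<open>p - 1 \<noteq> 0\<close> by simp
    qed
  qed
  then have "[cooper_18 (p - 1) = (\<Sum>k\<le>p - 1. 0)] (mod int p)"
    unfolding cooper_18_def by (intro cong_sum) auto
  then show ?thesis by (simp add: cong_0_iff)
qed

section \<open>Supercongruences proved through Fermat quotients\<close>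

lemma fermat_cong: "[int b ^ p = int b] (mod int p)"
proof (induction b)
  case (Suc b)
  define f where "f k = int (p choose k) * int b ^ k" for k
  have "int (Suc b) ^ p = (\<Sum>k\<le>p. f k)"
    using binomial_ring[of "int b" 1 p] by (simp add: f_def add.commute)
  also have "\<dots> = (\<Sum>k\<in>{0, p}. f k) + (\<Sum>k\<in>{..p} - {0, p}. f k)"
    by (subst add.commute) (intro sum.subset_diff; auto)
  also have "[\<dots> = (\<Sum>k\<in>{0, p}. f k) + (\<Sum>k\<in>{..p} - {0, p}. 0)] (mod int p)"
  proof (intro cong_add cong_refl cong_sum)
    fix k assume "k \<in> {..p} - {0, p}"
    then have "\<not> p dvd k" by (intro not_dvd_small) auto
    then have "[int (p choose k) = 0] (mod int p)" using cong_binomial_0[of k 1] by simp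
    then show "[f k = 0] (mod int p)" by (simp add: f_def cong_0_iff)
  qed
  also have "(\<Sum>k\<in>{0, p}. f k) + (\<Sum>k\<in>{..p} - {0, p}. 0) = int b ^ p + 1"
    using p_pos by (simp add: f_def)
  also have "[int b ^ p + 1 = int b + 1] (mod int p)" using Suc by (intro cong_add cong_refl)
  finally show ?case by (simp add: add.commute)
qed (use p_pos in \<open>simp add: zero_power\<close>)

text \<open>Taken in the rationals, so that \<open>b^(p - 1) = 1 + p q\<close> holds by definition
  and Fermat's theorem becomes the statement that \<open>q\<close> is
  \<open>p\<close>-integral.\<close>

definition fermat_quotient :: "nat \<Rightarrow> rat" where
  "fermat_quotient b = (of_nat b ^ (p - 1) - 1) / of_nat p"

lemma fermat_quotient_localization:
  assumes "\<not> p dvd b"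
  shows "fermat_quotient b \<in> localization p"
proof -
  have "int b * int b ^ (p - 1) = int b ^ p"
    using p_pos by (metis Suc_diff_1 power_Suc)
  then have "[int b * int b ^ (p - 1) = int b * 1] (mod int p)"
    using fermat_cong[of b] by (simp only: mult_1_right)
  moreover have "coprime (int b) (int p)"
    using assms prime_imp_coprime[OF prime] by (simp add: coprime_commute)
  ultimately have "[int b ^ (p - 1) = 1] (mod int p)" by (simp only: cong_mult_lcancel)
  then obtain c where "int b ^ (p - 1) - 1 = int p * c" by (auto simp: cong_iff_dvd_diff)
  then have "of_nat b ^ (p - 1) - 1 = (of_nat p * of_int c :: rat)"
    by (metis of_int_1 of_int_diff of_int_mult of_int_of_nat_eq of_int_power)
  then have "fermat_quotient b = of_int c" using p_nonzero by (simp add: fermat_quotient_def)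
  then show ?thesis by simp
qed

lemma power_fermat_quotient: "of_nat b ^ (p - 1) = 1 + of_nat p * fermat_quotient b"
  using p_nonzero by (simp add: fermat_quotient_def)

lemma power_p_fermat_quotient: "of_nat b ^ p = of_nat b * (1 + of_nat p * fermat_quotient b)"
  unfolding power_fermat_quotient[symmetric] using p_pos by (simp flip: power_Suc)

lemma pcong_fermat: "\<not> p dvd b \<Longrightarrow> pcong 1 (of_nat b ^ (p - 1)) 1"
  unfolding power_fermat_quotient pcong_def
  by (rule bexI[of _ "fermat_quotient b"]) (simp_all add: fermat_quotient_localization)

lemma pcong_power_p: "\<not> p dvd b \<Longrightarrow> pcong 1 (of_nat b ^ p) (of_nat b)"
  unfolding power_p_fermat_quotient pcong_def
  by (rule bexI[of _ "of_nat b * fermat_quotient b"])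
    (auto simp: algebra_simps intro!: localization_mult fermat_quotient_localization)

lemma pcong_one_plus_power:
  assumes "x \<in> localization p"
  shows "pcong 2 ((1 + of_nat p * x) ^ m) (1 + of_nat p * (of_nat m * x))"
proof (induction m)
  case (Suc m)
  have loc: "1 + of_nat p * x \<in> localization p" using assms by (intro localization_add localization_mult) auto
  have "pcong 2 ((1 + of_nat p * x) ^ Suc m) ((1 + of_nat p * x) * (1 + of_nat p * (of_nat m * x)))"
    unfolding power_Suc by (intro pcong_scale Suc loc)
  also have "pcong 2 \<dots> (1 + of_nat p * (of_nat (Suc m) * x))"
    unfolding pcong_def using assms
    by (intro bexI[of _ "of_nat m * x * x"]) (auto simp: algebra_simps power2_eq_square intro!: localization_mult)
  finally show ?case .
qed simp

lemma pcong_cancel_p: "pcong 2 (of_nat p * x) (of_nat p * y) \<Longrightarrow> pcong 1 x y"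
  unfolding pcong_def using p_nonzero by (auto simp: power2_eq_square simp flip: right_diff_distrib)

text \<open>When one factor carries a \<open>p\<close>, it is enough to know the other one modulo
  \<open>p\<close>.\<close>

lemma pcong_p_multI:
  assumes "pcong 2 c (of_nat p * y)" "pcong 1 w w'" "y \<in> localization p" "w \<in> localization p"
  shows "pcong 2 (w * c) (of_nat p * (y * w'))"
proof -
  have "pcong 2 (w * c) (w * (of_nat p * y))" using assms by (intro pcong_scale)
  also have "w * (of_nat p * y) = of_nat p * (y * w)" by simp
  also have "pcong 2 \<dots> (of_nat p * (y * w'))" using assms by (intro pcong_p_mult2 pcong_scale)
  finally show ?thesis .
qed

lemma minus_one_localization [simp]: "- 1 \<in> localization p" "(- 1) ^ k \<in> localization p"
  using localization_of_int[of "- 1"] localization_of_int[of "(- 1) ^ k"] by simp_all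

text \<open>The exponent is \<open>p (n - a - 1) + (p - l)\<close>; as \<open>c^p = c\<close> modulo
  \<open>p\<close>, the blocks contribute \<open>c^(n - a)\<close> and \<open>l\<close> inverse
  factors remain.\<close>

lemma pcong_power_complement:
  assumes "\<not> p dvd c" "l < p" "a < n"
  shows "pcong 1 (of_nat c ^ (p * n - (p * a + l))) (of_nat c ^ (n - a) / of_nat c ^ l)"
proof -
  define b where "b = n - a - 1"
  have n: "n = a + b + 1" using assms by (simp add: b_def)
  have c: "of_nat c \<noteq> (0 :: rat)" using assms by (metis dvd_0_right of_nat_eq_0_iff)
  have "p * n - (p * a + l) = p * b + (p - l)" using assms by (simp add: n algebra_simps)
  then have "of_nat c ^ (p * n - (p * a + l)) = (of_nat c ^ p) ^ b * (of_nat c ^ p / of_nat c ^ l :: rat)"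
    using assms c by (simp add: power_add power_mult power_diff)
  also have "pcong 1 \<dots> (of_nat c ^ b * (of_nat c / of_nat c ^ l))"
  proof (intro pcong_mult pcong_power pcong_power_p assms localization_power)
    have nd: "\<not> p dvd c ^ l" using assms prime prime_dvd_power by blast
    then show "pcong 1 (of_nat c ^ p / of_nat c ^ l) (of_nat c / of_nat c ^ l)"
      using pcong_divide_nat[OF pcong_power_p[OF assms(1)] nd] by simp
    show "of_nat c / of_nat c ^ l \<in> localization p"
      using localization_divide_nat[OF localization_of_nat nd] by simp
  qed simp_all
  also have "of_nat c ^ b * (of_nat c / of_nat c ^ l) = (of_nat c ^ (n - a) / of_nat c ^ l :: rat)"
    by (simp add: n)
  finally show ?thesis .
qed

text \<open>Replacing \<open>c\<^bsup>p N\<^esup>\<close> by \<open>c\<^bsup>N\<^esup>\<close> costs a multiple of \<open>p\<close> times \<open>fermat_quotient c\<close>; the summands with index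
  prime to \<open>p\<close> compensate it by the hypothesis \<open>quotient\<close>.\<close>

lemma super_weighted_sum:
  fixes c d n :: nat and v :: "nat \<Rightarrow> nat \<Rightarrow> rat" and h :: "nat \<Rightarrow> rat"
  defines "T \<equiv> \<lambda>N k. (- 1) ^ k * of_nat c ^ (N - d * k) * of_nat (N choose (d * k)) * v N k"
  assumes d: "odd d" "\<not> p dvd d" and c: "\<not> p dvd c"
    and v: "\<And>N k. v N k \<in> localization p" and h: "\<And>i. h i \<in> localization p"
    and v_multiple: "\<And>k. k \<le> n \<Longrightarrow> pcong 2 (v (p * n) (p * k)) (v n k)"
    and v_lucas: "\<And>j i. j < n \<Longrightarrow> i \<in> {1..<p} \<Longrightarrow> pcong 1 (v (p * n) (p * j + i)) (v n j * h i)"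
    and h_0: "\<And>i. i \<in> {1..<p} \<Longrightarrow> p < d * i \<Longrightarrow> pcong 1 (h i) 0"
    and quotient: "pcong 1 (\<Sum>i\<in>{1..<p}. if d * i < p then h i / (of_nat (d * i) * of_nat c ^ (d * i)) else 0)
      (fermat_quotient c)"
  shows "pcong 2 (\<Sum>k\<le>p * n. T (p * n) k) (\<Sum>k\<le>n. T n k)"
proof -
  define q where "q = fermat_quotient c"
  define g where "g i = (if d * i < p then h i / (of_nat (d * i) * of_nat c ^ (d * i)) else 0)" for i
  \<comment> \<open>This is \<open>(n - d j) T n j\<close> with the linear factor absorbed in the
    binomial coefficient: the common weight of the defect and of the summands compensating
    it.\<close>
  define U where "U j = of_nat n * of_nat (n - 1 choose (d * j)) * ((- 1) ^ j * of_nat c ^ (n - d * j) * v n j)" for j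
  have d_pos: "0 < d" using d by (auto intro: Nat.gr0I)
  have q: "q \<in> localization p" unfolding q_def by (rule fermat_quotient_localization[OF c])
  have locT: "T N k \<in> localization p" for N k
    unfolding T_def by (intro localization_mult localization_power v) auto
  have locU: "U k \<in> localization p" for k
    unfolding U_def by (intro localization_mult localization_power v) auto
  have nd_di: "\<not> p dvd d * i" if "i \<in> {1..<p}" for i
    using that d by (simp add: prime_dvd_mult_iff[OF prime] not_dvd_small)
  have locg: "g i \<in> localization p" if i: "i \<in> {1..<p}" for i
  proof -
    have "\<not> p dvd d * i * c ^ (d * i)"
      using nd_di[OF i] c prime by (meson prime_dvd_mult_iff prime_dvd_power)
    then have "h i / of_nat (d * i * c ^ (d * i)) \<in> localization p" by (intro localization_divide_nat h)
    then show ?thesis by (simp add: g_def)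
  qed
  have U: "(of_nat n - of_nat (d * k)) * T n k = U k" for k
  proof (cases "d * k \<le> n")
    case True
    have "(n - d * k) * (n choose (d * k)) = n * (n - 1 choose (d * k))" by (rule binomial_absorb_comp)
    then have "of_nat (n - d * k) * of_nat (n choose (d * k)) = (of_nat n * of_nat (n - 1 choose (d * k)) :: rat)"
      by (metis of_nat_mult)
    then show ?thesis using True unfolding T_def U_def by (simp add: of_nat_diff)
  next
    case False
    then show ?thesis by (simp add: T_def U_def binomial_eq_0)
  qed
  \<comment> \<open>The exponent \<open>p m\<close> with \<open>m = n - d k\<close> yields
    \<open>(1 + p q)^m\<close>, hence the extra term \<open>p m q\<close>, recorded by
    \<open>U k\<close>.\<close>
  have multiple: "pcong 2 (T (p * n) (p * k)) (T n k + of_nat p * (q * U k))" if k: "k \<le> n" for k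
  proof (cases "d * k \<le> n")
    case True
    define m where "m = n - d * k"
    have idx: "p * n - d * (p * k) = p * m" "d * (p * k) = p * (d * k)"
      by (simp_all add: m_def diff_mult_distrib2 mult.left_commute[of d])
    have cp: "of_nat c ^ (p * m) = (of_nat c ^ m * (1 + of_nat p * q) ^ m :: rat)"
      by (simp only: power_mult power_p_fermat_quotient power_mult_distrib q_def)
    have "T (p * n) (p * k) = (- 1) ^ k * (of_nat c ^ m * (1 + of_nat p * q) ^ m)
        * of_nat (p * n choose (p * (d * k))) * v (p * n) (p * k)"
      unfolding T_def minus_one_power_p idx(1) cp by (simp only: idx(2))
    also have "pcong 2 \<dots> ((- 1) ^ k * (of_nat c ^ m * (1 + of_nat p * (of_nat m * q))) * of_nat (n choose (d * k)) * v n k)"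
    proof (intro pcong_mult pcong_refl pcong_one_plus_power q v_multiple k localization_mult localization_power
        localization_add localization_of_nat localization_1 minus_one_localization v)
      show "pcong 2 (of_nat (p * n choose (p * (d * k)))) (of_nat (n choose (d * k)))"
        using pcong_of_nat_int[OF babbage] by simp
    qed
    also have "(- 1) ^ k * (of_nat c ^ m * (1 + of_nat p * (of_nat m * q))) * of_nat (n choose (d * k)) * v n k
      = T n k + of_nat p * (q * U k)"
      unfolding U[symmetric] T_def m_def[symmetric] using True by (simp add: m_def of_nat_diff algebra_simps)
    finally show ?thesis .
  next
    case False
    then have "p * n < p * (d * k)" using p_pos by simp
    then show ?thesis using False by (simp add: T_def U[symmetric] binomial_eq_0 mult.left_commute)
  qed
  \<comment> \<open>Modulo \<open>p^2\<close> each of these summands is \<open>p\<close> times a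
    product of \<open>U j\<close>, free of \<open>i\<close>, and \<open>g i\<close>, free of
    \<open>j\<close> and \<open>n\<close>; therefore the double sum factors.\<close>
  have other: "pcong 2 (T (p * n) (p * j + i)) (of_nat p * (- (U j * g i)))" if j: "j < n" and i: "i \<in> {1..<p}" for j i
  proof -
    have idx: "d * (p * j + i) = p * (d * j) + d * i" by (simp add: algebra_simps)
    have "d * i \<noteq> p" using nd_di[OF i] by auto
    then consider "d * i < p" "d * j < n" | "d * i < p" "n \<le> d * j" | "p < d * i"
      by linarith
    then show ?thesis
    proof cases
      case 1
      define y where "y = of_nat n * of_nat (n - 1 choose (d * j)) * (- 1) ^ (d * i - 1) / (of_nat (d * i) :: rat)"
      define w where "w = (- 1) ^ (p * j + i) * of_nat c ^ (p * n - (p * (d * j) + d * i)) * v (p * n) (p * j + i)"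
      have "0 < d * i" using i d_pos by simp
      have "pcong 2 (of_nat (p * n choose (p * (d * j) + d * i))) (of_nat p * y)"
        unfolding y_def using 1 i d_pos j by (intro binomial_near_multiple) auto
      moreover have "pcong 1 w ((- 1) ^ (p * j + i) * (of_nat c ^ (n - d * j) / of_nat c ^ (d * i)) * (v n j * h i))"
        unfolding w_def
      proof (intro pcong_mult pcong_refl pcong_power_complement v_lucas localization_mult localization_power v h c 1 j i)
        have nd: "\<not> p dvd c ^ (d * i)" using c prime prime_dvd_power by blast
        show "of_nat c ^ (n - d * j) / of_nat c ^ (d * i) \<in> localization p"
          using localization_divide_nat[OF localization_power[OF localization_of_nat] nd] by simp
      qed simp_all
      moreover have "y \<in> localization p"
        unfolding y_def using nd_di[OF i] by (intro localization_divide_nat localization_mult) auto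
      moreover have "w \<in> localization p"
        unfolding w_def by (intro localization_mult localization_power v) auto
      ultimately have "pcong 2 (w * of_nat (p * n choose (p * (d * j) + d * i)))
        (of_nat p * (y * ((- 1) ^ (p * j + i) * (of_nat c ^ (n - d * j) / of_nat c ^ (d * i)) * (v n j * h i))))"
        by (rule pcong_p_multI)
      also have "w * of_nat (p * n choose (p * (d * j) + d * i)) = T (p * n) (p * j + i)"
        unfolding T_def w_def idx by (simp only: mult_ac)
      also have "y * ((- 1) ^ (p * j + i) * (of_nat c ^ (n - d * j) / of_nat c ^ (d * i)) * (v n j * h i)) = - (U j * g i)"
      proof -
        \<comment> \<open>The total exponent \<open>(d + 1) i - 1\<close> is odd because
          \<open>d\<close> is, so the sign does not depend on \<open>i\<close>.\<close>
        have "(- 1 :: rat) ^ (d * i - 1) * (- 1) ^ (p * j + i) = - ((- 1) ^ j)"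
        proof -
          have "(- 1 :: rat) ^ (d * i - 1) * (- 1) ^ (p * j + i) = (- 1) ^ (d * i - 1 + i) * (- 1) ^ j"
            by (simp add: power_add)
          moreover have "odd (d * i - 1 + i)"
            using d \<open>0 < d * i\<close> by (cases "even i") auto
          ultimately show ?thesis by simp
        qed
        moreover have "y * ((- 1) ^ (p * j + i) * (of_nat c ^ (n - d * j) / of_nat c ^ (d * i)) * (v n j * h i))
          = of_nat n * of_nat (n - 1 choose (d * j)) * ((- 1) ^ (d * i - 1) * (- 1) ^ (p * j + i)) / of_nat (d * i)
            * (of_nat c ^ (n - d * j) / of_nat c ^ (d * i)) * (v n j * h i)"
          unfolding y_def by (simp only: divide_inverse mult_ac)
        ultimately show ?thesis using 1 unfolding U_def g_def by (simp add: field_simps)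
      qed
      finally show ?thesis .
    next
      case 2
      then have "n - 1 < d * j" using j by linarith
      then have "U j = 0" by (simp add: U_def binomial_eq_0)
      moreover have "p * n < p * (d * j) + d * i"
      proof -
        have "p * n \<le> p * (d * j)" using 2 by simp
        moreover have "0 < d * i" using i d_pos by simp
        ultimately show ?thesis by linarith
      qed
      ultimately show ?thesis by (simp add: T_def idx binomial_eq_0)
    next
      case 3
      \<comment> \<open>Two independent factors \<open>p\<close>: one from the binomial coefficient,
        whose lower index is prime to \<open>p\<close>, and one from \<open>h i\<close>.\<close>
      have "\<not> p dvd d * (p * j + i)" unfolding idx using nd_di[OF i] by (metis dvd_add_right_iff dvd_triv_left)
      then have "pcong 1 (of_nat (p * n choose (d * (p * j + i)))) 0"
        using pcong_of_nat_int[of "p * n choose (d * (p * j + i))" 0 1] cong_binomial_0 by simp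
      moreover have "pcong 1 (v (p * n) (p * j + i)) 0"
      proof -
        have "pcong 1 (v n j * h i) (v n j * 0)" using 3 by (intro pcong_scale h_0 v i)
        then show ?thesis using pcong_trans[OF v_lucas[OF j i]] by simp
      qed
      ultimately have "pcong 2 (of_nat (p * n choose (d * (p * j + i))) * v (p * n) (p * j + i)) 0"
        using pcong_0_mult[of 1 _ 1] by (simp add: numeral_2_eq_2)
      then have "pcong 2 ((- 1) ^ (p * j + i) * of_nat c ^ (p * n - d * (p * j + i))
          * (of_nat (p * n choose (d * (p * j + i))) * v (p * n) (p * j + i)))
        ((- 1) ^ (p * j + i) * of_nat c ^ (p * n - d * (p * j + i)) * 0)"
        by (intro pcong_scale localization_mult localization_power) auto
      then show ?thesis using 3 by (simp add: T_def g_def mult.assoc)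
    qed
  qed
  have "(\<Sum>k\<le>p * n. T (p * n) k) = (\<Sum>k\<le>n. T (p * n) (p * k)) + (\<Sum>j<n. \<Sum>i\<in>{1..<p}. T (p * n) (p * j + i))"
    by (rule sum_upto_multiple)
  also have "pcong 2 \<dots> ((\<Sum>k\<le>n. T n k + of_nat p * (q * U k)) + (\<Sum>j<n. \<Sum>i\<in>{1..<p}. of_nat p * (- (U j * g i))))"
    by (intro pcong_add pcong_sum multiple other) auto
  also have "(\<Sum>k\<le>n. T n k + of_nat p * (q * U k)) + (\<Sum>j<n. \<Sum>i\<in>{1..<p}. of_nat p * (- (U j * g i)))
    = (\<Sum>k\<le>n. T n k) + of_nat p * ((\<Sum>j<n. U j) * (q - (\<Sum>i\<in>{1..<p}. g i)))"
  proof -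
    \<comment> \<open>The multiples of \<open>p\<close> run up to \<open>k = n\<close>, the blocks
      in between only up to \<open>j = n - 1\<close>; the weight at the surplus index
      vanishes.\<close>
    have "U n = 0"
    proof (cases "n = 0")
      case False
      have "1 * n \<le> d * n" using d_pos by (intro mult_le_mono1) simp
      then have "n - 1 < d * n" using False by linarith
      then show ?thesis by (simp add: U_def binomial_eq_0)
    qed (simp add: U_def)
    then have "(\<Sum>k\<le>n. U k) = (\<Sum>k<n. U k)" by (simp add: lessThan_Suc_atMost[symmetric])
    then show ?thesis
      by (simp add: sum.distrib sum_negf sum_distrib_left[symmetric] sum_distrib_right[symmetric] right_diff_distrib mult_ac)
  qed
  also have "pcong 2 \<dots> ((\<Sum>k\<le>n. T n k) + of_nat p * ((\<Sum>j<n. U j) * 0))"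
  proof (intro pcong_add pcong_refl pcong_p_mult2 pcong_scale localization_sum locU)
    show "pcong 1 (q - (\<Sum>i\<in>{1..<p}. g i)) 0"
      using pcong_diff[OF pcong_refl[of 1 q] quotient] unfolding g_def q_def by simp
  qed
  finally show ?thesis by simp
qed

end

section \<open>Fermat quotients as harmonic sums, and the quotient of 3\<close>

lemma alternating_sum_binomial_mult:
  "(\<Sum>k\<le>K. (- 1)^k * of_nat ((m + 1 choose k) * (m + k choose k)))
    = (- 1)^K * (of_nat ((m choose K) * (m + 1 + K choose K)) :: rat)"
proof (induction K)
  case (Suc K)
  define r where "r = ifact (int (Suc K))"
  define R where "R = ifact (int m - int K)"
  define s where "s = ifact (int (m + 1))"
  define F where "F = (fact (m + Suc K) :: rat)"
  have idx: "int (m + 1) - int (Suc K) = int m - int K" "int (m + Suc K) - int (Suc K) = int m"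
    "int (m + 1 + K) - int K = int (m + 1)" "int (m + 1 + Suc K) - int (Suc K) = int (m + 1)"
    "int (m + Suc K) - int K = int (m + 1)" "int (Suc (m + Suc K)) - int (Suc K) = int (m + 1)"
    "int m - int (Suc K) = int m - int K - 1" "m + 1 + K = m + Suc K" "m + 1 + Suc K = Suc (m + Suc K)" by simp_all
  have rs: "ifact (int m) = (of_nat m + 1) * s" unfolding s_def using index_shift(1)[of m] by simp
  have rK: "ifact (int K) = (of_nat K + 1) * r" unfolding r_def by (rule index_shift(1))
  have facts: "fact (m + 1) = (of_nat m + 1) * (fact m :: rat)" "fact (Suc (m + Suc K)) = (of_nat m + of_nat K + 2) * F"
    by (simp_all add: F_def algebra_simps)
  have "of_nat (m + 1 choose Suc K) * of_nat (m + Suc K choose Suc K) - of_nat (m choose K) * of_nat (m + 1 + K choose K)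
    = (of_nat (m choose Suc K) * of_nat (m + 1 + Suc K choose Suc K) :: rat)"
    unfolding of_nat_binomial_ifact idx rs rK ifact_rec facts
    unfolding idx facts r_def[symmetric] R_def[symmetric] s_def[symmetric] F_def[symmetric] of_int_diff of_int_of_nat_eq
    by (simp add: algebra_simps)
  then show ?case using Suc by (simp add: algebra_simps del: binomial_Suc_Suc)
qed simp

text \<open>The coefficients are those of the shifted Legendre polynomial. Passing from
  \<open>m\<close> to \<open>m + 1\<close> adds \<open>2 / (m + 1)\<close> times an alternating sum
  equal to \<open>- 1\<close>: the closed form of \<open>alternating_sum_binomial_mult\<close> is 0
  at \<open>K = m + 1\<close>, and the term at \<open>k = 0\<close> is 1.\<close>

lemma sum_binomial_mult_harmonic:
  "(\<Sum>k\<in>{1..m}. (- 1)^k * of_nat ((m choose k) * (m + k choose k)) / of_nat k)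
    = - 2 * (\<Sum>k\<in>{1..m}. 1 / of_nat k :: rat)"
proof (induction m)
  case (Suc m)
  have step: "(- 1)^k * of_nat ((Suc m choose k) * (Suc m + k choose k)) / of_nat k
    = (- 1)^k * of_nat ((m choose k) * (m + k choose k)) / of_nat k
      + 2 / of_nat (Suc m) * ((- 1)^k * of_nat ((m + 1 choose k) * (m + k choose k)) :: rat)" if "k \<noteq> 0" for k
  proof -
    define R where "R = ifact (int (m + 1) - int k)"
    have idx: "int m - int k = int (m + 1) - int k - 1" "Suc m = m + 1" "int (m + k) - int k = int m" by simp_all
    have m: "ifact (int m) * fact m = 1" using ifact_fact[of m] by (simp add: mult.commute)
    have facts: "fact (m + 1 + k) = (of_nat m + 1 + of_nat k) * (fact (m + k) :: rat)"
      "fact (m + 1) = (of_nat m + 1) * (fact m :: rat)" by (simp_all add: algebra_simps)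
    define Z where "Z = fact (m + k) * ifact (int k)^2 * R"
    have A: "of_nat (m + 1 choose k) * of_nat (m + 1 + k choose k) = of_nat (m choose k) * of_nat (m + k choose k) + 2 * of_nat k * Z"
      unfolding binomial_mult_binomial_add idx(1) ifact_rec facts(1) R_def Z_def by (simp add: algebra_simps)
    have B: "of_nat (m + 1 choose k) * of_nat (m + k choose k) = of_nat (m + 1) * Z"
    proof -
      have "of_nat (m + 1 choose k) * of_nat (m + k choose k) = of_nat (m + 1) * Z * (ifact (int m) * fact m)"
        unfolding of_nat_binomial_ifact idx(3) facts(2) R_def Z_def by (simp add: power2_eq_square algebra_simps)
      then show ?thesis unfolding m by simp
    qed
    have "of_nat (m + 1) \<noteq> (0 :: rat)" "of_nat k \<noteq> (0 :: rat)" using that by simp_all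
    then show ?thesis unfolding idx(2) of_nat_mult A B
      by (simp add: add_divide_distrib distrib_left del: of_nat_add of_nat_Suc)
  qed
  have "(\<Sum>k\<in>{1..Suc m}. (- 1)^k * of_nat ((Suc m choose k) * (Suc m + k choose k)) / of_nat k)
    = (\<Sum>k\<in>{1..Suc m}. (- 1)^k * of_nat ((m choose k) * (m + k choose k)) / of_nat k)
      + 2 / of_nat (Suc m) * (\<Sum>k\<in>{1..Suc m}. (- 1)^k * of_nat ((m + 1 choose k) * (m + k choose k)) :: rat)"
    unfolding sum_distrib_left sum.distrib[symmetric] by (rule sum.cong) (auto simp only: step atLeastAtMost_iff)
  also have "(\<Sum>k\<in>{1..Suc m}. (- 1)^k * of_nat ((m + 1 choose k) * (m + k choose k)) :: rat) = - 1"
  proof -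
    have "{..Suc m} = insert 0 {1..Suc m}" by auto
    then have "(\<Sum>k\<le>Suc m. (- 1)^k * of_nat ((m + 1 choose k) * (m + k choose k)) :: rat)
      = 1 + (\<Sum>k\<in>{1..Suc m}. (- 1)^k * of_nat ((m + 1 choose k) * (m + k choose k)))" by simp
    then show ?thesis unfolding alternating_sum_binomial_mult by (simp add: binomial_eq_0)
  qed
  also have "(\<Sum>k\<in>{1..Suc m}. (- 1)^k * of_nat ((m choose k) * (m + k choose k)) / of_nat k)
    = - 2 * (\<Sum>k\<in>{1..m}. 1 / of_nat k :: rat)"
    using Suc by (simp add: binomial_eq_0)
  finally show ?case by (simp add: algebra_simps)
qed simp

context odd_prime
begin

lemma harmonic_reflect: "pcong 1 (\<Sum>i\<in>I. 1 / of_nat (p - i)) (- (\<Sum>i\<in>I. 1 / of_nat i))" if I: "I \<subseteq> {1..<p}"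
  unfolding sum_negf[symmetric]
proof (rule pcong_sum)
  fix i assume "i \<in> I"
  then have i: "0 < i" "i < p" using I by auto
  then have "1 / of_nat (p - i) - (- (1 / of_nat i)) = (of_nat p ^ 1 * (1 / of_nat (p - i) * (1 / of_nat i)) :: rat)"
    by (simp add: field_simps of_nat_diff)
  moreover have "1 / of_nat (p - i) * (1 / of_nat i) \<in> localization p"
    using i by (intro localization_mult localization_divide_nat not_dvd_small) auto
  ultimately show "pcong 1 (1 / of_nat (p - i)) (- (1 / of_nat i))" unfolding pcong_def by blast
qed

lemma localization_inverse_nat: "i \<in> {1..<p} \<Longrightarrow> 1 / of_nat i \<in> localization p"
  by (intro localization_divide_nat not_dvd_small) auto

lemma pcong_prod_one_plus:
  assumes "finite I" "\<And>i. i \<in> I \<Longrightarrow> x i \<in> localization p"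
  shows "pcong 2 (\<Prod>i\<in>I. 1 + of_nat p * x i) (1 + of_nat p * (\<Sum>i\<in>I. x i))"
  using assms
proof (induction I)
  case (insert i I)
  have S: "(\<Sum>i\<in>I. x i) \<in> localization p" using insert by (intro localization_sum) auto
  have "pcong 2 ((1 + of_nat p * x i) * (\<Prod>i\<in>I. 1 + of_nat p * x i)) ((1 + of_nat p * x i) * (1 + of_nat p * (\<Sum>i\<in>I. x i)))"
    using insert by (intro pcong_scale localization_add localization_mult) auto
  also have "pcong 2 \<dots> (1 + of_nat p * (x i + (\<Sum>i\<in>I. x i)))"
    unfolding pcong_def using insert S
    by (intro bexI[of _ "x i * (\<Sum>i\<in>I. x i)"]) (auto simp: algebra_simps power2_eq_square intro!: localization_mult)
  finally show ?case using insert by simp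
qed simp

text \<open>Comparing \<open>\<Prod>(b j)\<close> with the product of the residues of \<open>b j\<close> modulo \<open>p\<close>, to second order.\<close>

lemma fermat_quotient_sum:
  assumes b: "\<not> p dvd b"
  shows "pcong 1 (of_nat b * fermat_quotient b) (\<Sum>j\<in>{1..<p}. of_nat (b * j div p) / of_nat j)"
proof -
  define t where "t j = b * j div p" for j
  define r where "r j = b * j mod p" for j
  \<comment> \<open>Multiplication by the unit \<open>b\<close> permutes the nonzero residues, so
    that the factor \<open>P\<close> cancels from both products.\<close>
  have bij: "bij_betw r {1..<p} {1..<p}"
  proof (rule bij_betw_imageI)
    show inj: "inj_on r {1..<p}"
    proof (rule inj_onI)
      fix i j assume ij: "i \<in> {1..<p}" "j \<in> {1..<p}" "r i = r j"
      then have "[b * i = b * j] (mod p)" by (simp add: r_def cong_def)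
      then have "[i = j] (mod p)" using cong_mult_lcancel_nat[of b p i j] prime_imp_coprime[OF prime b] by (simp add: coprime_commute)
      then show "i = j" using ij by (simp add: cong_less_modulus_unique_nat)
    qed
    have "r ` {1..<p} \<subseteq> {1..<p}"
    proof
      fix x assume "x \<in> r ` {1..<p}"
      then obtain j where j: "j \<in> {1..<p}" "x = r j" by blast
      then have "\<not> p dvd b * j" using b by (simp add: prime_dvd_mult_iff[OF prime] not_dvd_small)
      then have "0 < r j" by (simp add: r_def dvd_eq_mod_eq_0)
      then show "x \<in> {1..<p}" using j p_pos by (simp add: r_def)
    qed
    then show "r ` {1..<p} = {1..<p}" using inj by (intro card_subset_eq) (simp_all add: card_image)
  qed
  have rpos: "r j \<in> {1..<p}" if "j \<in> {1..<p}" for j using bij that by (auto simp: bij_betw_def)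
  have split: "of_nat (b * j) = (of_nat (r j) * (1 + of_nat p * (of_nat (t j) / of_nat (r j))) :: rat)" if "j \<in> {1..<p}" for j
  proof -
    have "b * j = r j + p * t j" by (simp add: r_def t_def)
    then have "of_nat (b * j) = (of_nat (r j) + of_nat p * of_nat (t j) :: rat)" by (metis of_nat_add of_nat_mult)
    then show ?thesis using rpos[OF that] by (simp add: field_simps)
  qed
  define P :: rat where "P = (\<Prod>j\<in>{1..<p}. of_nat j)"
  have P0: "P \<noteq> 0" by (auto simp: P_def)
  have "of_nat b ^ (p - 1) * P = (\<Prod>j\<in>{1..<p}. of_nat (b * j))"
    by (simp add: P_def prod.distrib)
  also have "\<dots> = (\<Prod>j\<in>{1..<p}. of_nat (r j)) * (\<Prod>j\<in>{1..<p}. 1 + of_nat p * (of_nat (t j) / of_nat (r j)))"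
    unfolding prod.distrib[symmetric] by (rule prod.cong) (auto simp only: split)
  also have "(\<Prod>j\<in>{1..<p}. of_nat (r j)) = P"
    unfolding P_def by (rule prod.reindex_bij_betw[OF bij])
  finally have eq: "1 + of_nat p * fermat_quotient b = (\<Prod>j\<in>{1..<p}. 1 + of_nat p * (of_nat (t j) / of_nat (r j)))"
    unfolding power_fermat_quotient using P0 by (metis mult.commute mult_left_cancel)
  have "pcong 2 (\<Prod>j\<in>{1..<p}. 1 + of_nat p * (of_nat (t j) / of_nat (r j)))
    (1 + of_nat p * (\<Sum>j\<in>{1..<p}. of_nat (t j) / of_nat (r j)))"
  proof (rule pcong_prod_one_plus)
    fix j assume "j \<in> {1..<p}"
    from rpos[OF this] show "of_nat (t j) / of_nat (r j) \<in> localization p"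
      by (intro localization_divide_nat not_dvd_small) auto
  qed simp
  from pcong_diff[OF this pcong_refl[of 2 1]]
  have "pcong 2 (of_nat p * fermat_quotient b) (of_nat p * (\<Sum>j\<in>{1..<p}. of_nat (t j) / of_nat (r j)))"
    unfolding eq[symmetric] by simp
  then have "pcong 1 (fermat_quotient b) (\<Sum>j\<in>{1..<p}. of_nat (t j) / of_nat (r j))" by (rule pcong_cancel_p)
  then have "pcong 1 (of_nat b * fermat_quotient b) (of_nat b * (\<Sum>j\<in>{1..<p}. of_nat (t j) / of_nat (r j)))"
    by (intro pcong_scale) auto
  \<comment> \<open>Since \<open>b j = r j\<close> modulo \<open>p\<close>, the quotient
    \<open>b / r j\<close> may be replaced by \<open>1 / j\<close>.\<close>
  also have "pcong 1 \<dots> (\<Sum>j\<in>{1..<p}. of_nat (t j) / of_nat j)"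
    unfolding sum_distrib_left
  proof (rule pcong_sum)
    fix j assume j: "j \<in> {1..<p}"
    have "of_nat b * (of_nat (t j) / of_nat (r j)) - of_nat (t j) / of_nat j
      = (of_nat p ^ 1 * (of_nat (t j) * (of_nat (t j) * (1 / of_nat (r j)) * (1 / of_nat j))) :: rat)"
    proof -
      have "of_nat b * of_nat j = (of_nat (r j) + of_nat p * of_nat (t j) :: rat)"
        using split[OF j] rpos[OF j] by (simp add: field_simps)
      then have "of_nat b * of_nat j * of_nat (t j) = ((of_nat (r j) + of_nat p * of_nat (t j)) * of_nat (t j) :: rat)" by simp
      then show ?thesis using j rpos[OF j] by (simp add: field_simps)
    qed
    moreover have "of_nat (t j) * (of_nat (t j) * (1 / of_nat (r j)) * (1 / of_nat j)) \<in> localization p"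
      by (intro localization_mult localization_of_nat localization_inverse_nat rpos j)
    ultimately show "pcong 1 (of_nat b * (of_nat (t j) / of_nat (r j))) (of_nat (t j) / of_nat j)"
      unfolding pcong_def by blast
  qed
  finally show ?thesis by (simp add: t_def)
qed

text \<open>In \<open>fermat_quotient_sum\<close> the floor of \<open>3 j / p\<close> is 0, 1 or 2
  according to the third in which \<open>j\<close> lies. The sum is thus the full harmonic sum, 0
  modulo \<open>p\<close>, minus its first third plus its last third, and the reflection of
  \<open>j\<close> to \<open>p - j\<close> turns the last third into minus the first.\<close>

lemma fermat_quotient_3:
  assumes "p \<noteq> 3"
  shows "pcong 1 (of_nat 3 * fermat_quotient 3) (- 2 * (\<Sum>i\<in>{1..p div 3}. 1 / of_nat i))"
proof -
  define I where "I = {i \<in> {1..<p}. 3 * i < p}"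
  have nd: "\<not> p dvd 3" using assms ge3 dvd_imp_le[of p 3] by auto
  have three: "\<not> 3 dvd p" using assms prime by (auto simp: prime_nat_iff)
  have I: "I = {1..p div 3}"
  proof (intro equalityI subsetI)
    fix i assume i: "i \<in> {1..p div 3}"
    then have "3 * i \<le> p" by auto
    moreover have "3 * i \<noteq> p" using three by auto
    ultimately show "i \<in> I" using i by (auto simp: I_def)
  qed (auto simp: I_def)
  have filter: "(\<Sum>j\<in>{1..<p}. if 3 * j < p then g j else 0) = (\<Sum>j\<in>I. g j)" for g :: "nat \<Rightarrow> rat"
    unfolding I_def by (rule sum.inter_filter[symmetric]) simp
  have H0: "(\<Sum>j\<in>{1..<p}. of_nat (3 * j div p) / of_nat j)
    = (\<Sum>j\<in>{1..<p}. 1 / of_nat j) - (\<Sum>j\<in>I. 1 / of_nat j) + (\<Sum>j\<in>I. 1 / of_nat (p - j) :: rat)"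
  proof -
    have "3 * j div p = (if 3 * j < p then 0 else if 2 * p < 3 * j then 2 else 1)" if j: "j \<in> {1..<p}" for j
    proof -
      have "3 * j \<noteq> 2 * p"
      proof
        assume "3 * j = 2 * p"
        then have "p = 3 * (p - j)" using j by (simp add: diff_mult_distrib2)
        then show False using three by (metis dvd_triv_left)
      qed
      moreover have "3 * j < 3 * p" using j by simp
      ultimately consider "3 * j < p" | "p \<le> 3 * j" "3 * j < 2 * p" | "2 * p < 3 * j" "3 * j < 3 * p" by linarith
      then show ?thesis
      proof cases
        case 2
        then have "3 * j div p = 1" by (intro div_nat_eqI) auto
        then show ?thesis using 2 by simp
      next
        case 3
        then have "3 * j div p = 2" by (intro div_nat_eqI) auto
        then show ?thesis using 3 by simp
      qed simp
    qed
    then have "(\<Sum>j\<in>{1..<p}. of_nat (3 * j div p) / of_nat j)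
      = (\<Sum>j\<in>{1..<p}. 1 / of_nat j - (if 3 * j < p then 1 / of_nat j else 0)
        + (if 2 * p < 3 * j then 1 / of_nat j else 0) :: rat)"
      by (intro sum.cong refl) auto
    also have "\<dots> = (\<Sum>j\<in>{1..<p}. 1 / of_nat j) - (\<Sum>j\<in>I. 1 / of_nat j)
      + (\<Sum>j\<in>{1..<p}. if 2 * p < 3 * j then 1 / of_nat j else 0)"
      by (simp only: sum.distrib sum_subtractf filter)
    also have "(\<Sum>j\<in>{1..<p}. if 2 * p < 3 * j then 1 / of_nat j else 0 :: rat)
      = (\<Sum>j\<in>{1..<p}. if 2 * p < 3 * (p - j) then 1 / of_nat (p - j) else 0)"
      by (rule sum_inverse_reflect[symmetric])
    also have "\<dots> = (\<Sum>j\<in>{1..<p}. if 3 * j < p then 1 / of_nat (p - j) else 0)"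
      by (intro sum.cong) auto
    also have "\<dots> = (\<Sum>j\<in>I. 1 / of_nat (p - j))"
      by (rule filter)
    finally show ?thesis .
  qed
  have "pcong 1 (of_nat 3 * fermat_quotient 3) (\<Sum>j\<in>{1..<p}. of_nat (3 * j div p) / of_nat j)"
    by (rule fermat_quotient_sum[OF nd])
  also have "pcong 1 \<dots> (0 - (\<Sum>j\<in>I. 1 / of_nat j) + - (\<Sum>j\<in>I. 1 / of_nat j))"
    unfolding H0 by (intro pcong_add pcong_diff harmonic_cong_0 pcong_refl harmonic_reflect) (auto simp: I_def)
  finally show ?thesis unfolding I by simp
qed

end

lemma trinomial_fact: "of_nat (3 * k choose k) * of_nat (2 * k choose k) = fact (3 * k) * ifact (int k)^3"
  using trinomial_ifact[of "3 * k" k] by (simp add: ifact_def)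

context odd_prime
begin

text \<open>With \<open>m = p div 3\<close>, the ratios of consecutive terms are
  \<open>(i + 1/3) (i + 2/3) / (i + 1)^2\<close> on the left and
  \<open>(i - m) (i + m + 1) / (i + 1)^2\<close> on the right. As \<open>p\<close> is
  \<open>3 m + 1\<close> or \<open>3 m + 2\<close>, the numbers \<open>- m\<close> and
  \<open>m + 1\<close> are \<open>1/3\<close> and \<open>2/3\<close> modulo \<open>p\<close> in some
  order.\<close>

lemma trinomial_cong:
  assumes "p \<noteq> 3" "i \<le> p div 3"
  shows "pcong 1 (of_nat (3 * i choose i) * of_nat (2 * i choose i) / 27 ^ i)
    ((- 1) ^ i * of_nat ((p div 3 choose i) * (p div 3 + i choose i)))"
  using assms(2)
proof (induction i)
  case (Suc i)
  define m where "m = p div 3"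
  define X where "X i = (of_nat (3 * i choose i) * of_nat (2 * i choose i) / 27 ^ i :: rat)" for i
  define Y where "Y i = ((- 1) ^ i * of_nat ((m choose i) * (m + i choose i)) :: rat)" for i
  have X: "of_int (9 * (int i + 1)^2) * X (Suc i) = of_nat ((3 * i + 1) * (3 * i + 2)) * X i"
  proof -
    have f: "fact (3 * Suc i) = 3 * (of_nat i + 1) * ((3 * of_nat i + 2) * ((3 * of_nat i + 1) * (fact (3 * i) :: rat)))"
    proof -
      have "3 * Suc i = Suc (Suc (Suc (3 * i)))" by simp
      then show ?thesis by (simp only: fact_Suc) (simp add: algebra_simps)
    qed
    show ?thesis unfolding X_def trinomial_fact f index_shift(1)[of i]
      by (simp add: field_simps power2_eq_square power3_eq_cube)
  qed
  have Y: "of_int (9 * (int i + 1)^2) * Y (Suc i) = of_int (- (3 * int m - 3 * int i) * (3 * int m + 3 * int i + 3)) * Y i"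
  proof -
    have f: "fact (m + Suc i) = (of_nat m + of_nat i + 1) * (fact (m + i) :: rat)" by (simp add: algebra_simps)
    have idx: "int m - int (Suc i) = int m - int i - 1" by simp
    show ?thesis unfolding Y_def of_nat_mult binomial_mult_binomial_add f idx ifact_rec index_shift(1)[of i]
      by (simp add: algebra_simps power2_eq_square)
  qed
  obtain s where s: "p = 3 * m + s" "s = 1 \<or> s = 2"
  proof -
    have "\<not> 3 dvd p" using assms prime by (auto simp: prime_nat_iff)
    then have "p mod 3 \<noteq> 0" by (simp add: dvd_eq_mod_eq_0)
    then have "p mod 3 = 1 \<or> p mod 3 = 2" by linarith
    then show ?thesis using that[of "p mod 3"] by (simp add: m_def)
  qed
  have coeff: "[- (3 * int m - 3 * int i) * (3 * int m + 3 * int i + 3) = int ((3 * i + 1) * (3 * i + 2))] (mod int p ^ 1)"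
  proof -
    have m: "3 * int m = int p - int s" using s by simp
    have "- (3 * int m - 3 * int i) * (3 * int m + 3 * int i + 3) - int ((3 * i + 1) * (3 * i + 2))
      = int p * (- int p + 2 * int s - 3)" using s(2) unfolding m by (auto simp: algebra_simps)
    then show ?thesis unfolding cong_iff_dvd_diff by simp
  qed
  have locX: "X i \<in> localization p"
  proof -
    have "\<not> p dvd 27 ^ i"
    proof
      assume "p dvd 27 ^ i"
      then have "p dvd 3 ^ (3 * i)" by (simp add: power_mult)
      then have "p dvd 3" using prime prime_dvd_power by blast
      then show False using assms ge3 dvd_imp_le[of p 3] by auto
    qed
    then show ?thesis unfolding X_def using localization_divide_nat[of "of_nat (3 * i choose i) * of_nat (2 * i choose i)" "27 ^ i"]
      by (simp add: localization_mult)
  qed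
  have "pcong 1 (of_int (9 * (int i + 1)^2) * X (Suc i)) (of_int (9 * (int i + 1)^2) * Y (Suc i))"
    unfolding X Y
  proof (rule pcong_mult)
    show "pcong 1 (of_nat ((3 * i + 1) * (3 * i + 2))) (of_int (- (3 * int m - 3 * int i) * (3 * int m + 3 * int i + 3)))"
      using cong_sym[OF coeff] by (rule pcong_of_nat_int)
    show "pcong 1 (X i) (Y i)" using Suc by (simp add: X_def Y_def m_def)
    show "Y i \<in> localization p" unfolding Y_def by (intro localization_mult) auto
    show "of_nat ((3 * i + 1) * (3 * i + 2)) \<in> localization p" by (rule localization_of_nat)
  qed
  moreover have "\<not> int p dvd 9 * (int i + 1)^2"
  proof -
    have "\<not> p dvd 3" using assms ge3 dvd_imp_le[of p 3] by auto
    moreover have "\<not> p dvd i + 1" using Suc.prems ge3 by (intro not_dvd_small) auto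
    ultimately have "\<not> p dvd 3 * 3 * (i + 1)^2" using prime by (simp only: prime_dvd_mult_iff prime_dvd_power_iff) simp
    then have "\<not> int p dvd int (3 * 3 * (i + 1)^2)" by (simp only: of_nat_dvd_iff not_False_eq_True)
    then show ?thesis by (simp add: add.commute)
  qed
  ultimately have "pcong 1 (X (Suc i)) (Y (Suc i))" by (rule pcong_cancel)
  then show ?case by (simp only: X_def Y_def m_def)
qed simp

text \<open>The hypothesis \<open>quotient\<close> of \<open>super_weighted_sum\<close> for
  \<open>c = d = 3\<close>: \<open>trinomial_cong\<close> leads to the Legendre coefficients, these
  to a harmonic number, and that to the Fermat quotient.\<close>

lemma trinomial_quotient:
  assumes "p \<noteq> 3"
  shows "pcong 1 (\<Sum>i\<in>{1..<p}. if 3 * i < p then of_nat (3 * i choose i) * of_nat (2 * i choose i) / (of_nat (3 * i) * of_nat 3 ^ (3 * i)) else 0)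
    (fermat_quotient 3)"
proof -
  have nd: "\<not> p dvd 3" using assms ge3 dvd_imp_le[of p 3] by auto
  have three: "\<not> 3 dvd p" using assms prime by (auto simp: prime_nat_iff)
  have I: "{i \<in> {1..<p}. 3 * i < p} = {1..p div 3}"
  proof (intro equalityI subsetI)
    fix i assume i: "i \<in> {1..p div 3}"
    then have "3 * i \<le> p" by auto
    moreover have "3 * i \<noteq> p" using three by auto
    ultimately show "i \<in> {i \<in> {1..<p}. 3 * i < p}" using i by auto
  qed auto
  define g where "g i = (of_nat (3 * i choose i) * of_nat (2 * i choose i) / (of_nat (3 * i) * of_nat 3 ^ (3 * i)) :: rat)" for i
  have "(\<Sum>i\<in>{1..<p}. if 3 * i < p then g i else 0) = (\<Sum>i\<in>{i \<in> {1..<p}. 3 * i < p}. g i)"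
    by (rule sum.inter_filter[symmetric]) simp
  then have "of_nat 3 * (\<Sum>i\<in>{1..<p}. if 3 * i < p then g i else 0) = (\<Sum>i\<in>{1..p div 3}. of_nat 3 * g i)"
    unfolding I by (simp only: sum_distrib_left)
  also have "\<dots> = (\<Sum>i\<in>{1..p div 3}. of_nat (3 * i choose i) * of_nat (2 * i choose i) / 27 ^ i / of_nat i)"
  proof (rule sum.cong)
    fix i
    have "(of_nat 3 :: rat) ^ (3 * i) = 27 ^ i" by (simp add: power_mult)
    then show "of_nat 3 * g i = of_nat (3 * i choose i) * of_nat (2 * i choose i) / 27 ^ i / of_nat i"
      unfolding g_def by simp
  qed simp
  also have "pcong 1 \<dots> (\<Sum>i\<in>{1..p div 3}. (- 1) ^ i * of_nat ((p div 3 choose i) * (p div 3 + i choose i)) / of_nat i)"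
    using assms by (intro pcong_sum pcong_divide_nat trinomial_cong not_dvd_small) auto
  also have "\<dots> = - 2 * (\<Sum>k\<in>{1..p div 3}. 1 / of_nat k)" by (rule sum_binomial_mult_harmonic)
  also have "pcong 1 \<dots> (of_nat 3 * fermat_quotient 3)" by (rule pcong_sym[OF fermat_quotient_3[OF assms]])
  finally have "pcong 1 (of_int (int 3) * (\<Sum>i\<in>{1..<p}. if 3 * i < p then g i else 0)) (of_int (int 3) * fermat_quotient 3)"
    by (simp only: of_int_of_nat_eq)
  moreover have "\<not> int p dvd int 3" using nd by (simp only: of_nat_dvd_iff not_False_eq_True)
  ultimately show ?thesis unfolding g_def by (rule pcong_cancel)
qed

end

section \<open>Binomial sums over Franel numbers, and the quotient of 8\<close>

lemma coeff_linear_power_one: "coeff ([:1, a:] ^ n) i = of_nat (n choose i) * (a :: rat) ^ i"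
proof (cases "i \<le> n")
  case False
  have "degree ([:1, a:] ^ n) \<le> degree [:1, a:] * n" by (rule degree_power_le)
  also have "\<dots> \<le> 1 * n" by (intro mult_le_mono1) simp
  finally show ?thesis using False by (simp add: coeff_eq_0 binomial_eq_0)
qed (simp add: coeff_linear_poly_power)

text \<open>Rests on \<open>(m + 1 choose r) / r = (m choose r) / r + (m + 1 choose r) / (m +
  1)\<close>. The division by \<open>r\<close> inside a binomial sum is traded for an outer division
  by \<open>s\<close>, and the inner sum becomes open to closed evaluation.\<close>

lemma sum_binomial_div:
  fixes z :: "nat \<Rightarrow> rat"
  shows "(\<Sum>r\<in>{1..m}. of_nat (m choose r) * z r / of_nat r)
    = (\<Sum>s\<in>{1..m}. (\<Sum>r\<in>{1..s}. of_nat (s choose r) * z r) / of_nat s)"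
proof (induction m)
  case (Suc m)
  have step: "of_nat (Suc m choose r) * z r / of_nat r
    = of_nat (m choose r) * z r / of_nat r + of_nat (Suc m choose r) * z r / of_nat (Suc m)" if mem: "r \<in> {1..Suc m}" for r
  proof -
    obtain q where r: "r = Suc q" using mem by (cases r) auto
    have "of_nat (Suc m choose r) = (of_nat (m choose q) + of_nat (m choose r) :: rat)" by (simp add: r)
    then have e1: "of_nat (Suc m choose r) / of_nat r = (of_nat (m choose r) / of_nat r + of_nat (m choose q) / of_nat r :: rat)"
      by (simp add: add_divide_distrib)
    have "of_nat r * of_nat (Suc m choose r) = (of_nat (Suc m) * of_nat (m choose q) :: rat)"
      unfolding r using Suc_times_binomial[of q m] by (metis of_nat_mult)
    then have "of_nat (m choose q) / of_nat r = (of_nat (Suc m choose r) / of_nat (Suc m) :: rat)"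
      using mem by (simp add: frac_eq_eq mult.commute del: of_nat_Suc binomial_Suc_Suc)
    with e1 have "of_nat (Suc m choose r) / of_nat r = (of_nat (m choose r) / of_nat r + of_nat (Suc m choose r) / of_nat (Suc m) :: rat)"
      by (simp only:)
    from arg_cong[OF this, of "\<lambda>w. w * z r"] show ?thesis by (simp add: distrib_right del: of_nat_Suc binomial_Suc_Suc)
  qed
  have "(\<Sum>r\<in>{1..Suc m}. of_nat (Suc m choose r) * z r / of_nat r)
    = (\<Sum>r\<in>{1..Suc m}. of_nat (m choose r) * z r / of_nat r)
      + (\<Sum>r\<in>{1..Suc m}. of_nat (Suc m choose r) * z r / of_nat (Suc m))"
    unfolding sum.distrib[symmetric] by (rule sum.cong[OF refl step])
  also have "(\<Sum>r\<in>{1..Suc m}. of_nat (m choose r) * z r / of_nat r) = (\<Sum>r\<in>{1..m}. of_nat (m choose r) * z r / of_nat r)"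
    by (simp add: binomial_eq_0)
  finally show ?case
    using Suc by (simp add: sum_divide_distrib del: of_nat_Suc binomial_Suc_Suc)
qed simp

text \<open>The coefficient of \<open>s\<^sup>j\<close> in \<open>(1 + s)\<^bsup>j-1\<^esup> (1 + 9 s)\<^sup>j\<close>; as \<open>s - (1 + s) (1 + 9 s) / 16 = - (1 - 3 s)\<^sup>2 / 16\<close>,
  the binomial sums of these coefficients collapse.\<close>

definition franel_coeff :: "nat \<Rightarrow> rat" where
  "franel_coeff j = coeff ([:1, 1:] ^ (j - 1) * [:1, 9:] ^ j) j"

lemma franel_coeff_alt: "franel_coeff j = (\<Sum>r\<le>j. of_nat ((j - 1 choose r) * (j choose r)) * 9 ^ (j - r))"
proof -
  have "franel_coeff j = (\<Sum>r\<le>j. coeff ([:1, 1:] ^ (j - 1)) r * coeff ([:1, 9:] ^ j) (j - r))"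
    by (simp add: franel_coeff_def coeff_mult)
  also have "\<dots> = (\<Sum>r\<le>j. of_nat ((j - 1 choose r) * (j choose r)) * 9 ^ (j - r))"
    by (rule sum.cong) (auto simp: coeff_linear_power_one binomial_symmetric[symmetric])
  finally show ?thesis .
qed

text \<open>Vandermonde expands \<open>j + l - 1 choose l\<close> into products
  \<open>(j - 1 choose r) (l choose r)\<close>; the sum over \<open>l\<close> is then the binomial
  expansion of \<open>(1 + 8)^(j - r)\<close>, the origin of the 9 in
  \<open>franel_coeff\<close>.\<close>

lemma sum_binomial_eighths:
  assumes "0 < j"
  shows "(\<Sum>l\<le>j. of_nat ((j + l - 1 choose l) * (j choose l)) / 8 ^ l) = franel_coeff j / (8 ^ j :: rat)"
proof -
  have vm: "(j + l - 1 choose l) = (\<Sum>r\<le>j. (j - 1 choose r) * (l choose r))" if "l \<le> j" for l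
  proof -
    have "(j + l - 1 choose l) = ((j - 1) + l choose l)" using assms by simp
    also have "\<dots> = (\<Sum>r\<le>l. (j - 1 choose r) * (l choose (l - r)))" by (rule vandermonde[symmetric])
    also have "\<dots> = (\<Sum>r\<le>l. (j - 1 choose r) * (l choose r))"
      by (rule sum.cong) (auto simp: binomial_symmetric[symmetric])
    also have "\<dots> = (\<Sum>r\<le>j. (j - 1 choose r) * (l choose r))"
      using that by (intro sum.mono_neutral_left) (auto simp: binomial_eq_0)
    finally show ?thesis .
  qed
  have inner: "(\<Sum>l\<le>j. of_nat ((l choose r) * (j choose l)) / 8 ^ l) = (of_nat (j choose r) * 9 ^ (j - r) / 8 ^ j :: rat)" if r: "r \<le> j" for r
  proof -
    have "(\<Sum>l\<le>j. of_nat ((l choose r) * (j choose l)) / 8 ^ l)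
      = (\<Sum>l\<in>{r..j}. of_nat ((l choose r) * (j choose l)) / 8 ^ l :: rat)"
      by (intro sum.mono_neutral_right) (auto simp: binomial_eq_0)
    also have "\<dots> = (\<Sum>k\<le>j - r. of_nat (j choose r) * of_nat (j - r choose k) * 1 ^ k * 8 ^ (j - r - k) / 8 ^ j)"
      by (rule sum.reindex_bij_witness[of _ "\<lambda>k. k + r" "\<lambda>l. l - r"])
    (use r in \<open>auto simp: choose_mult[symmetric] power_diff field_simps power_add mult.commute simp flip: of_nat_mult\<close>)
    also have "\<dots> = of_nat (j choose r) * (\<Sum>k\<le>j - r. of_nat (j - r choose k) * 1 ^ k * 8 ^ (j - r - k)) / 8 ^ j"
      by (simp add: sum_distrib_left sum_divide_distrib mult.assoc)
    also have "(\<Sum>k\<le>j - r. of_nat (j - r choose k) * 1 ^ k * 8 ^ (j - r - k)) = (1 + 8 :: rat) ^ (j - r)"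
      by (rule binomial_ring[symmetric])
    finally show ?thesis by simp
  qed
  have "(\<Sum>l\<le>j. of_nat ((j + l - 1 choose l) * (j choose l)) / 8 ^ l)
    = (\<Sum>l\<le>j. \<Sum>r\<le>j. of_nat (j - 1 choose r) * (of_nat ((l choose r) * (j choose l)) / 8 ^ l) :: rat)"
  proof (rule sum.cong)
    fix l assume "l \<in> {..j}"
    then have "(j + l - 1 choose l) * (j choose l) = (\<Sum>r\<le>j. (j - 1 choose r) * ((l choose r) * (j choose l)))"
      by (simp only: vm atMost_iff sum_distrib_right mult.assoc)
    then show "of_nat ((j + l - 1 choose l) * (j choose l)) / 8 ^ l
      = (\<Sum>r\<le>j. of_nat (j - 1 choose r) * (of_nat ((l choose r) * (j choose l)) / 8 ^ l) :: rat)"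
      by (simp add: sum_divide_distrib)
  qed simp
  also have "\<dots> = (\<Sum>r\<le>j. of_nat (j - 1 choose r) * (\<Sum>l\<le>j. of_nat ((l choose r) * (j choose l)) / 8 ^ l))"
    by (subst sum.swap) (simp add: sum_distrib_left)
  also have "\<dots> = (\<Sum>r\<le>j. of_nat (j - 1 choose r) * (of_nat (j choose r) * 9 ^ (j - r) / 8 ^ j))"
    by (rule sum.cong) (simp_all only: inner atMost_iff)
  also have "\<dots> = franel_coeff j / 8 ^ j" by (simp add: franel_coeff_alt sum_divide_distrib mult.assoc)
  finally show ?thesis .
qed

text \<open>Multiplying term \<open>i\<close> by the monomial of degree \<open>n - i\<close> lets
  all coefficients be read off at the same degree \<open>n + 1\<close>; the sum is then the binomial
  expansion of an \<open>n\<close>-th power.\<close>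

lemma binomial_sum_franel_coeff:
  "(\<Sum>i\<le>n. of_nat (n choose i) * (- 1 / 16) ^ Suc i * franel_coeff (Suc i))
    = (- 1 / 16) ^ Suc n * coeff ([:1, 9:] * [:1, - 3:] ^ (2 * n)) (Suc n)"
proof -
  define P :: "rat poly" where "P = [:1, 1:] * [:1, 9:]"
  define c :: rat where "c = - 1 / 16"
  have base: "smult c P + [:0, 1:] = smult c ([:1, - 3:] ^ 2)"
    by (simp add: P_def c_def power2_eq_square)
  have "smult c [:1, 9:] * (smult c P + [:0, 1:]) ^ n
    = (\<Sum>i\<le>n. of_nat (n choose i) * (smult c [:1, 9:] * (smult c P) ^ i * [:0, 1:] ^ (n - i)))"
    by (simp only: binomial_ring sum_distrib_left mult_ac)
  then have "coeff (smult c [:1, 9:] * smult c ([:1, - 3:] ^ 2) ^ n) (Suc n)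
    = (\<Sum>i\<le>n. coeff (of_nat (n choose i) * (smult c [:1, 9:] * (smult c P) ^ i * [:0, 1:] ^ (n - i))) (Suc n))"
    unfolding base by (simp only: coeff_sum)
  also have "\<dots> = (\<Sum>i\<le>n. of_nat (n choose i) * c ^ Suc i * franel_coeff (Suc i))"
  proof (rule sum.cong)
    fix i assume i: "i \<in> {..n}"
    have X: "[:0, 1:] ^ k = (monom 1 k :: rat poly)" for k by (simp add: monom_altdef)
    have k: "of_nat k * q = smult (of_nat k) q" for k and q :: "rat poly" by (simp add: of_nat_poly)
    have "of_nat (n choose i) * (smult c [:1, 9:] * (smult c P) ^ i * [:0, 1:] ^ (n - i))
      = monom 1 (n - i) * (smult (of_nat (n choose i) * c ^ Suc i) ([:1, 1:] ^ i * [:1, 9:] ^ Suc i))"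
      unfolding P_def smult_power power_mult_distrib X k power_Suc
      by (simp only: mult_smult_left mult_smult_right smult_smult mult_ac)
    then have "coeff (of_nat (n choose i) * (smult c [:1, 9:] * (smult c P) ^ i * [:0, 1:] ^ (n - i))) (Suc n)
      = of_nat (n choose i) * c ^ Suc i * coeff ([:1, 1:] ^ i * [:1, 9:] ^ Suc i) (Suc i)"
      using i by (simp only: coeff_monom_mult coeff_smult) (simp add: Suc_diff_le)
    then show "coeff (of_nat (n choose i) * (smult c [:1, 9:] * (smult c P) ^ i * [:0, 1:] ^ (n - i))) (Suc n)
      = of_nat (n choose i) * c ^ Suc i * franel_coeff (Suc i)"
      by (simp add: franel_coeff_def)
  qed simp
  also have "coeff (smult c [:1, 9:] * smult c ([:1, - 3:] ^ 2) ^ n) (Suc n)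
    = c ^ Suc n * coeff ([:1, 9:] * [:1, - 3:] ^ (2 * n)) (Suc n)"
    unfolding power_mult[of "[:1, - 3:]" 2 n]
    by (simp only: smult_power mult_smult_left mult_smult_right smult_smult coeff_smult power_Suc mult_ac)
  finally show ?thesis by (simp add: c_def)
qed

text \<open>What the factor \<open>(- 1 / 16)^n\<close> leaves of the middle coefficient
  \<open>(- 3)^n (2 n choose n)\<close> of \<open>(1 - 3 s)^(2 n)\<close>.\<close>

definition scaled_central :: "nat \<Rightarrow> rat" where
  "scaled_central n = (3 / 16) ^ n * of_nat (2 * n choose n)"

lemma binomial_sum_franel_coeff_closed:
  "(\<Sum>i\<le>n. of_nat (n choose i) * (- 1 / 16) ^ Suc i * franel_coeff (Suc i))
    = scaled_central (Suc n) / 2 - 3 / 4 * scaled_central n"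
proof -
  have s: "(- 1 / 16 :: rat) ^ n * (- 3) ^ n = (3 / 16) ^ n" by (simp flip: power_mult_distrib)
  have "[:1, 9:] = [:1:] + (monom 9 1 :: rat poly)" by (simp add: monom_altdef)
  then have "coeff ([:1, 9:] * [:1, - 3:] ^ (2 * n)) (Suc n)
    = coeff ([:1, - 3:] ^ (2 * n)) (Suc n) + 9 * coeff ([:1, - 3 :: rat:] ^ (2 * n)) n"
    by (simp add: distrib_right coeff_monom_mult one_pCons[symmetric])
  also have "\<dots> = of_nat (2 * n choose Suc n) * (- 3) ^ Suc n + 9 * (of_nat (2 * n choose n) * (- 3) ^ n)"
    by (simp only: coeff_linear_power_one)
  finally have coeff: "coeff ([:1, 9:] * [:1, - 3:] ^ (2 * n)) (Suc n)
    = of_nat (2 * n choose Suc n) * (- 3) ^ Suc n + 9 * (of_nat (2 * n choose n) * (- 3 :: rat) ^ n)" .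
  have "(\<Sum>i\<le>n. of_nat (n choose i) * (- 1 / 16) ^ Suc i * franel_coeff (Suc i))
    = (- 1 / 16) * ((- 1 / 16) ^ n * (- 3) ^ n) * (of_nat (2 * n choose Suc n) * (- 3) + 9 * of_nat (2 * n choose n))"
    unfolding binomial_sum_franel_coeff coeff unfolding power_Suc by (simp only: distrib_left mult_ac)
  also have "\<dots> = (3 / 16) ^ n * (3 / 16) * (of_nat (2 * n choose Suc n) - 3 * of_nat (2 * n choose n))"
    unfolding s by (simp add: algebra_simps)
  \<comment> \<open>By Pascal's rule and symmetry, the coefficient next to the middle is half of the
    following central coefficient minus the present one.\<close>
  also have "(of_nat (2 * n choose Suc n) :: rat) = of_nat (2 * Suc n choose Suc n) / 2 - of_nat (2 * n choose n)"
  proof -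
    have "Suc (2 * n) choose n = Suc (2 * n) choose Suc n"
      using binomial_symmetric[of n "Suc (2 * n)"] by simp
    then have "(2 * Suc n choose Suc n) = 2 * ((2 * n choose n) + (2 * n choose Suc n))" by simp
    then show ?thesis by (simp add: add_divide_distrib del: binomial_Suc_Suc mult_Suc_right)
  qed
  finally show ?thesis by (simp add: scaled_central_def algebra_simps del: binomial_Suc_Suc mult_Suc_right)
qed

text \<open>By Pascal's rule the increment from \<open>r\<close> to \<open>r + 1\<close> is the sum
  of the preceding lemma; adding up the increments creates the partial sums of
  \<open>scaled_central\<close>.\<close>

lemma binomial_sum_franel_coeff_all:
  "(\<Sum>j\<in>{1..r}. of_nat (r choose j) * ((- 1 / 16) ^ j * franel_coeff j))
    = 3 / 4 * scaled_central r - (\<Sum>s\<le>r. scaled_central s) / 4 - 1 / 2"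
proof (induction r)
  case 0
  then show ?case by (simp add: scaled_central_def)
next
  case (Suc r)
  define z where "z j = (- 1 / 16) ^ j * franel_coeff j" for j
  have "(\<Sum>j\<in>{1..Suc r}. of_nat (Suc r choose j) * z j) = (\<Sum>i\<le>r. of_nat (Suc r choose Suc i) * z (Suc i))"
    unfolding One_nat_def sum.atLeast_Suc_atMost_Suc_shift by (simp add: atLeast0AtMost)
  also have "\<dots> = (\<Sum>i\<le>r. of_nat (r choose i) * z (Suc i)) + (\<Sum>i\<le>r. of_nat (r choose Suc i) * z (Suc i))"
    by (simp add: sum.distrib distrib_right)
  also have "(\<Sum>i\<le>r. of_nat (r choose Suc i) * z (Suc i)) = (\<Sum>j\<in>{1..Suc r}. of_nat (r choose j) * z j)"
    unfolding One_nat_def sum.atLeast_Suc_atMost_Suc_shift by (simp add: atLeast0AtMost)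
  also have "\<dots> = (\<Sum>j\<in>{1..r}. of_nat (r choose j) * z j)" by (simp add: binomial_eq_0)
  also have "(\<Sum>i\<le>r. of_nat (r choose i) * z (Suc i)) = scaled_central (Suc r) / 2 - 3 / 4 * scaled_central r"
    unfolding z_def binomial_sum_franel_coeff_closed[symmetric] by (simp only: mult.assoc)
  also have "(\<Sum>j\<in>{1..r}. of_nat (r choose j) * z j)
    = 3 / 4 * scaled_central r - (\<Sum>s\<le>r. scaled_central s) / 4 - 1 / 2"
    using Suc by (simp only: z_def)
  finally show ?case unfolding z_def[symmetric] sum.atMost_Suc by (simp only:) (simp add: field_simps)
qed

lemma sum_binomial_power_div:
  fixes y :: rat
  shows "(\<Sum>r\<in>{1..m}. of_nat (m choose r) * y ^ r / of_nat r) = (\<Sum>s\<in>{1..m}. ((1 + y) ^ s - 1) / of_nat s)"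
proof -
  have "(\<Sum>r\<in>{1..s}. of_nat (s choose r) * y ^ r) = (1 + y) ^ s - 1" for s
  proof -
    have "(1 + y) ^ s = (\<Sum>r\<le>s. of_nat (s choose r) * y ^ r)"
      using binomial_ring[of y 1 s] by (simp add: add.commute)
    also have "{..s} = insert 0 {1..s}" by auto
    finally show ?thesis by simp
  qed
  then show ?thesis by (simp only: sum_binomial_div[of m "\<lambda>r. y ^ r"])
qed

text \<open>Handles the image of the partial sums of \<open>scaled_central\<close> modulo
  \<open>p\<close>. For the truncated expansion \<open>P m r\<close> one has
  \<open>P (m + 1) r = (1 + y) P m r - y (m choose r) y^r\<close>, which leads back to the complete
  expansion at \<open>r = m + 1\<close> and to \<open>sum_binomial_power_div\<close>.\<close>

lemma sum_binomial_partial_power_div: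
  fixes y :: rat
  shows "(\<Sum>r\<in>{1..m}. (\<Sum>s\<le>r. of_nat (m choose s) * y ^ s) / of_nat r)
    = (\<Sum>k\<in>{1..m}. (1 + y) ^ (m - k) / of_nat k) + (\<Sum>s\<in>{1..m}. ((1 + y) ^ s - 1) / of_nat s)"
proof (induction m)
  case (Suc m)
  define P where "P m r = (\<Sum>s\<le>r. of_nat (m choose s) * y ^ s)" for m r
  have step: "P (Suc m) r = (1 + y) * P m r - y * (of_nat (m choose r) * y ^ r)" for r
    unfolding P_def by (induction r) (simp_all add: algebra_simps)
  have full: "P m (Suc m) = (1 + y) ^ m"
    using binomial_ring[of y 1 m] by (simp add: P_def add.commute binomial_eq_0)
  have "(\<Sum>r\<in>{1..Suc m}. P (Suc m) r / of_nat r)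
    = (1 + y) * (\<Sum>r\<in>{1..Suc m}. P m r / of_nat r) - y * (\<Sum>r\<in>{1..Suc m}. of_nat (m choose r) * y ^ r / of_nat r)"
    unfolding step by (simp add: sum_subtractf sum_distrib_left diff_divide_distrib del: of_nat_Suc sum.cl_ivl_Suc)
  also have "(\<Sum>r\<in>{1..Suc m}. P m r / of_nat r) = (\<Sum>r\<in>{1..m}. P m r / of_nat r) + (1 + y) ^ m / of_nat (Suc m)"
    by (simp add: full)
  also have "(\<Sum>r\<in>{1..Suc m}. of_nat (m choose r) * y ^ r / of_nat r) = (\<Sum>s\<in>{1..m}. ((1 + y) ^ s - 1) / of_nat s)"
    unfolding sum_binomial_power_div[symmetric] by (simp add: binomial_eq_0)
  also have "(\<Sum>r\<in>{1..m}. P m r / of_nat r)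
    = (\<Sum>k\<in>{1..m}. (1 + y) ^ (m - k) / of_nat k) + (\<Sum>s\<in>{1..m}. ((1 + y) ^ s - 1) / of_nat s)"
    using Suc by (simp add: P_def)
  finally have "(\<Sum>r\<in>{1..Suc m}. P (Suc m) r / of_nat r)
    = (1 + y) * (\<Sum>k\<in>{1..m}. (1 + y) ^ (m - k) / of_nat k) + (\<Sum>s\<in>{1..m}. ((1 + y) ^ s - 1) / of_nat s)
      + (1 + y) ^ Suc m / of_nat (Suc m)"
    by (simp add: algebra_simps)
  moreover have "(\<Sum>k\<in>{1..Suc m}. (1 + y) ^ (Suc m - k) / of_nat k)
    = (1 + y) * (\<Sum>k\<in>{1..m}. (1 + y) ^ (m - k) / of_nat k) + 1 / of_nat (Suc m)"
  proof -
    have "(\<Sum>k\<in>{1..m}. (1 + y) ^ (Suc m - k) / of_nat k) = (\<Sum>k\<in>{1..m}. (1 + y) * ((1 + y) ^ (m - k) / of_nat k))"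
      by (rule sum.cong) (auto simp: Suc_diff_le)
    then show ?thesis by (simp add: sum_distrib_left)
  qed
  ultimately show ?case by (simp add: P_def diff_divide_distrib)
qed simp

context odd_prime
begin

text \<open>Exactly, \<open>2 s choose s\<close> is \<open>(- 4)^s\<close> times the generalized
  coefficient of \<open>- 1/2\<close> over \<open>s\<close>, and \<open>- 1/2\<close> is
  \<open>m\<close> modulo \<open>p = 2 m + 1\<close>; the proof compares ratios of consecutive
  terms.\<close>

lemma central_binomial_cong:
  assumes m: "p = 2 * m + 1" and "s \<le> m"
  shows "pcong 1 (of_nat (2 * s choose s)) ((- 4) ^ s * of_nat (m choose s))"
  using assms(2)
proof (induction s)
  case (Suc s)
  define X where "X s = (of_nat (2 * s choose s) :: rat)" for s
  define Y where "Y s = ((- 4) ^ s * of_nat (m choose s) :: rat)" for s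
  have X: "of_int (int s + 1) * X (Suc s) = of_nat (2 * (2 * s + 1)) * X s"
    unfolding X_def central_binomial_fact index_shift(4) index_shift(1)[of s]
    by (simp add: algebra_simps power2_eq_square)
  have Y: "of_int (int s + 1) * Y (Suc s) = of_int (- 4 * (int m - int s)) * Y s"
  proof -
    have idx: "int m - int (Suc s) = int m - int s - 1" by simp
    show ?thesis unfolding Y_def of_nat_binomial_ifact idx ifact_rec index_shift(1)[of s]
      by (simp add: algebra_simps)
  qed
  have coeff: "[- 4 * (int m - int s) = int (2 * (2 * s + 1))] (mod int p ^ 1)"
  proof -
    have "- 4 * (int m - int s) - int (2 * (2 * s + 1)) = int p * (- 2)" unfolding m by simp
    then show ?thesis unfolding cong_iff_dvd_diff by simp
  qed
  have "pcong 1 (of_int (int s + 1) * X (Suc s)) (of_int (int s + 1) * Y (Suc s))"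
    unfolding X Y
  proof (rule pcong_mult)
    show "pcong 1 (of_nat (2 * (2 * s + 1))) (of_int (- 4 * (int m - int s)))"
      using cong_sym[OF coeff] by (rule pcong_of_nat_int)
    show "pcong 1 (X s) (Y s)" using Suc by (simp add: X_def Y_def)
    show "Y s \<in> localization p"
      using localization_of_int[of "(- 4) ^ s * int (m choose s)"] unfolding Y_def by simp
    show "of_nat (2 * (2 * s + 1)) \<in> localization p" by (rule localization_of_nat)
  qed
  moreover have "\<not> int p dvd int s + 1"
    using Suc.prems not_dvd_small[of "Suc s"] unfolding m by (metis add.commute int_dvd_int_iff of_nat_Suc Suc_eq_plus1 add_less_mono1 less_Suc_eq_le mult_2 trans_less_add1 zero_less_Suc le_imp_less_Suc le_trans le_add1)
  ultimately have "pcong 1 (X (Suc s)) (Y (Suc s))" by (rule pcong_cancel)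
  then show ?case by (simp only: X_def Y_def)
qed simp

lemma not_dvd_2: "\<not> p dvd 2"
  using ge3 dvd_imp_le[of p 2] by auto

lemma not_dvd_power_2: "\<not> p dvd 2 ^ n"
  using not_dvd_2 prime prime_dvd_power by blast

lemma localization_divide_power_2: "x \<in> localization p \<Longrightarrow> x / 2 ^ n \<in> localization p"
  using localization_divide_nat[OF _ not_dvd_power_2, of x n] by simp

lemma localization_divide_power_8: "x \<in> localization p \<Longrightarrow> x / 8 ^ n \<in> localization p"
  using localization_divide_power_2[of x "3 * n"] by (simp add: power_mult)

text \<open>In \<open>fermat_quotient_sum\<close> the floor of \<open>2 j / p\<close> is 0 up to
  \<open>m\<close> and 1 beyond, so the sum is the full harmonic sum minus its first half.\<close>

lemma fermat_quotient_2:
  assumes m: "p = 2 * m + 1"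
  shows "pcong 1 (\<Sum>i\<in>{1..m}. 1 / of_nat i) (- 2 * fermat_quotient 2)"
proof -
  have "(\<Sum>j\<in>{1..<p}. of_nat (2 * j div p) / of_nat j)
    = (\<Sum>j\<in>{1..<p}. 1 / of_nat j - (if j \<le> m then 1 / of_nat j else 0) :: rat)"
  proof (rule sum.cong)
    fix j assume j: "j \<in> {1..<p}"
    have "2 * j div p = (if j \<le> m then 0 else 1)"
    proof (cases "j \<le> m")
      case False
      then have "2 * j div p = 1" using j by (intro div_nat_eqI) (auto simp: m)
      then show ?thesis using False by simp
    qed (simp add: m)
    then show "of_nat (2 * j div p) / of_nat j = (1 / of_nat j - (if j \<le> m then 1 / of_nat j else 0) :: rat)" by simp
  qed simp
  also have "\<dots> = (\<Sum>j\<in>{1..<p}. 1 / of_nat j) - (\<Sum>j\<in>{j \<in> {1..<p}. j \<le> m}. 1 / of_nat j)"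
    by (simp only: sum_subtractf sum.inter_filter[OF finite_atLeastLessThan])
  also have "{j \<in> {1..<p}. j \<le> m} = {1..m}" by (auto simp: m)
  finally have "pcong 1 (of_nat 2 * fermat_quotient 2) ((\<Sum>j\<in>{1..<p}. 1 / of_nat j) - (\<Sum>j\<in>{1..m}. 1 / of_nat j))"
    using fermat_quotient_sum[OF not_dvd_2] by simp
  also have "pcong 1 \<dots> (0 - (\<Sum>j\<in>{1..m}. 1 / of_nat j))"
    by (intro pcong_diff harmonic_cong_0 pcong_refl)
  finally show ?thesis using pcong_uminus[OF pcong_sym] by fastforce
qed

text \<open>Expand \<open>(1 - 1/2)^p\<close> modulo \<open>p^2\<close>: the end terms give
  \<open>1 - 2^(- p)\<close>, a middle term is \<open>- p / (i 2^i)\<close>, and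
  \<open>2^(1 - p) - 1\<close> becomes \<open>- p\<close> times the quotient of 2 after
  multiplication by the unit \<open>2^(p - 1)\<close>.\<close>

lemma sum_half_powers: "pcong 1 (\<Sum>i\<in>{1..<p}. 1 / (of_nat i * 2 ^ i)) (fermat_quotient 2)"
proof -
  define L where "L = (\<Sum>i\<in>{1..<p}. 1 / (of_nat i * 2 ^ i) :: rat)"
  have "(1 / 2 :: rat) ^ p = (\<Sum>k\<le>p * 1. of_nat (p choose k) * (- 1 / 2) ^ k)"
    using binomial_ring[of "- 1 / 2 :: rat" 1 p] by simp
  also have "\<dots> = (\<Sum>k\<le>1. of_nat (p choose (p * k)) * (- 1 / 2) ^ (p * k))
    + (\<Sum>j<(1::nat). \<Sum>i\<in>{1..<p}. of_nat (p choose (p * j + i)) * (- 1 / 2) ^ (p * j + i))"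
    by (rule sum_upto_multiple)
  also have "\<dots> = 1 + (- 1 / 2) ^ p + (\<Sum>i\<in>{1..<p}. of_nat (p choose i) * (- 1 / 2) ^ i)" by simp
  also have "(- 1 / 2 :: rat) ^ p = - ((1 / 2) ^ p)" using odd_p by simp
  finally have eq: "(\<Sum>i\<in>{1..<p}. of_nat (p choose i) * (- 1 / 2) ^ i) = (2 * (1 / 2) ^ p - 1 :: rat)" by simp
  have "pcong 2 (\<Sum>i\<in>{1..<p}. of_nat (p choose i) * (- 1 / 2) ^ i)
    (\<Sum>i\<in>{1..<p}. of_nat p * - (1 / (of_nat i * 2 ^ i)))"
  proof (rule pcong_sum)
    fix i assume i: "i \<in> {1..<p}"
    have "pcong 2 ((- 1) ^ i / 2 ^ i * of_nat (p * 1 choose (p * 0 + i)))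
      ((- 1) ^ i / 2 ^ i * (of_nat p * (of_nat 1 * of_nat (1 - 1 choose 0) * (- 1) ^ (i - 1) / of_nat i)))"
      using i by (intro pcong_scale binomial_near_multiple localization_divide_power_2) auto
    moreover have "(- 1 :: rat) ^ i * (- 1) ^ (i - 1) = - 1" using i by (cases i) auto
    then have "(- 1) ^ i / 2 ^ i * (of_nat p * (of_nat 1 * of_nat (1 - 1 choose 0) * (- 1) ^ (i - 1) / of_nat i))
      = of_nat p * - (1 / (of_nat i * 2 ^ i) :: rat)"
      using i by (simp add: field_simps)
    ultimately show "pcong 2 (of_nat (p choose i) * (- 1 / 2) ^ i) (of_nat p * - (1 / (of_nat i * 2 ^ i)))"
      unfolding power_divide[of "- 1" 2 i] by (simp add: mult.commute)
  qed
  then have 1: "pcong 2 (2 * (1 / 2) ^ p - 1) (of_nat p * - L)"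
    unfolding eq L_def sum_distrib_left[symmetric] sum_negf by simp
  have "of_nat 2 ^ (p - 1) * (2 * (1 / 2) ^ p - 1) = (of_nat p * - fermat_quotient 2 :: rat)"
  proof -
    have "(2 :: rat) ^ p = 2 * 2 ^ (p - 1)" using p_pos by (simp flip: power_Suc)
    then have "(1 / 2 :: rat) ^ p = 1 / (2 * 2 ^ (p - 1))" by (simp add: power_one_over)
    then have "of_nat 2 ^ (p - 1) * (2 * (1 / 2) ^ p - 1) = (1 - of_nat 2 ^ (p - 1) :: rat)"
      by (simp add: right_diff_distrib)
    then show ?thesis unfolding power_fermat_quotient by simp
  qed
  moreover have "pcong 2 (of_nat 2 ^ (p - 1) * (2 * (1 / 2) ^ p - 1)) (of_nat 2 ^ (p - 1) * (of_nat p * - L))"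
    using 1 by (intro pcong_scale localization_power) auto
  ultimately have "pcong 2 (of_nat p * - fermat_quotient 2) (of_nat p * (of_nat 2 ^ (p - 1) * - L))"
    by (simp add: mult.left_commute)
  then have "pcong 1 (- fermat_quotient 2) (of_nat 2 ^ (p - 1) * - L)" by (rule pcong_cancel_p)
  also have "pcong 1 (of_nat 2 ^ (p - 1) * - L) (1 * - L)"
  proof (intro pcong_mult pcong_fermat not_dvd_2 pcong_refl localization_power localization_of_nat localization_uminus)
    show "L \<in> localization p"
      unfolding L_def
    proof (rule localization_sum)
      fix i assume "i \<in> {1..<p}"
      from localization_divide_power_2[OF localization_inverse_nat[OF this], of i]
      show "1 / (of_nat i * 2 ^ i) \<in> localization p" by simp
    qed
  qed
  finally have "pcong 1 (- fermat_quotient 2) (- L)" by simp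
  from pcong_sym[OF pcong_uminus[OF this]] show ?thesis by (simp add: L_def)
qed

text \<open>Modulo \<open>p\<close> the quotient behaves like a logarithm, and
  \<open>8 = 2^3\<close>.\<close>

lemma fermat_quotient_8: "pcong 1 (fermat_quotient 8) (3 * fermat_quotient 2)"
proof (rule pcong_cancel_p)
  have "of_nat 8 ^ (p - 1) = (of_nat 2 ^ (p - 1) :: rat) ^ 3" by (simp flip: power_mult power_mult_distrib add: mult.commute power_mult)
  then have "1 + of_nat p * fermat_quotient 8 = (1 + of_nat p * fermat_quotient 2) ^ 3"
    unfolding power_fermat_quotient .
  also have "pcong 2 \<dots> (1 + of_nat p * (of_nat 3 * fermat_quotient 2))"
    by (intro pcong_one_plus_power fermat_quotient_localization not_dvd_2)
  finally show "pcong 2 (of_nat p * fermat_quotient 8) (of_nat p * (3 * fermat_quotient 2))"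
    using pcong_diff[OF _ pcong_refl[of 2 1]] by fastforce
qed

text \<open>Rearranging \<open>(i choose j) (2 j choose i)\<close> as a choice of a subset within a
  subset isolates \<open>2 j choose j\<close>, the factor that is replaced modulo \<open>p\<close>
  later.\<close>

lemma franel_alt:
  "of_int (franel i) = (\<Sum>j\<le>i. of_nat (2 * j choose j) * of_nat (i choose j) * of_nat (j choose (i - j)) :: rat)"
proof -
  have "(i choose j)^2 * (2 * j choose i) = (2 * j choose j) * (i choose j) * (j choose (i - j))" if "j \<le> i" for j
  proof (cases "i \<le> 2 * j")
    case True
    have "(2 * j choose i) * (i choose j) = (2 * j choose j) * (2 * j - j choose (i - j))"
      using that True by (rule choose_mult)
    then show ?thesis by (simp add: power2_eq_square mult_ac)
  qed (use that in \<open>simp add: binomial_eq_0\<close>)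
  then show ?thesis
    unfolding franel_def of_int_sum by (intro sum.cong) (simp_all flip: of_nat_mult of_nat_power)
qed

text \<open>Expand \<open>franel i\<close> in the basis \<open>2 j choose j\<close>, replace \<open>2 j choose j\<close> by \<open>(-4)\<^sup>j (m choose j)\<close> with \<open>p = 2 m + 1\<close>,
  and evaluate the resulting binomial sums exactly.\<close>

lemma franel_quotient:
  "pcong 1 (\<Sum>i\<in>{1..<p}. of_int (franel i) / (of_nat i * 8 ^ i)) (fermat_quotient 8)"
proof -
  obtain m where m: "p = 2 * m + 1" using odd_p by (elim oddE)
  have m_pos: "0 < m" using ge3 m by simp
  \<comment> \<open>The value is \<open>3 / 16\<close> times \<open>- 4\<close>, from replacing the
    central coefficient in \<open>scaled_central\<close>; hence \<open>1 + y = 1/4\<close> in the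
    final sums.\<close>
  define y :: rat where "y = - 3 / 4"
  define w where "w j i = (of_nat (i - 1 choose (j - 1)) * of_nat (j choose (i - j)) / 8 ^ i :: rat)" for j i
  \<comment> \<open>Absorption moves the division from \<open>i\<close> to \<open>j\<close>, after
    which the sum over \<open>i\<close> takes the form of
    \<open>sum_binomial_eighths\<close>.\<close>
  have expand: "of_int (franel i) / (of_nat i * 8 ^ i) = (\<Sum>j\<in>{1..<p}. of_nat (2 * j choose j) / of_nat j * w j i :: rat)"
    if i: "i \<in> {1..<p}" for i
  proof -
    have "of_int (franel i) / (of_nat i * 8 ^ i)
      = (\<Sum>j\<le>i. of_nat (2 * j choose j) * (of_nat (i choose j) / of_nat i) * of_nat (j choose (i - j)) / 8 ^ i :: rat)"
      unfolding franel_alt sum_divide_distrib by (rule sum.cong) simp_all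
    also have "\<dots> = (\<Sum>j\<in>{1..i}. of_nat (2 * j choose j) * (of_nat (i choose j) / of_nat i) * of_nat (j choose (i - j)) / 8 ^ i)"
      using i by (intro sum.mono_neutral_right) (auto simp: binomial_eq_0)
    also have "\<dots> = (\<Sum>j\<in>{1..i}. of_nat (2 * j choose j) / of_nat j * w j i)"
    proof (rule sum.cong)
      fix j assume j: "j \<in> {1..i}"
      have "j * (i choose j) = i * (i - 1 choose (j - 1))" using j by (intro times_binomial_minus1_eq) simp
      then have "of_nat j * of_nat (i choose j) = (of_nat i * of_nat (i - 1 choose (j - 1)) :: rat)" by (metis of_nat_mult)
      then have "of_nat (i choose j) / of_nat i = (of_nat (i - 1 choose (j - 1)) / of_nat j :: rat)"
        using i j by (simp add: frac_eq_eq mult.commute)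
      then show "of_nat (2 * j choose j) * (of_nat (i choose j) / of_nat i) * of_nat (j choose (i - j)) / 8 ^ i
        = of_nat (2 * j choose j) / of_nat j * w j i" by (simp add: w_def)
    qed simp
    also have "\<dots> = (\<Sum>j\<in>{1..<p}. of_nat (2 * j choose j) / of_nat j * w j i)"
      using i by (intro sum.mono_neutral_left) (auto simp: w_def binomial_eq_0)
    finally show ?thesis .
  qed
  \<comment> \<open>The summand lives on \<open>j <= i <= 2 j\<close>, and \<open>j <= m\<close>
    keeps this range below \<open>p\<close>, so the cut at \<open>p\<close> loses nothing.\<close>
  have inner: "(\<Sum>i\<in>{1..<p}. w j i) = franel_coeff j / 64 ^ j" if j: "j \<in> {1..m}" for j
  proof -
    have "(\<Sum>i\<in>{1..<p}. w j i) = (\<Sum>i\<in>{j..2 * j}. w j i)"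
      using j by (intro sum.mono_neutral_right) (auto simp: w_def m binomial_eq_0)
    also have "\<dots> = (\<Sum>l\<le>j. of_nat ((j + l - 1 choose l) * (j choose l)) / 8 ^ l / 8 ^ j)"
    proof (rule sum.reindex_bij_witness[of _ "\<lambda>l. j + l" "\<lambda>i. i - j"])
      fix i assume i: "i \<in> {j..2 * j}"
      have "(j + (i - j) - 1 choose (i - j)) = (i - 1 choose (j - 1))"
      proof -
        have "i - j \<le> i - 1" "i - 1 - (i - j) = j - 1" "j + (i - j) - 1 = i - 1" using i j by auto
        then show ?thesis using binomial_symmetric[of "i - j" "i - 1"] by simp
      qed
      then show "of_nat ((j + (i - j) - 1 choose (i - j)) * (j choose (i - j))) / 8 ^ (i - j) / 8 ^ j = w j i"
        using i by (simp add: w_def power_diff)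
    qed (use j in auto)
    also have "\<dots> = franel_coeff j / 8 ^ j / 8 ^ j"
    proof -
      have "0 < j" using j by simp
      then show ?thesis by (simp only: sum_divide_distrib[symmetric] sum_binomial_eighths)
    qed
    also have "\<dots> = franel_coeff j / 64 ^ j" by (simp flip: power_mult_distrib)
    finally show ?thesis .
  qed
  have locw: "w j i \<in> localization p" for j i
    unfolding w_def by (intro localization_divide_power_8 localization_mult localization_of_nat)
  have loc_coeff: "franel_coeff j \<in> localization p" for j
    unfolding franel_coeff_alt
    by (intro localization_sum localization_mult localization_power localization_of_nat localization_numeral)
  define R where "R = (\<Sum>j\<in>{1..m}. of_nat (m choose j) * ((- 1 / 16) ^ j * franel_coeff j) / of_nat j)"
  have "(\<Sum>i\<in>{1..<p}. of_int (franel i) / (of_nat i * 8 ^ i))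
    = (\<Sum>j\<in>{1..<p}. of_nat (2 * j choose j) * ((\<Sum>i\<in>{1..<p}. w j i) / of_nat j))"
  proof -
    have "(\<Sum>i\<in>{1..<p}. of_int (franel i) / (of_nat i * 8 ^ i))
      = (\<Sum>i\<in>{1..<p}. \<Sum>j\<in>{1..<p}. of_nat (2 * j choose j) / of_nat j * w j i)"
      by (rule sum.cong[OF refl expand])
    also have "\<dots> = (\<Sum>j\<in>{1..<p}. \<Sum>i\<in>{1..<p}. of_nat (2 * j choose j) / of_nat j * w j i)"
      by (rule sum.swap)
    also have "\<dots> = (\<Sum>j\<in>{1..<p}. of_nat (2 * j choose j) * ((\<Sum>i\<in>{1..<p}. w j i) / of_nat j))"
      unfolding sum_distrib_left[symmetric] by simp
    finally show ?thesis .
  qed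
  \<comment> \<open>For \<open>j > m\<close> the central coefficient is divisible by
    \<open>p\<close>, while the division by \<open>j < p\<close> leaves its cofactor
    \<open>p\<close>-integral.\<close>
  also have "pcong 1 \<dots> (\<Sum>j\<in>{1..<p}. if j \<le> m then (- 4) ^ j * of_nat (m choose j) * (franel_coeff j / 64 ^ j / of_nat j) else 0)"
  proof (rule pcong_sum)
    fix j assume j: "j \<in> {1..<p}"
    have loc: "(\<Sum>i\<in>{1..<p}. w j i) / of_nat j \<in> localization p"
      using j by (intro localization_divide_nat localization_sum locw not_dvd_small) auto
    show "pcong 1 (of_nat (2 * j choose j) * ((\<Sum>i\<in>{1..<p}. w j i) / of_nat j))
      (if j \<le> m then (- 4) ^ j * of_nat (m choose j) * (franel_coeff j / 64 ^ j / of_nat j) else 0)"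
    proof (cases "j \<le> m")
      case True
      then have "(\<Sum>i\<in>{1..<p}. w j i) = franel_coeff j / 64 ^ j" using inner j by simp
      moreover have "pcong 1 (of_nat (2 * j choose j) * ((\<Sum>i\<in>{1..<p}. w j i) / of_nat j))
        ((- 4) ^ j * of_nat (m choose j) * ((\<Sum>i\<in>{1..<p}. w j i) / of_nat j))"
        by (intro pcong_mult central_binomial_cong m True pcong_refl localization_of_nat loc)
      ultimately show ?thesis using True by simp
    next
      case False
      have "j mod p = j" using j by simp
      then have "[int (2 * j choose j) = 0] (mod int p)"
        using False m by (intro cong_central_binomial_0) simp
      then have "pcong 1 (of_nat (2 * j choose j)) 0"
        using pcong_of_nat_int[of "2 * j choose j" 0 1] by simp
      then have "pcong 1 (of_nat (2 * j choose j) * ((\<Sum>i\<in>{1..<p}. w j i) / of_nat j)) (0 * ((\<Sum>i\<in>{1..<p}. w j i) / of_nat j))"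
        by (intro pcong_mult pcong_refl localization_of_nat loc)
      then show ?thesis using False by simp
    qed
  qed
  also have "(\<Sum>j\<in>{1..<p}. if j \<le> m then (- 4) ^ j * of_nat (m choose j) * (franel_coeff j / 64 ^ j / of_nat j) else 0)
    = (\<Sum>j\<in>{j \<in> {1..<p}. j \<le> m}. (- 4) ^ j * of_nat (m choose j) * (franel_coeff j / 64 ^ j / of_nat j))"
    by (rule sum.inter_filter[symmetric]) simp
  also have "{j \<in> {1..<p}. j \<le> m} = {1..m}" by (auto simp: m)
  also have "(\<Sum>j\<in>{1..m}. (- 4) ^ j * of_nat (m choose j) * (franel_coeff j / 64 ^ j / of_nat j)) = R"
    unfolding R_def
  proof (rule sum.cong)
    fix j
    have e: "(- 1 / 16) ^ j = (- 4 :: rat) ^ j / 64 ^ j" unfolding power_divide[symmetric] by simp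
    show "(- 4) ^ j * of_nat (m choose j) * (franel_coeff j / 64 ^ j / of_nat j)
      = of_nat (m choose j) * ((- 1 / 16) ^ j * franel_coeff j) / (of_nat j :: rat)"
      unfolding e by (simp only: divide_inverse mult_ac)
  qed simp
  also have "R = (\<Sum>r\<in>{1..m}. (3 / 4 * scaled_central r - (\<Sum>s\<le>r. scaled_central s) / 4 - 1 / 2) / of_nat r)"
    unfolding R_def sum_binomial_div binomial_sum_franel_coeff_all ..
  also have "pcong 1 \<dots> (\<Sum>r\<in>{1..m}. (3 / 4 * (of_nat (m choose r) * y ^ r) - (\<Sum>s\<le>r. of_nat (m choose s) * y ^ s) / 4 - 1 / 2) / of_nat r)"
  proof (rule pcong_sum)
    fix r assume r: "r \<in> {1..m}"
    have e: "pcong 1 (scaled_central s) (of_nat (m choose s) * y ^ s)" if "s \<le> r" for s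
    proof -
      have "pcong 1 (3 ^ s / 2 ^ (4 * s) * of_nat (2 * s choose s)) (3 ^ s / 2 ^ (4 * s) * ((- 4) ^ s * of_nat (m choose s)))"
        using that r by (intro pcong_scale central_binomial_cong m localization_divide_power_2 localization_power) auto
      moreover have "3 ^ s / 2 ^ (4 * s) = (3 / 16 :: rat) ^ s" by (simp add: power_mult power_divide)
      moreover have "(3 / 16 :: rat) ^ s * ((- 4) ^ s * of_nat (m choose s)) = of_nat (m choose s) * y ^ s"
      proof -
        have "y ^ s = (3 / 16 :: rat) ^ s * (- 4) ^ s" by (simp add: y_def flip: power_mult_distrib)
        then show ?thesis by (simp only: mult_ac)
      qed
      ultimately show ?thesis by (simp add: scaled_central_def)
    qed
    have "3 / 2 ^ 2 \<in> localization p" by (intro localization_divide_power_2) simp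
    then have "pcong 1 (3 / 4 * scaled_central r) (3 / 4 * (of_nat (m choose r) * y ^ r))"
      by (intro pcong_scale e) simp_all
    moreover have "pcong 1 ((\<Sum>s\<le>r. scaled_central s) / 4) ((\<Sum>s\<le>r. of_nat (m choose s) * y ^ s) / 4)"
    proof -
      have "pcong 1 (\<Sum>s\<le>r. scaled_central s) (\<Sum>s\<le>r. of_nat (m choose s) * y ^ s)"
        by (intro pcong_sum e) simp
      from pcong_divide_nat[OF this not_dvd_power_2[of 2]] show ?thesis by simp
    qed
    ultimately have "pcong 1 (3 / 4 * scaled_central r - (\<Sum>s\<le>r. scaled_central s) / 4 - 1 / 2)
      (3 / 4 * (of_nat (m choose r) * y ^ r) - (\<Sum>s\<le>r. of_nat (m choose s) * y ^ s) / 4 - 1 / 2)"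
      by (intro pcong_diff pcong_refl)
    then show "pcong 1 ((3 / 4 * scaled_central r - (\<Sum>s\<le>r. scaled_central s) / 4 - 1 / 2) / of_nat r)
      ((3 / 4 * (of_nat (m choose r) * y ^ r) - (\<Sum>s\<le>r. of_nat (m choose s) * y ^ s) / 4 - 1 / 2) / of_nat r)"
      using r m by (intro pcong_divide_nat not_dvd_small) auto
  qed
  also have "(\<Sum>r\<in>{1..m}. (3 / 4 * (of_nat (m choose r) * y ^ r) - (\<Sum>s\<le>r. of_nat (m choose s) * y ^ s) / 4 - 1 / 2) / of_nat r)
    = 3 / 4 * (\<Sum>r\<in>{1..m}. of_nat (m choose r) * y ^ r / of_nat r)
      - (\<Sum>r\<in>{1..m}. (\<Sum>s\<le>r. of_nat (m choose s) * y ^ s) / of_nat r) / 4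
      - (\<Sum>r\<in>{1..m}. 1 / of_nat r) / 2"
  proof -
    have "(\<Sum>r\<in>{1..m}. (3 / 4 * a r - b r / 4 - 1 / 2) / of_nat r)
      = 3 / 4 * (\<Sum>r\<in>{1..m}. a r / of_nat r) - (\<Sum>r\<in>{1..m}. b r / of_nat r) / 4 - (\<Sum>r\<in>{1..m}. 1 / of_nat r) / 2"
      for a b :: "nat \<Rightarrow> rat"
      unfolding sum_distrib_left sum_divide_distrib sum_subtractf[symmetric]
      by (rule sum.cong) (simp_all add: diff_divide_distrib mult.commute)
    then show ?thesis .
  qed
  also have "\<dots> = (\<Sum>s\<in>{1..m}. ((1 / 4) ^ s - 1) / of_nat s) / 2 - (\<Sum>k\<in>{1..m}. (1 / 4) ^ (m - k) / of_nat k) / 4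
      - (\<Sum>r\<in>{1..m}. 1 / of_nat r) / 2"
  proof -
    have y1: "1 + y = 1 / 4" by (simp add: y_def)
    have "3 / 4 * a - (z + a) / 4 - h / 2 = a / 2 - z / 4 - h / 2" for a z h :: rat
      by (simp add: field_simps)
    then show ?thesis unfolding sum_binomial_power_div sum_binomial_partial_power_div y1 .
  qed
  finally have main: "pcong 1 (\<Sum>i\<in>{1..<p}. of_int (franel i) / (of_nat i * 8 ^ i))
    ((\<Sum>s\<in>{1..m}. ((1 / 4) ^ s - 1) / of_nat s) / 2 - (\<Sum>k\<in>{1..m}. (1 / 4) ^ (m - k) / of_nat k) / 4
      - (\<Sum>r\<in>{1..m}. 1 / of_nat r) / 2)" .
  \<comment> \<open>\<open>g\<close> is the summand of \<open>sum_half_powers\<close>; the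
    even-indexed half \<open>V\<close> and the odd-indexed half \<open>W\<close> are what the first
    two sums of \<open>main\<close> amount to, apart from \<open>H\<close>.\<close>
  define g where "g i = (1 / (of_nat i * 2 ^ i) :: rat)" for i
  define H where "H = (\<Sum>r\<in>{1..m}. 1 / of_nat r :: rat)"
  define V where "V = (\<Sum>k\<in>{1..m}. g (2 * k))"
  define W where "W = (\<Sum>k\<in>{1..m}. g (2 * k - 1))"
  have VW: "(\<Sum>i\<in>{1..<p}. g i) = V + W"
  proof -
    have "(\<Sum>i\<in>{1..<2 * m + 1}. g i) = (\<Sum>k\<in>{1..m}. g (2 * k)) + (\<Sum>k\<in>{1..m}. g (2 * k - 1))"
      by (induction m) (simp_all add: algebra_simps)
    then show ?thesis unfolding m V_def W_def .
  qed
  have even: "(\<Sum>s\<in>{1..m}. ((1 / 4) ^ s - 1) / of_nat s) = 2 * V - H"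
    unfolding V_def H_def g_def sum_distrib_left sum_subtractf[symmetric]
    by (rule sum.cong) (simp_all add: power_mult power_divide diff_divide_distrib)
  have odd: "pcong 1 ((\<Sum>k\<in>{1..m}. (1 / 4) ^ (m - k) / of_nat k) / 4) (- W)"
  proof -
    \<comment> \<open>The odd indices are the numbers \<open>p - 2 k\<close>; there
      \<open>(1/4)^(m - k)\<close> equals \<open>2 / 2^(p - 2 k)\<close>, and
      \<open>1 / (2 k)\<close> is \<open>- 1 / (p - 2 k)\<close> modulo \<open>p\<close>.\<close>
    have "W = (\<Sum>k\<in>{1..m}. g (p - 2 * k))"
      unfolding W_def by (rule sum.reindex_bij_witness[of _ "\<lambda>k. m + 1 - k" "\<lambda>k. m + 1 - k"])
        (auto simp: m intro!: arg_cong[of _ _ g])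
    moreover have "pcong 1 (\<Sum>k\<in>{1..m}. (1 / 4) ^ (m - k) / of_nat k / 4) (\<Sum>k\<in>{1..m}. - g (p - 2 * k))"
    proof (rule pcong_sum)
      fix k assume k: "k \<in> {1..m}"
      then have k2: "p - 2 * k \<in> {1..<p}" "2 * k \<in> {1..<p}" by (auto simp: m)
      have f: "(of_nat (p - 2 * k) :: rat) = of_nat p - 2 * of_nat k" using k2 by (simp add: of_nat_diff)
      define u :: rat where "u = 1 / 2 ^ (p - 2 * k)"
      have "(1 / 4 :: rat) ^ (m - k) = 2 * u"
      proof -
        have "p - 2 * k = Suc (2 * (m - k))" using k unfolding m atLeastAtMost_iff by arith
        then show ?thesis by (simp add: u_def power_mult power_divide)
      qed
      then have "(1 / 4) ^ (m - k) / of_nat k / 4 - - g (p - 2 * k) = u / (2 * of_nat k) + u / of_nat (p - 2 * k)"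
        by (simp add: g_def u_def mult.commute)
      also have "\<dots> = of_nat p ^ 1 * (u * (1 / of_nat (2 * k)) * (1 / of_nat (p - 2 * k)))"
        using k k2 unfolding f by (simp add: field_simps)
      finally have "(1 / 4) ^ (m - k) / of_nat k / 4 - - g (p - 2 * k)
        = of_nat p ^ 1 * (u * (1 / of_nat (2 * k)) * (1 / of_nat (p - 2 * k)))" .
      moreover have "u * (1 / of_nat (2 * k)) * (1 / of_nat (p - 2 * k)) \<in> localization p"
        unfolding u_def by (intro localization_mult localization_inverse_nat k2 localization_divide_power_2 localization_1)
      ultimately show "pcong 1 ((1 / 4) ^ (m - k) / of_nat k / 4) (- g (p - 2 * k))" unfolding pcong_def by blast
    qed
    ultimately show ?thesis by (simp add: sum_divide_distrib sum_negf)
  qed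
  note main
  also have "pcong 1 ((\<Sum>s\<in>{1..m}. ((1 / 4) ^ s - 1) / of_nat s) / 2 - (\<Sum>k\<in>{1..m}. (1 / 4) ^ (m - k) / of_nat k) / 4
      - (\<Sum>r\<in>{1..m}. 1 / of_nat r) / 2) ((2 * V - H) / 2 - - W - H / 2)"
    unfolding even H_def by (intro pcong_diff pcong_refl odd)
  \<comment> \<open>The sum of \<open>g\<close> yields the quotient of 2 once and \<open>- H\<close>
    yields it twice, in total the quotient of 8.\<close>
  also have "(2 * V - H) / 2 - - W - H / 2 = (\<Sum>i\<in>{1..<p}. g i) - H"
    unfolding VW by (simp add: field_simps)
  also have "pcong 1 \<dots> (fermat_quotient 2 - - 2 * fermat_quotient 2)"
    unfolding H_def g_def by (intro pcong_diff sum_half_powers fermat_quotient_2 m)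
  also have "fermat_quotient 2 - - 2 * fermat_quotient 2 = 3 * fermat_quotient 2" by simp
  also have "pcong 1 \<dots> (fermat_quotient 8)" by (rule pcong_sym[OF fermat_quotient_8])
  finally show ?thesis .
qed

section \<open>Assembly for one sequence, and the sequence F\<close>

lemma gessel_lucas_nat_solution:
  assumes "apery_seq r A" "formal_derivative r A A'" "nat_solution r (\<lambda>n. of_int (a n))"
    and "\<And>n. [a (p * n) = a n] (mod int p ^ 2)" "linear_term r \<noteq> 0 \<Longrightarrow> int p dvd a (p - 1)" "k < p"
  shows "cong_localization p (A (int (p * n + k)))
    (A (int k) * A (int n) + of_nat (p * n) * A' (int k) * A (int n)) (p^2)"
  using assms by (intro gessel_lucas[where a = a] apery_seq_eqI)

text \<open>The Franel numbers have a direct supercongruence, so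
  \<open>gessel_lucas_nat_solution\<close> already applies to them; read modulo \<open>p\<close>,
  its derivative term drops out. The result serves as \<open>v_lucas\<close> for the sequence
  F.\<close>

lemma franel_lucas:
  assumes "i < p"
  shows "pcong 1 (of_int (franel (p * j + i))) (of_int (franel j) * of_int (franel i))"
proof -
  let ?r = "Quadratic 7 2 (- 8)"
  obtain A where A: "apery_seq ?r A" using apery_seq_ex1 by blast
  obtain A' where A': "formal_derivative ?r A A'" using formal_derivative_ex1 by blast
  have int: "A (int n) = of_int (franel n)" for n
    by (rule apery_seq_eqI[OF A nat_solution_franel])
  have neg: "A j = 0" if "j < 0" for j using A that by (simp add: apery_seq_def)
  have "cong_localization p (A (int (p * j + i))) (A (int i) * A (int j) + of_nat (p * j) * A' (int i) * A (int j)) (p^2)"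
    by (rule gessel_lucas_nat_solution[OF A A' nat_solution_franel super_franel _ assms]) simp
  then have "pcong 2 (A (int (p * j + i))) (A (int i) * A (int j) + of_nat (p * j) * A' (int i) * A (int j))"
    unfolding cong_localization_iff by blast
  then have "pcong 1 (A (int (p * j + i))) (A (int i) * A (int j) + of_nat (p * j) * A' (int i) * A (int j))"
    by (rule pcong_mono) simp
  also have "pcong 1 \<dots> (A (int i) * A (int j) + 0)"
  proof (intro pcong_add pcong_refl pcong_0I)
    have "A' (int i) \<in> localization p" by (rule formal_derivative_localization[OF int neg A' assms])
    then show "of_nat j * A' (int i) * A (int j) \<in> localization p"
      unfolding int by (intro localization_mult) auto
  qed simp
  finally show ?thesis unfolding int add_0_right by (simp only: mult.commute)
qed

text \<open>The case \<open>d = 1\<close>, \<open>c = 8\<close> of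
  \<open>super_weighted_sum\<close>, with \<open>v\<close> constant in its first argument and
  \<open>h\<close> the Franel numbers themselves; the factors 1 in the sums only match its
  shape.\<close>

lemma super_zagier_F: "[zagier_F_of franel (p * n) = zagier_F_of franel n] (mod int p ^ 2)"
proof -
  have nd8: "\<not> p dvd 8" using not_dvd_power_2[of 3] by simp
  define v :: "nat \<Rightarrow> nat \<Rightarrow> rat" where "v N k = of_int (franel k)" for N k
  define h :: "nat \<Rightarrow> rat" where "h i = of_int (franel i)" for i
  have F: "of_int (zagier_F_of franel N) = (\<Sum>k\<le>N. (- 1) ^ k * of_nat 8 ^ (N - 1 * k) * of_nat (N choose (1 * k)) * v N k)" for N
    by (simp add: zagier_F_of_def v_def)
  have "pcong 2 (of_int (zagier_F_of franel (p * n))) (of_int (zagier_F_of franel n))"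
    unfolding F
  proof (rule super_weighted_sum[where h = h])
    show "pcong 2 (v (p * n) (p * k)) (v n k)" for k
      unfolding v_def pcong_of_int by (rule super_franel)
    show "pcong 1 (v (p * n) (p * j + i)) (v n j * h i)" if "i \<in> {1..<p}" for j i
      unfolding v_def h_def using that by (intro franel_lucas) simp
    have "(\<Sum>i\<in>{1..<p}. if 1 * i < p then h i / (of_nat (1 * i) * of_nat 8 ^ (1 * i)) else 0)
      = (\<Sum>i\<in>{1..<p}. of_int (franel i) / (of_nat i * 8 ^ i))"
      by (rule sum.cong) (auto simp: h_def)
    then show "pcong 1 (\<Sum>i\<in>{1..<p}. if 1 * i < p then h i / (of_nat (1 * i) * of_nat 8 ^ (1 * i)) else 0) (fermat_quotient 8)"
      using franel_quotient by simp
  qed (use nd8 prime in \<open>auto simp: v_def h_def\<close>)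
  then show ?thesis unfolding pcong_of_int .
qed

text \<open>Let \<open>r\<close> be the last digit of \<open>k\<close>. If \<open>p < 2 r\<close>,
  then \<open>2 k choose k\<close> vanishes; if \<open>2 r < p < 3 r\<close>, the last digit of
  \<open>3 k\<close> is \<open>3 r - p < r\<close> and \<open>3 k choose k\<close> vanishes.\<close>

lemma trinomial_cong_0:
  assumes "p < 3 * (k mod p)"
  shows "[int (3 * k choose k) * int (2 * k choose k) = 0] (mod int p)"
proof (cases "p < 2 * (k mod p)")
  case True
  then show ?thesis using cong_mult[OF cong_refl cong_central_binomial_0] by simp
next
  case False
  define q r where "q = k div p" and "r = k mod p"
  have k: "k = p * q + r" and r: "r < p" using p_pos by (simp_all add: q_def r_def)
  moreover have "2 * r \<noteq> p" using odd_p by (metis dvd_triv_left)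
  ultimately have "3 * r - p < r" "p < 3 * r" using False assms by (simp_all add: r_def)
  then have "[int (3 * k choose k) = 0] (mod int p)"
    using r by (intro lucas_0[of _ "3 * q + 1" "3 * r - p" k q r]) (simp_all add: k algebra_simps)
  then show ?thesis using cong_mult[OF _ cong_refl, of _ 0] by simp
qed

end

section \<open>Supercongruences for the sequences B and \<delta>\<close>

definition trinomial_sum :: "(nat \<Rightarrow> nat \<Rightarrow> int) \<Rightarrow> nat \<Rightarrow> int" where
  "trinomial_sum w n = (\<Sum>k\<le>n. (- 1)^k * 3^(n - 3 * k) * (int ((n choose (3 * k)) * (3 * k choose k) * (2 * k choose k)) * w n k))"

context odd_prime
begin

text \<open>The case \<open>c = d = 3\<close> of \<open>super_weighted_sum\<close>, where 3 has to
  be a unit. Modulo \<open>p\<close> the factor \<open>w\<close> depends on \<open>j\<close> only,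
  so \<open>h\<close> comes from the two coefficients \<open>3 i choose i\<close> and
  \<open>2 i choose i\<close> alone.\<close>

lemma super_trinomial_sum_ne_3:
  assumes "p \<noteq> 3"
    and w_multiple: "\<And>k. [w (p * n) (p * k) = w n k] (mod int p ^ 2)"
    and w_lucas: "\<And>j i. i \<in> {1..<p} \<Longrightarrow> [w (p * n) (p * j + i) = w n j] (mod int p)"
  shows "[trinomial_sum w (p * n) = trinomial_sum w n] (mod int p ^ 2)"
proof -
  have nd: "\<not> p dvd 3" using assms ge3 dvd_imp_le[of p 3] by auto
  have three: "\<not> 3 dvd p" using assms prime by (auto simp: prime_nat_iff)
  define v :: "nat \<Rightarrow> nat \<Rightarrow> rat" where "v N k = of_int (int (3 * k choose k) * int (2 * k choose k) * w N k)" for N k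
  define h :: "nat \<Rightarrow> rat" where "h i = of_int (int (3 * i choose i) * int (2 * i choose i))" for i
  have h_0: "pcong 1 (h i) 0" if "i \<in> {1..<p}" "p < 3 * i" for i
    using that trinomial_cong_0[of i] pcong_of_int[of 1 "int (3 * i choose i) * int (2 * i choose i)" 0] by (simp add: h_def)
  have T: "of_int (trinomial_sum w N) = (\<Sum>k\<le>N. (- 1) ^ k * of_nat 3 ^ (N - 3 * k) * of_nat (N choose (3 * k)) * v N k)" for N
    by (simp add: trinomial_sum_def v_def mult.assoc)
  have "pcong 2 (of_int (trinomial_sum w (p * n))) (of_int (trinomial_sum w n))"
    unfolding T
  proof (rule super_weighted_sum[where h = h])
    show "pcong 2 (v (p * n) (p * k)) (v n k)" for k
      unfolding v_def pcong_of_int by (intro cong_mult babbage' w_multiple) simp_all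
    show "pcong 1 (v (p * n) (p * j + i)) (v n j * h i)" if i: "i \<in> {1..<p}" for j i
    proof (cases "3 * i < p")
      case True
      then have "[int (3 * (p * j + i) choose (p * j + i)) = int (3 * j choose j) * int (3 * i choose i)] (mod int p)"
        "[int (2 * (p * j + i) choose (p * j + i)) = int (2 * j choose j) * int (2 * i choose i)] (mod int p)"
        using i lucas'[of "3 * (p * j + i)" "3 * j" "3 * i" "p * j + i" j i] lucas'[of "2 * (p * j + i)" "2 * j" "2 * i" "p * j + i" j i]
        by (simp_all add: algebra_simps)
      then have "[int (3 * (p * j + i) choose (p * j + i)) * int (2 * (p * j + i) choose (p * j + i)) * w (p * n) (p * j + i)
        = (int (3 * j choose j) * int (3 * i choose i)) * (int (2 * j choose j) * int (2 * i choose i)) * w n j] (mod int p ^ 1)"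
        using w_lucas[OF i] unfolding power_one_right by (intro cong_mult)
      then have "pcong 1 (v (p * n) (p * j + i))
        (of_int ((int (3 * j choose j) * int (3 * i choose i)) * (int (2 * j choose j) * int (2 * i choose i)) * w n j))"
        unfolding v_def pcong_of_int .
      then show ?thesis by (simp add: v_def h_def mult_ac)
    next
      case False
      have "3 * i \<noteq> p" using three by auto
      then have pi: "p < 3 * i" using False by simp
      have "(p * j + i) mod p = i" using i by simp
      then have "[int (3 * (p * j + i) choose (p * j + i)) * int (2 * (p * j + i) choose (p * j + i)) * w (p * n) (p * j + i)
        = 0 * w (p * n) (p * j + i)] (mod int p ^ 1)"
        using pi unfolding power_one_right by (intro cong_mult cong_refl trinomial_cong_0) simp
      then have "pcong 1 (v (p * n) (p * j + i)) (of_int (0 * w (p * n) (p * j + i)))"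
        unfolding v_def pcong_of_int .
      also have "of_int (0 * w (p * n) (p * j + i)) = v n j * 0" by simp
      also have "pcong 1 \<dots> (v n j * h i)"
        using i pi by (intro pcong_scale pcong_sym[OF h_0]) (simp_all add: v_def del: of_int_mult)
      finally show ?thesis .
    qed
    have "(\<Sum>i\<in>{1..<p}. if 3 * i < p then h i / (of_nat (3 * i) * of_nat 3 ^ (3 * i)) else 0)
      = (\<Sum>i\<in>{1..<p}. if 3 * i < p then of_nat (3 * i choose i) * of_nat (2 * i choose i) / (of_nat (3 * i) * of_nat 3 ^ (3 * i)) else 0)"
      by (rule sum.cong) (simp_all add: h_def)
    then show "pcong 1 (\<Sum>i\<in>{1..<p}. if 3 * i < p then h i / (of_nat (3 * i) * of_nat 3 ^ (3 * i)) else 0) (fermat_quotient 3)"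
      using trinomial_quotient[OF assms(1)] by simp
    show "\<not> p dvd 3" "\<not> p dvd 3" by (fact nd)+
    show "pcong 1 (h i) 0" if "i \<in> {1..<p}" "p < 3 * i" for i using that by (rule h_0)
  qed (simp_all add: v_def h_def del: of_int_mult)
  then show ?thesis unfolding pcong_of_int .
qed

text \<open>Modulo 9, only the summand with \<open>k = n div 3\<close> survives.\<close>

lemma super_trinomial_sum_3:
  assumes p: "p = 3"
    and w_multiple: "\<And>n k. [w (p * n) (p * k) = w n k] (mod int p ^ 2)"
    and w_lucas: "\<And>n j i. i \<in> {1..<p} \<Longrightarrow> [w (p * n) (p * j + i) = w n j] (mod int p)"
  shows "[trinomial_sum w (p * n) = trinomial_sum w n] (mod int p ^ 2)"
proof -
  define t where "t N k = (- 1)^k * 3^(N - 3 * k) * (int ((N choose (3 * k)) * (3 * k choose k) * (2 * k choose k)) * w N k)" for N k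
  have single: "[trinomial_sum w N = t N (N div 3)] (mod 9)" for N
  proof -
    have "trinomial_sum w N = t N (N div 3) + (\<Sum>k\<in>{..N} - {N div 3}. t N k)"
      unfolding trinomial_sum_def t_def by (intro sum.remove) auto
    also have "[\<dots> = t N (N div 3) + (\<Sum>k\<in>{..N} - {N div 3}. 0)] (mod 9)"
    proof (intro cong_add cong_refl cong_sum)
      fix k assume k: "k \<in> {..N} - {N div 3}"
      have N: "N = 3 * (N div 3) + N mod 3" "N mod 3 < 3" by simp_all
      show "[t N k = 0] (mod 9)"
      proof (cases "k < N div 3")
        case True
        \<comment> \<open>Below the last admissible \<open>k\<close> the exponent of 3 is at least
          2, which makes the summand 0 modulo 9.\<close>
        then have "2 \<le> N - 3 * k" using N by linarith
        then have "(3 :: int) ^ 2 dvd 3 ^ (N - 3 * k)" by (rule le_imp_power_dvd)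
        then show ?thesis by (simp add: t_def cong_0_iff)
      next
        case False
        then have "N div 3 < k" using k by auto
        then have "N < 3 * k" using N by linarith
        then show ?thesis by (simp add: t_def binomial_eq_0)
      qed
    qed
    finally show ?thesis by simp
  qed
  define m where "m = n div 3"
  have top: "t (3 * n) n = (- 1)^n * (int (3 * n choose n) * int (2 * n choose n) * w (3 * n) n)"
    by (simp add: t_def)
  have "[t (3 * n) n = t n m] (mod 9)"
  proof -
    \<comment> \<open>The surviving summands are \<open>k = n\<close> for \<open>3 n\<close> and
      \<open>k = m\<close> for \<open>n\<close>; the exponent of 3 in the latter is
      \<open>n mod 3\<close>, which decides how it must be matched.\<close>
    consider "n = 3 * m" | "n = 3 * m + 1" | "n = 3 * m + 2" unfolding m_def by linarith
    then show ?thesis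
    proof cases
      case 1
      have sgn: "(- 1 :: int)^n = (- 1)^m" using minus_one_power_p[of m] unfolding 1 p .
      have "[int (3 * n choose n) = int (3 * m choose m)] (mod 3 ^ 2)"
        using babbage'[of "3 * n" "3 * m" n m] 1 unfolding p by simp
      moreover have "[int (2 * n choose n) = int (2 * m choose m)] (mod 3 ^ 2)"
        using babbage'[of "2 * n" "2 * m" n m] 1 unfolding p by simp
      moreover have "[w (3 * n) n = w n m] (mod 3 ^ 2)"
        using w_multiple[of n m] 1 unfolding p by simp
      ultimately have "[(- 1)^n * (int (3 * n choose n) * int (2 * n choose n) * w (3 * n) n)
        = (- 1)^m * (int (3 * m choose m) * int (2 * m choose m) * w n m)] (mod 3 ^ 2)"
        unfolding sgn by (intro cong_mult cong_refl)
      then show ?thesis unfolding top using 1 by (simp add: t_def)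
    next
      case 2
      have sgn: "(- 1 :: int)^n = - ((- 1)^m)" using minus_one_power_p[of m] unfolding 2 p by (simp add: power_add)
      have "pcong 2 (of_nat (p * n choose (p * m + 1))) (of_nat p * (of_nat n * of_nat (n - 1 choose m) * (- 1)^(1 - 1) / of_nat 1))"
        using 2 p by (intro binomial_near_multiple) auto
      then have "pcong 2 (of_int (int (p * n choose (p * m + 1)))) (of_int (int p * (int n * int (n - 1 choose m))))" by simp
      then have a: "[int (3 * n choose n) = 3 * (int n * int (3 * m choose m))] (mod 3 ^ 2)"
        unfolding pcong_of_int using 2 p by simp
      have "[int (2 * n choose n) = int (2 * m choose m) * int (2 choose 1)] (mod int p)"
        using 2 p by (intro lucas') auto
      moreover have "[w (p * n) (p * m + 1) = w n m] (mod int p)" using p by (intro w_lucas) auto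
      ultimately have b: "[int (2 * n choose n) * w (3 * n) n = int (2 * m choose m) * 2 * w n m] (mod 3)"
        using 2 unfolding p by (intro cong_mult) simp_all
      obtain x where x: "int (3 * n choose n) = 3 * (int n * int (3 * m choose m)) + 9 * x"
      proof -
        have "9 dvd int (3 * n choose n) - 3 * (int n * int (3 * m choose m))" using a by (simp add: cong_iff_dvd_diff)
        then obtain x where "int (3 * n choose n) - 3 * (int n * int (3 * m choose m)) = 9 * x" by (elim dvdE)
        then show ?thesis using that[of x] by linarith
      qed
      obtain z where z: "int (2 * n choose n) * w (3 * n) n = int (2 * m choose m) * 2 * w n m + 3 * z"
      proof -
        have "3 dvd int (2 * n choose n) * w (3 * n) n - int (2 * m choose m) * 2 * w n m" using b by (simp add: cong_iff_dvd_diff)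
        then obtain z where "int (2 * n choose n) * w (3 * n) n - int (2 * m choose m) * 2 * w n m = 3 * z" by (elim dvdE)
        then show ?thesis using that[of z] by linarith
      qed
      have "t (3 * n) n = - ((- 1)^m) * (int (3 * n choose n) * (int (2 * n choose n) * w (3 * n) n))"
        unfolding top sgn by simp
      moreover have "t n m = (- 1)^m * 3 * (int n * int (3 * m choose m) * int (2 * m choose m) * w n m)"
        using 2 by (simp add: t_def algebra_simps)
      \<comment> \<open>Up to multiples of 9 the two summands are \<open>- 6\<close> and
        \<open>3\<close> times the same product, and these coefficients differ by 9.\<close>
      moreover have "- s * ((3 * (n' * a) + 9 * x) * (b * 2 * w' + 3 * z)) - s * 3 * (n' * a * b * w')
        = 9 * (- s * (n' * a * b * w' + n' * a * z + x * (b * 2 * w' + 3 * z)))" for s n' a b w' :: int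
        by algebra
      ultimately have "t (3 * n) n - t n m = 9 * (- ((- 1)^m) * (int n * int (3 * m choose m) * int (2 * m choose m) * w n m
        + int n * int (3 * m choose m) * z + x * (int (2 * m choose m) * 2 * w n m + 3 * z)))"
        unfolding x z by (simp only:)
      then show ?thesis unfolding cong_iff_dvd_diff by simp
    next
      case 3
      \<comment> \<open>Both \<open>3 n choose n\<close> and \<open>2 n choose n\<close> contain a
        factor 3, matching the explicit \<open>3^2\<close> in the summand for
        \<open>n\<close>.\<close>
      have "n mod 3 = 2" using 3 by presburger
      then have "\<not> p dvd n" "p < 2 * (n mod p)" unfolding p dvd_eq_mod_eq_0 by simp_all
      then have "[int (p * n choose n) = 0] (mod int p)" "[int (2 * n choose n) = 0] (mod int p)"
        by (auto intro: cong_binomial_0 cong_central_binomial_0)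
      then have "[int (p * n choose n) * int (2 * n choose n) = 0] (mod int p ^ 2)" by (rule cong_p2_0)
      then have "9 dvd int (3 * n choose n) * int (2 * n choose n)" by (simp add: p cong_0_iff)
      then have "9 dvd t (3 * n) n" unfolding top by simp
      moreover have "9 dvd t n m" using 3 by (simp add: t_def)
      ultimately show ?thesis unfolding cong_iff_dvd_diff by (rule dvd_diff)
    qed
  qed
  then have "[trinomial_sum w (3 * n) = trinomial_sum w n] (mod 9)"
    using single[of "3 * n"] single[of n] unfolding m_def by (simp add: cong_def)
  then show ?thesis by (simp add: p)
qed

lemma super_trinomial_sum:
  assumes "\<And>n k. [w (p * n) (p * k) = w n k] (mod int p ^ 2)"
    and "\<And>n j i. i \<in> {1..<p} \<Longrightarrow> [w (p * n) (p * j + i) = w n j] (mod int p)"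
  shows "[trinomial_sum w (p * n) = trinomial_sum w n] (mod int p ^ 2)"
proof (cases "p = 3")
  case True
  then show ?thesis using assms by (rule super_trinomial_sum_3)
next
  case False
  then show ?thesis using assms by (rule super_trinomial_sum_ne_3)
qed

lemma super_zagier_B: "[zagier_B (p * n) = zagier_B n] (mod int p ^ 2)"
proof -
  have "zagier_B = trinomial_sum (\<lambda>_ _. 1)" by (simp add: fun_eq_iff zagier_B_def trinomial_sum_def)
  then show ?thesis using super_trinomial_sum[of "\<lambda>_ _. 1" n] by simp
qed

lemma super_sequence_delta: "[sequence_delta (p * n) = sequence_delta n] (mod int p ^ 2)"
proof -
  have "sequence_delta = trinomial_sum (\<lambda>n k. int (n + k choose k))"
    by (simp add: fun_eq_iff sequence_delta_def trinomial_sum_def mult.assoc)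
  moreover have "[trinomial_sum (\<lambda>n k. int (n + k choose k)) (p * n) = trinomial_sum (\<lambda>n k. int (n + k choose k)) n] (mod int p ^ 2)"
  proof (rule super_trinomial_sum)
    show "[int (p * n + p * k choose (p * k)) = int (n + k choose k)] (mod int p ^ 2)" for n k
      by (rule babbage') (simp_all add: algebra_simps)
    \<comment> \<open>Lucas splits off the low-digit coefficient \<open>i choose i = 1\<close>, so
      no factor depending on \<open>i\<close> is left.\<close>
    show "[int (p * n + (p * j + i) choose (p * j + i)) = int (n + j choose j)] (mod int p)" if "i \<in> {1..<p}" for n j i
      using lucas'[of "p * n + (p * j + i)" "n + j" i "p * j + i" j i] that by (simp add: algebra_simps)
  qed
  ultimately show ?thesis by simp
qed

end

theorem theorem1p3:
  fixes r :: apery_rec and A A' :: "int \<Rightarrow> rat" and p n k :: nat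
  assumes "r \<in> sporadic"
    and "apery_seq r A"
    and "formal_derivative r A A'"
    and "prime p" and "p \<ge> 3"
    and "k < p"
  shows "cong_localization p
           (A (int (p * n + k)))
           (A (int k) * A (int n) + of_nat (p * n) * A' (int k) * A (int n))
           (p^2)"
proof -
  interpret odd_prime p by unfold_locales (use assms in auto)
  consider "r = Quadratic 7 2 (- 8)"
    | "r = Quadratic 9 3 27"
    | "r = Quadratic 10 3 9"
    | "r = Quadratic 11 3 (- 1)"
    | "r = Quadratic 12 4 32"
    | "r = Quadratic 17 6 72"
    | "r = Cubic 10 4 64 0"
    | "r = Cubic 17 5 1 0"
    | "r = Cubic 7 3 81 0"
    | "r = Cubic 12 4 16 0"
    | "r = Cubic 11 5 125 0"
    | "r = Cubic 9 3 (- 27) 0"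
    | "r = Cubic 13 4 (- 27) 3"
    | "r = Cubic 6 2 (- 64) 4"
    | "r = Cubic 14 6 192 (- 12)"
    using assms(1) unfolding sporadic_def zagier_def almkvist_zudilin_def cooper_def by blast
  then show ?thesis
  proof cases
    case 1
    show ?thesis
      by (rule gessel_lucas_nat_solution[OF assms(2,3)[unfolded 1] nat_solution_franel super_franel _ assms(6)]) (simp)
  next
    case 2
    show ?thesis
      by (rule gessel_lucas_nat_solution[OF assms(2,3)[unfolded 2] nat_solution_zagier_B super_zagier_B _ assms(6)]) (simp)
  next
    case 3
    show ?thesis
      by (rule gessel_lucas_nat_solution[OF assms(2,3)[unfolded 3] nat_solution_zagier_C super_zagier_C _ assms(6)]) (simp)
  next
    case 4
    show ?thesis
      by (rule gessel_lucas_nat_solution[OF assms(2,3)[unfolded 4] nat_solution_zagier_D super_zagier_D _ assms(6)]) (simp)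
  next
    case 5
    show ?thesis
      by (rule gessel_lucas_nat_solution[OF assms(2,3)[unfolded 5] nat_solution_zagier_E super_zagier_E _ assms(6)]) (simp)
  next
    case 6
    show ?thesis
      by (rule gessel_lucas_nat_solution[OF assms(2,3)[unfolded 6] nat_solution_zagier_F_of[OF nat_solution_franel] super_zagier_F _ assms(6)]) (simp)
  next
    case 7
    show ?thesis
      by (rule gessel_lucas_nat_solution[OF assms(2,3)[unfolded 7] nat_solution_domb super_domb _ assms(6)]) (simp)
  next
    case 8
    show ?thesis
      by (rule gessel_lucas_nat_solution[OF assms(2,3)[unfolded 8] nat_solution_apery super_apery _ assms(6)]) (simp)
  next
    case 9
    show ?thesis
      by (rule gessel_lucas_nat_solution[OF assms(2,3)[unfolded 9] nat_solution_sequence_delta super_sequence_delta _ assms(6)]) (simp)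
  next
    case 10
    show ?thesis
      by (rule gessel_lucas_nat_solution[OF assms(2,3)[unfolded 10] nat_solution_sequence_epsilon super_sequence_epsilon _ assms(6)]) (simp)
  next
    case 11
    show ?thesis
      by (rule gessel_lucas_nat_solution[OF assms(2,3)[unfolded 11] nat_solution_sequence_eta super_sequence_eta _ assms(6)]) (simp)
  next
    case 12
    show ?thesis
      by (rule gessel_lucas_nat_solution[OF assms(2,3)[unfolded 12] nat_solution_sequence_zeta super_sequence_zeta _ assms(6)]) (simp)
  next
    case 13
    show ?thesis
      by (rule gessel_lucas_nat_solution[OF assms(2,3)[unfolded 13] nat_solution_cooper_7 super_cooper_7 _ assms(6)]) (rule dvd_cooper_7)
  next
    case 14
    show ?thesis
      by (rule gessel_lucas_nat_solution[OF assms(2,3)[unfolded 14] nat_solution_cooper_10 super_cooper_10 _ assms(6)]) (rule dvd_cooper_10)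
  next
    case 15
    show ?thesis
      by (rule gessel_lucas_nat_solution[OF assms(2,3)[unfolded 15] nat_solution_cooper_18 super_cooper_18 _ assms(6)]) (rule dvd_cooper_18)
  qed
qed

end
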